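(* Assume that $\omega(x,e)=\frac1{2d}$ for all $x\in\mathbb{Z}^d$ and all $e\in\mathbb{Z}^d$ with $|e|=1$, for $\mathbb{P}$-almost every $\omega$, and that $\int_0^\infty s\,\sigma_0(ds)\in L^d(\mathbf{P})$. Then for any $x\in\mathbb{R}^d$, $$I(\ell x)=\frac d2\,\mathbf{E}\left[\int_0^\infty s\,\sigma_0(ds)\right]\ell^2\,\|x\|_2^2\,(1+o(1))\qquad\text{as }\ell\to0,$$ where $\|x\|_2$ is the Euclidean norm of $x$.
   Context: Fix $d\ge1$; $|x|=|x_1|+\dots+|x_d|$ is the $l^1$-norm on $\mathbb{R}^d$. Let $\mathcal{P}_1$ be the space of probability measures on $\{e\in\mathbb{Z}^d:|e|=1\}$ and $\Omega=\mathcal{P}_1^{\mathbb{Z}^d}$ with the product $\sigma$-field and an i.i.d. (product) probability measure $\mathbb{P}$. For an environment $\omega=(\omega(x,\cdot))_{x\in\mathbb{Z}^d}\in\Omega$, $P_\omega^x$ is the law of the Markov chain $X=(X_n)_{n\ge0}$ on $\mathbb{Z}^d$ with $P_\omega^x(X_0=x)=1$ and $P_\omega^x(X_{n+1}=y+e\mid X_n=y)=\omega(y,e)$. Let $\mathcal{P}_2$ be the space of Borel probability measures on $(0,\infty)$ and $\Sigma=\mathcal{P}_2^{\mathbb{Z}^d}$ with the canonical $\sigma$-field and an i.i.d. (product) probability measure $\mathbf{P}$. For $\sigma=(\sigma_x)_{x\in\mathbb{Z}^d}\in\Sigma$, under $P^{\mathrm{HT}}_\sigma$ the holding times $\tau=(\tau_n(x))_{n\ge0,x\in\mathbb{Z}^d}$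 are independent and $\tau_n(x)$ has law $\sigma_x$ for all $n$. The continuous-time process $(Z_t)_{t\ge0}$ is $Z_t=X_n$ if $\sum_{m=0}^{n-1}\tau_m(X_m)\le t<\sum_{m=0}^{n}\tau_m(X_m)$ (empty sum $=0$), and $Z_t=\Delta$ (a graveyard state) if $t\ge\sum_{m=0}^\infty\tau_m(X_m)$. Put $\tilde P^x_{\omega,\sigma}=P^x_\omega\otimes P^{\mathrm{HT}}_\sigma$. Expectations with respect to $\mathbb{P},\mathbf{P},\tilde P^x_{\omega,\sigma}$ are $\mathbb{E},\mathbf{E},\tilde E^x_{\omega,\sigma}$. With $H^Z(y)=\inf\{t\ge0:Z_t=y\}$, set $a_\lambda(x,y,\omega,\sigma)=-\log\tilde E^x_{\omega,\sigma}[\exp\{-\lambda H^Z(y)\}\mathbf{1}_{\{H^Z(y)<\infty\}}]$ for $\lambda\ge0$, $x,y\in\mathbb{Z}^d$. The Lyapunov exponent $\alpha_\lambda:\mathbb{R}^d\to[0,\infty)$ is the nonrandom function given for $x\in\mathbb{Z}^d$ by $\alpha_\lambda(x)=\lim_{n\to\infty}\frac1n a_\lambda(0,nx,\omega,\sigma)$ ($\mathbb{P}\otimes\mathbf{P}$-a.s. and in $L^1$), extended to $\mathbb{Q}^d$ by $\alpha_\lambda(x/q)=\alpha_\lambda(x)/q$ for $q\in\mathbb{N}$, and to $\mathbb{R}^d$ by continuity. The rate function is $I(x)=\sup_{\lambda\ge0}(\alpha_\lambda(x)-\lambda)$. *)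

theory Defs
  imports "HOL-Probability.Probability"
begin

text \<open>The lattice \<open>\<int>\<^sup>d\<close> is \<^typ>\<open>int ^ 'd\<close> and \<open>\<real>\<^sup>d\<close> is
  \<^typ>\<open>real ^ 'd\<close>, for an arbitrary finite index type, so that \<open>d = CARD('d) \<ge> 1\<close>.\<close>

definition lattice_l1 :: "int ^ 'd \<Rightarrow> int" where
  "lattice_l1 x = (\<Sum>i\<in>UNIV. \<bar>x $ i\<bar>)"

definition lattice_to_real :: "int ^ 'd \<Rightarrow> real ^ 'd" where
  "lattice_to_real x = (\<chi> i. real_of_int (x $ i))"

definition step_laws :: "(int ^ 'd) measure measure" where
  "step_laws = prob_algebra (count_space {e. lattice_l1 e = 1})"

definition holding_laws :: "real measure measure" where
  "holding_laws = prob_algebra (restrict_space borel {0<..})"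

text \<open>The i.i.d. law on \<open>\<int>\<^sup>d\<close>-indexed families whose one-site marginal is \<open>\<mu>\<close>.\<close>

definition iid_law :: "'a measure \<Rightarrow> (int ^ 'd \<Rightarrow> 'a) measure" where
  "iid_law \<mu> = (\<Pi>\<^sub>M x\<in>UNIV. \<mu>)"

definition step_kernel :: "(int ^ 'd \<Rightarrow> (int ^ 'd) measure) \<Rightarrow> int ^ 'd \<Rightarrow> (int ^ 'd) measure" where
  "step_kernel \<omega> y = distr (\<omega> y) (count_space UNIV) (\<lambda>e. y + e)"

text \<open>Conditional law of the \<open>n\<close>-th position given the path \<open>h\<close> up to time \<open>n - 1\<close>, in the
  format of the Ionescu-Tulcea construction.\<close>

definition walk_kernel ::
  "(int ^ 'd \<Rightarrow> (int ^ 'd) measure) \<Rightarrow> int ^ 'd \<Rightarrow> nat \<Rightarrow> (nat \<Rightarrow> int ^ 'd) \<Rightarrow> (int ^ 'd) measure" where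
  "walk_kernel \<omega> x n h =
     (case n of 0 \<Rightarrow> return (count_space UNIV) x | Suc m \<Rightarrow> step_kernel \<omega> (h m))"

definition walk_law ::
  "(int ^ 'd \<Rightarrow> (int ^ 'd) measure) \<Rightarrow> int ^ 'd \<Rightarrow> (nat \<Rightarrow> int ^ 'd) measure" where
  "walk_law \<omega> x =
     projective_family.lim UNIV
       (Ionescu_Tulcea.CI (walk_kernel \<omega> x) (\<lambda>_. count_space UNIV)) (\<lambda>_. count_space UNIV)"

definition holding_law :: "(int ^ 'd \<Rightarrow> real measure) \<Rightarrow> (nat \<times> (int ^ 'd) \<Rightarrow> real) measure" where
  "holding_law \<sigma> = (\<Pi>\<^sub>M (n, x)\<in>UNIV. \<sigma> x)"

definition quenched_law ::
  "(int ^ 'd \<Rightarrow> (int ^ 'd) measure) \<Rightarrow> (int ^ 'd \<Rightarrow> real measure) \<Rightarrow> int ^ 'd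
     \<Rightarrow> ((nat \<Rightarrow> int ^ 'd) \<times> (nat \<times> (int ^ 'd) \<Rightarrow> real)) measure" where
  "quenched_law \<omega> \<sigma> x = walk_law \<omega> x \<Otimes>\<^sub>M holding_law \<sigma>"

definition jump_time :: "(nat \<Rightarrow> int ^ 'd) \<Rightarrow> (nat \<times> (int ^ 'd) \<Rightarrow> real) \<Rightarrow> nat \<Rightarrow> real" where
  "jump_time X \<tau> n = (\<Sum>m<n. \<tau> (m, X m))"

text \<open>\<^const>\<open>None\<close> is the graveyard state. For \<open>t \<ge> 0\<close> and positive holding times the index
  \<open>n\<close> is unique, and it fails to exist iff \<open>t\<close> is at least the sum of all holding times.\<close>

definition process ::
  "(nat \<Rightarrow> int ^ 'd) \<Rightarrow> (nat \<times> (int ^ 'd) \<Rightarrow> real) \<Rightarrow> real \<Rightarrow> (int ^ 'd) option" where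
  "process X \<tau> t =
     (if \<exists>n. jump_time X \<tau> n \<le> t \<and> t < jump_time X \<tau> (Suc n)
      then Some (X (THE n. jump_time X \<tau> n \<le> t \<and> t < jump_time X \<tau> (Suc n)))
      else None)"

definition hitting_time ::
  "(nat \<Rightarrow> int ^ 'd) \<Rightarrow> (nat \<times> (int ^ 'd) \<Rightarrow> real) \<Rightarrow> int ^ 'd \<Rightarrow> ereal" where
  "hitting_time X \<tau> y = Inf {ereal t | t. 0 \<le> t \<and> process X \<tau> t = Some y}"

definition hitting_laplace ::
  "real \<Rightarrow> int ^ 'd \<Rightarrow> int ^ 'd
     \<Rightarrow> (int ^ 'd \<Rightarrow> (int ^ 'd) measure) \<Rightarrow> (int ^ 'd \<Rightarrow> real measure) \<Rightarrow> real" where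
  "hitting_laplace \<theta> x y \<omega> \<sigma> =
     (\<integral>(X, \<tau>). (if hitting_time X \<tau> y < \<infinity>
                  then exp (- \<theta> * real_of_ereal (hitting_time X \<tau> y)) else 0)
        \<partial>quenched_law \<omega> \<sigma> x)"

text \<open>\<open>\<theta>\<close> is the Laplace parameter (lambda is a reserved symbol).  The cost is
  extended-real valued because \<open>- log 0 = \<infinity>\<close>, whereas \<^prop>\<open>ln (0 :: real) = 0\<close>.\<close>

definition hitting_cost ::
  "real \<Rightarrow> int ^ 'd \<Rightarrow> int ^ 'd
     \<Rightarrow> (int ^ 'd \<Rightarrow> (int ^ 'd) measure) \<Rightarrow> (int ^ 'd \<Rightarrow> real measure) \<Rightarrow> ereal" where
  "hitting_cost \<theta> x y \<omega> \<sigma> =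
     (if hitting_laplace \<theta> x y \<omega> \<sigma> = 0 then \<infinity> else ereal (- ln (hitting_laplace \<theta> x y \<omega> \<sigma>)))"

text \<open>\<open>\<mu>\<close> and \<open>\<nu>\<close> are the one-site marginals of the laws of \<open>\<omega>\<close> and \<open>\<sigma>\<close>;
  \<open>f\<close> is determined by these conditions (lemma \<open>lyapunov_exponent_unique\<close>).  Convergence in
  \<open>L\<^sup>1\<close> is written with the nonnegative integral since the costs may be infinite.\<close>

definition lyapunov_exponent ::
  "(int ^ 'd) measure measure \<Rightarrow> real measure measure \<Rightarrow> real \<Rightarrow> (real ^ 'd \<Rightarrow> real) \<Rightarrow> bool" where
  "lyapunov_exponent \<mu> \<nu> \<theta> f \<longleftrightarrow>
     (\<forall>x. 0 \<le> f x) \<and>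
     (\<forall>x :: int ^ 'd.
        (AE (\<omega>, \<sigma>) in iid_law \<mu> \<Otimes>\<^sub>M iid_law \<nu>.
           (\<lambda>n. hitting_cost \<theta> 0 (int n *s x) \<omega> \<sigma> / ereal (real n))
             \<longlonglongrightarrow> ereal (f (lattice_to_real x))) \<and>
        (\<lambda>n. \<integral>\<^sup>+ (\<omega>, \<sigma>).
                e2ennreal \<bar>hitting_cost \<theta> 0 (int n *s x) \<omega> \<sigma> / ereal (real n)
                            - ereal (f (lattice_to_real x))\<bar>
              \<partial>(iid_law \<mu> \<Otimes>\<^sub>M iid_law \<nu>)) \<longlonglongrightarrow> 0) \<and>
     (\<forall>x q. 0 < q \<longrightarrow>
        f ((1 / real q) *\<^sub>R lattice_to_real x) = f (lattice_to_real x) / real q) \<and>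
     continuous_on UNIV f"

definition rate_function :: "(real \<Rightarrow> real ^ 'd \<Rightarrow> real) \<Rightarrow> real ^ 'd \<Rightarrow> ereal" where
  "rate_function \<alpha> x = (SUP \<theta>\<in>{0..}. ereal (\<alpha> \<theta> x - \<theta>))"

definition mean_holding_time :: "real measure \<Rightarrow> ennreal" where
  "mean_holding_time s = (\<integral>\<^sup>+ t. ennreal t \<partial>s)"

lemma Ionescu_Tulcea_walk:
  fixes \<omega> :: "int ^ 'd \<Rightarrow> (int ^ 'd) measure"
  assumes "\<omega> \<in> space (\<Pi>\<^sub>M x\<in>UNIV. step_laws)"
  shows "Ionescu_Tulcea (walk_kernel \<omega> x) (\<lambda>_. count_space UNIV)"
proof -
  have pr: "prob_space (\<omega> y)" and st: "sets (\<omega> y) = sets (count_space {e. lattice_l1 e = 1})" for y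
    using assms by (auto simp: space_PiM PiE_iff step_laws_def space_prob_algebra)
  have meas: "(\<lambda>e. y + e) \<in> measurable (\<omega> y) (count_space UNIV)" for y
    unfolding measurable_cong_sets[OF st refl] by simp
  have k: "prob_space (step_kernel \<omega> y)" for y
    unfolding step_kernel_def by (rule prob_space.prob_space_distr[OF pr meas])
  have ks: "step_kernel \<omega> y \<in> space (subprob_algebra (count_space UNIV))" for y
    using k[of y] by (auto simp: space_subprob_algebra step_kernel_def prob_space_imp_subprob_space)
  show ?thesis
  proof (rule Ionescu_Tulcea.intro)
    show "walk_kernel \<omega> x i \<in> measurable (PiM {0..<i} (\<lambda>_. count_space UNIV)) (subprob_algebra (count_space UNIV))" for i
    proof (cases i)
      case 0
      then show ?thesis
        by (simp add: walk_kernel_def space_subprob_algebra prob_space_imp_subprob_space prob_space_return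
            cong: measurable_cong)
    next
      case (Suc m)
      have "(\<lambda>h. h m) \<in> measurable (PiM {0..<Suc m} (\<lambda>_. count_space (UNIV :: (int ^ 'd) set))) (count_space UNIV)"
        by (rule measurable_component_singleton) simp
      moreover have "step_kernel \<omega> \<in> measurable (count_space UNIV) (subprob_algebra (count_space UNIV))"
        using ks by simp
      ultimately have "(\<lambda>h. step_kernel \<omega> (h m)) \<in> measurable (PiM {0..<Suc m} (\<lambda>_. count_space UNIV)) (subprob_algebra (count_space UNIV))"
        by (rule measurable_compose)
      moreover have "walk_kernel \<omega> x i = (\<lambda>h. step_kernel \<omega> (h m))"
        by (simp add: fun_eq_iff Suc walk_kernel_def)
      ultimately show ?thesis
        by (simp only: Suc)
    qed
    show "prob_space (walk_kernel \<omega> x i h)"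
      if "h \<in> space (PiM {0..<i} (\<lambda>_. count_space UNIV))" for i h
      by (cases i) (simp_all add: walk_kernel_def k prob_space_return)
  qed
qed

lemma sets_walk_law: "sets (walk_law \<omega> x) = sets (\<Pi>\<^sub>M n\<in>UNIV. count_space UNIV)"
  if "\<omega> \<in> space (\<Pi>\<^sub>M x\<in>UNIV. step_laws)"
proof -
  interpret Ionescu_Tulcea "walk_kernel \<omega> x" "\<lambda>_. count_space UNIV"
    by (rule Ionescu_Tulcea_walk[OF that])
  show ?thesis
    by (simp add: walk_law_def)
qed

lemma emeasure_walk_law:
  fixes \<omega> :: "int ^ 'd \<Rightarrow> (int ^ 'd) measure"
  assumes \<omega>: "\<omega> \<in> space (\<Pi>\<^sub>M x\<in>UNIV. step_laws)"
  shows "emeasure (walk_law \<omega> x) {X. \<forall>i\<le>n. X i = p i} =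
    indicator {x} (p 0) * (\<Prod>i<n. emeasure (step_kernel \<omega> (p i)) {p (Suc i)})"
proof -
  let ?M = "\<lambda>_::nat. count_space (UNIV :: (int ^ 'd) set)"
  interpret IT: Ionescu_Tulcea "walk_kernel \<omega> x" ?M
    by (rule Ionescu_Tulcea_walk[OF \<omega>])
  let ?u = "\<lambda>_::nat. undefined :: int ^ 'd"
  define q where "q n = restrict p {0..<n}" for n
  have set: "{q n} \<in> sets (PiM {0..<n} ?M)" for n
  proof -
    have "{q n} = PiE {0..<n} (\<lambda>i. {p i})"
      by (auto simp: q_def PiE_iff extensional_def restrict_def fun_eq_iff)
    also have "\<dots> \<in> sets (PiM {0..<n} ?M)"
      by (rule sets_PiM_I_finite) auto
    finally show ?thesis .
  qed
  have step: "emeasure (IT.C 0 (Suc n) ?u) {q (Suc n)} =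
      emeasure (IT.C 0 n ?u) {q n} * emeasure (walk_kernel \<omega> x n (q n)) {p n}" for n
  proof -
    have u: "?u \<in> space (PiM {0..<0} ?M)"
      by (simp add: space_PiM)
    have sC: "sets (IT.C 0 n ?u) = sets (PiM {0..<n} ?M)"
      using IT.sets_C[OF u, of n] by simp
    have m: "IT.eP n \<in> measurable (IT.C 0 n ?u) (subprob_algebra (PiM {0..<Suc n} ?M))"
      unfolding measurable_cong_sets[OF sC refl] by (rule IT.measurable_eP)
    have ne: "space (IT.C 0 n ?u) \<noteq> {}"
      using prob_space.not_empty[OF IT.prob_space_C[OF u, of n]] .
    have "emeasure (IT.C 0 (Suc n) ?u) {q (Suc n)}
        = (\<integral>\<^sup>+h. emeasure (IT.eP n h) {q (Suc n)} \<partial>IT.C 0 n ?u)"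
      using emeasure_bind[OF ne m set[of "Suc n"]] by simp
    also have "\<dots> = (\<integral>\<^sup>+h. emeasure (walk_kernel \<omega> x n (q n)) {p n} * indicator {q n} h \<partial>IT.C 0 n ?u)"
    proof (rule nn_integral_cong)
      fix h assume "h \<in> space (IT.C 0 n ?u)"
      then have h: "h \<in> space (PiM {0..<n} ?M)"
        using sets_eq_imp_space_eq[OF sC] by simp
      have eq: "h(n := y) = q (Suc n) \<longleftrightarrow> h = q n \<and> y = p n" for y
      proof
        assume a: "h(n := y) = q (Suc n)"
        have y: "y = p n"
          using fun_cong[OF a, of n] by (simp add: q_def)
        have "h i = q n i" for i
        proof (cases "i < n")
          case True
          then show ?thesis
            using fun_cong[OF a, of i] by (simp add: q_def)
        next
          case False
          then show ?thesis
            using h by (simp add: q_def space_PiM PiE_iff extensional_def)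
        qed
        with y show "h = q n \<and> y = p n" by (simp add: fun_eq_iff)
      next
        assume "h = q n \<and> y = p n"
        then show "h(n := y) = q (Suc n)"
          by (auto simp: q_def fun_eq_iff restrict_def)
      qed
      have "emeasure (IT.eP n h) {q (Suc n)} =
        emeasure (walk_kernel \<omega> x n h) ((\<lambda>y. h(n := y)) -` {q (Suc n)} \<inter> space (count_space UNIV))"
        by (rule IT.emeasure_eP[OF h set])
      also have "(\<lambda>y. h(n := y)) -` {q (Suc n)} \<inter> space (count_space UNIV) = (if h = q n then {p n} else {})"
      proof -
        have "(\<lambda>y. h(n := y)) -` {q (Suc n)} \<inter> space (count_space UNIV) = {y. h(n := y) = q (Suc n)}"
          by auto
        also have "\<dots> = (if h = q n then {p n} else {})"
          unfolding eq by auto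
        finally show ?thesis .
      qed
      finally show "emeasure (IT.eP n h) {q (Suc n)} =
          emeasure (walk_kernel \<omega> x n (q n)) {p n} * indicator {q n} h"
        by (simp add: indicator_def)
    qed
    also have "\<dots> = emeasure (IT.C 0 n ?u) {q n} * emeasure (walk_kernel \<omega> x n (q n)) {p n}"
      using set[of n] by (subst nn_integral_cmult_indicator) (simp_all add: sC mult.commute)
    finally show ?thesis .
  qed
  have C: "emeasure (IT.C 0 (Suc n) ?u) {q (Suc n)} =
    indicator {x} (p 0) * (\<Prod>i<n. emeasure (step_kernel \<omega> (p i)) {p (Suc i)})" for n
  proof (induction n)
    case 0
    have "emeasure (IT.C 0 0 ?u) {q 0} = 1"
    proof -
      have "q 0 = ?u"
        by (simp add: q_def restrict_def)
      then show ?thesis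
        using emeasure_return[OF set[of 0], of ?u] by simp
    qed
    then show ?case
      unfolding step by (simp add: walk_kernel_def indicator_def)
  next
    case (Suc n)
    have "walk_kernel \<omega> x (Suc n) (q (Suc n)) = step_kernel \<omega> (p n)"
      by (simp add: walk_kernel_def q_def)
    then show ?case
      unfolding step[of "Suc n"] Suc.IH by (simp add: mult.assoc)
  qed
  have up: "IT.up_to {0..<Suc n} = Suc n"
    by (rule antisym) (auto simp: IT.up_to_iff intro: IT.up_to_less[of "{0..<Suc n}" n, simplified, THEN Suc_leI])
  have "{X. \<forall>i\<le>n. X i = p i} = IT.PF.emb UNIV {0..<Suc n} {q (Suc n)}"
    by (simp add: q_def prod_emb_def space_PiM fun_eq_iff restrict_def less_Suc_eq_le set_eq_iff)
  then have "emeasure (walk_law \<omega> x) {X. \<forall>i\<le>n. X i = p i} = emeasure (IT.CI {0..<Suc n}) {q (Suc n)}"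
    unfolding walk_law_def by (simp add: IT.lim[OF _ set])
  also have "\<dots> = emeasure (IT.C 0 (Suc n) ?u) {q (Suc n)}"
  proof -
    have "IT.PF.emb {0..<Suc n} {0..<Suc n} {q (Suc n)} = {q (Suc n)}"
      by (rule prod_emb_id) (auto simp: q_def PiE_iff)
    then show ?thesis
      using IT.emeasure_CI[OF subset_refl set[of "Suc n"]] by (simp del: IT.C.simps)
  qed
  finally show ?thesis
    by (simp add: C del: IT.C.simps)
qed

lemma emeasure_step_kernel:
  assumes "\<omega> \<in> space (\<Pi>\<^sub>M x\<in>UNIV. step_laws)" and "lattice_l1 e = 1"
  shows "emeasure (step_kernel \<omega> y) {y + e} = emeasure (\<omega> y) {e}"
proof -
  have st: "sets (\<omega> y) = sets (count_space {e. lattice_l1 e = 1})"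
    using assms by (auto simp: space_PiM PiE_iff step_laws_def space_prob_algebra)
  have "(\<lambda>e. y + e) \<in> measurable (\<omega> y) (count_space UNIV)"
    unfolding measurable_cong_sets[OF st refl] by simp
  moreover have "(\<lambda>e. y + e) -` {y + e} \<inter> space (\<omega> y) = {e}"
    using assms(2) sets_eq_imp_space_eq[OF st] by auto
  ultimately show ?thesis
    by (simp add: step_kernel_def emeasure_distr)
qed

lemma lyapunov_exponent_unique:
  fixes f g :: "real ^ 'd \<Rightarrow> real"
  assumes \<mu>: "prob_space \<mu>" and \<nu>: "prob_space \<nu>"
    and f: "lyapunov_exponent \<mu> \<nu> \<theta> f" and g: "lyapunov_exponent \<mu> \<nu> \<theta> g"
  shows "f = g"
proof
  fix x :: "real ^ 'd"
  let ?P = "iid_law \<mu> \<Otimes>\<^sub>M iid_law \<nu> ::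
    ((int ^ 'd \<Rightarrow> (int ^ 'd) measure) \<times> (int ^ 'd \<Rightarrow> real measure)) measure"
  interpret A: prob_space "iid_law \<mu> :: (int ^ 'd \<Rightarrow> (int ^ 'd) measure) measure"
    unfolding iid_law_def by (rule prob_space_PiM) (rule \<mu>)
  interpret B: prob_space "iid_law \<nu> :: (int ^ 'd \<Rightarrow> real measure) measure"
    unfolding iid_law_def by (rule prob_space_PiM) (rule \<nu>)
  interpret AB: pair_prob_space "iid_law \<mu> :: (int ^ 'd \<Rightarrow> (int ^ 'd) measure) measure"
    "iid_law \<nu> :: (int ^ 'd \<Rightarrow> real measure) measure" ..
  have lattice: "f (lattice_to_real z) = g (lattice_to_real z)" for z
  proof -
    have "AE w in ?P. f (lattice_to_real z) = g (lattice_to_real z)"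
      using f[unfolded lyapunov_exponent_def, THEN conjunct2, THEN conjunct1, rule_format, of z, THEN conjunct1]
        g[unfolded lyapunov_exponent_def, THEN conjunct2, THEN conjunct1, rule_format, of z, THEN conjunct1]
      by eventually_elim (auto dest: LIMSEQ_unique)
    then show ?thesis
      by simp
  qed
  define r where "r n = (1 / real (Suc n)) *\<^sub>R lattice_to_real (\<chi> i. \<lfloor>real (Suc n) * x $ i\<rfloor>)" for n
  have fg: "f (r n) = g (r n)" for n
  proof -
    have "h (r n) = h (lattice_to_real (\<chi> i. \<lfloor>real (Suc n) * x $ i\<rfloor>)) / real (Suc n)"
      if "lyapunov_exponent \<mu> \<nu> \<theta> h" for h :: "real ^ 'd \<Rightarrow> real"
      using that unfolding lyapunov_exponent_def r_def by blast
    from this[OF f] this[OF g] show ?thesis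
      by (simp only: lattice)
  qed
  have "(\<lambda>n. r n $ i) \<longlonglongrightarrow> x $ i" for i
  proof (rule tendsto_sandwich)
    have "x $ i - 1 / real (Suc n) \<le> r n $ i" for n
    proof -
      have "(real (Suc n) * x $ i - 1) / real (Suc n) \<le> of_int \<lfloor>real (Suc n) * x $ i\<rfloor> / real (Suc n)"
        by (intro divide_right_mono) linarith+
      then show ?thesis
        by (simp add: r_def lattice_to_real_def diff_divide_distrib)
    qed
    then show "\<forall>\<^sub>F n in sequentially. x $ i - 1 / real (Suc n) \<le> r n $ i"
      by simp
    have "r n $ i \<le> x $ i" for n
    proof -
      have "of_int \<lfloor>real (Suc n) * x $ i\<rfloor> / real (Suc n) \<le> (real (Suc n) * x $ i) / real (Suc n)"
        by (intro divide_right_mono) linarith+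
      then show ?thesis
        by (simp add: r_def lattice_to_real_def)
    qed
    then show "\<forall>\<^sub>F n in sequentially. r n $ i \<le> x $ i"
      by simp
    show "(\<lambda>n. x $ i - 1 / real (Suc n)) \<longlonglongrightarrow> x $ i"
      using tendsto_diff[OF tendsto_const lim_inverse_n'[THEN LIMSEQ_Suc]] by simp
  qed simp
  then have r: "r \<longlonglongrightarrow> x"
    by (rule vec_tendstoI)
  have "continuous_on UNIV f" "continuous_on UNIV g"
    using f g by (simp_all add: lyapunov_exponent_def)
  then have "(\<lambda>n. f (r n)) \<longlonglongrightarrow> f x" "(\<lambda>n. g (r n)) \<longlonglongrightarrow> g x"
    using r by (auto simp: continuous_on_eq_continuous_at intro: isCont_tendsto_compose)
  then show "f x = g x"
    by (auto simp: fg intro: LIMSEQ_unique)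
qed

end

theory Submission
  imports Defs
begin

text \<open>Integrating out the holding times turns the Laplace transform of the hitting time into the
  weight \<open>E [\<Prod>m<H. \<phi> (X m)]\<close> of simple random walk in the i.i.d. potential \<open>- ln \<phi>\<close>, where
  \<open>\<phi> z = \<integral> exp (- \<theta> t) \<sigma>\<^sub>z(dt)\<close>.

  Upper bound: force the walk to sit at the target at a given time \<open>k\<close>.  Jensen's inequality under
  the bridge law replaces the potential by its mean and costs \<open>\<theta> k\<close> times the mean holding time,
  while multinomial counting bounds the entropy of the bridge.  With \<open>k\<close> proportional to the
  inverse of the speed, the terms in \<open>\<theta>\<close> cancel in the rate function.

  Lower bound: by Fatou's lemma it suffices to bound the annealed weight.  Cut the path at the first
  passages of levels at distance \<open>R = K / \<surd>\<theta>\<close> in the direction of the target and count, between two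
  passages, only the visits to the slab in between.  These slabs are disjoint, so the annealed weight
  factorises into one-slab crossings.  In one slab the potential may be replaced by its mean because
  by Tanaka's formula the walk has few self-intersections, and the resulting constant potential has an
  explicit hyperbolic cosine supersolution of the right decay rate.\<close>

subsection \<open>Weights of walks\<close>

text \<open>Why slabs of width K / sqrt \<theta>: crossing one is given a time t of order 1 /
  \<theta>. In that time the potential, of size \<theta> per site, accumulates a mean of order 1,
  while the bound on its variance is of order \<theta>^2 t^(3/2), hence of order sqrt \<theta>. So
  fluctuations die out and the mean survives. The exponent 3/2 is a one-dimensional count of
  self-intersections, valid in every dimension. K must be large because the supersolution only
  yields 2 exp (- g K) for one crossing; the factor 2 is absorbed by taking g strictly between the
  wanted rate b and the critical sqrt (2 d m), m being the mean holding time. Holding times are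
  truncated beforehand, since the mean holding time need not be square integrable in \<sigma>.

  The bounds are proved for every fixed uniform \<omega>, with \<sigma> as the only randomness;
  Fubini supplies such an \<omega>. They match in the rate function: d m |v|^2 / 2 is the bridge
  cost of travelling v in mean time 1, and also the maximum over \<theta> of sqrt (2 d m \<theta>)
  |v| - \<theta>.\<close>

definition lattice_steps :: "(int ^ 'd) set" where
  "lattice_steps = {e. lattice_l1 e = 1}"

lemma lattice_steps_eq:
  "(lattice_steps :: (int ^ 'd) set) = range (\<lambda>i. axis i 1) \<union> range (\<lambda>i. axis i (- 1))"
proof (intro equalityI subsetI)
  fix e :: "int ^ 'd"
  assume "e \<in> lattice_steps"
  then have s: "(\<Sum>i\<in>UNIV. \<bar>e $ i\<bar>) = 1"
    by (simp add: lattice_steps_def lattice_l1_def)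
  then obtain i where i: "e $ i \<noteq> 0"
    by (metis abs_zero sum.neutral zero_neq_one)
  have sp: "(\<Sum>j\<in>UNIV. \<bar>e $ j\<bar>) = \<bar>e $ i\<bar> + (\<Sum>j\<in>UNIV - {i}. \<bar>e $ j\<bar>)"
    by (simp add: sum.remove)
  have nn: "0 \<le> (\<Sum>j\<in>UNIV - {i}. \<bar>e $ j\<bar>)"
    by (simp add: sum_nonneg)
  have 1: "\<bar>e $ i\<bar> = 1" and z: "(\<Sum>j\<in>UNIV - {i}. \<bar>e $ j\<bar>) = 0"
    using s sp nn i by linarith+
  from z have z': "e $ j = 0" if "j \<noteq> i" for j
    using that by (auto simp: sum_nonneg_eq_0_iff)
  have "e = axis i (e $ i)"
    using z' by (auto simp: vec_eq_iff axis_def)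
  moreover have "e $ i = 1 \<or> e $ i = - 1"
    using 1 by linarith
  ultimately show "e \<in> range (\<lambda>i. axis i 1) \<union> range (\<lambda>i. axis i (- 1))"
    by (metis UnCI rangeI)
next
  fix e :: "int ^ 'd"
  assume "e \<in> range (\<lambda>i. axis i 1) \<union> range (\<lambda>i. axis i (- 1))"
  then show "e \<in> lattice_steps"
    by (auto simp: lattice_steps_def lattice_l1_def axis_def if_distrib[of abs] sum.delta cong: if_cong)
qed

lemma finite_lattice_steps [simp]: "finite (lattice_steps :: (int ^ 'd) set)"
  unfolding lattice_steps_eq by simp

lemma sum_lattice_steps:
  fixes g :: "int ^ 'd \<Rightarrow> 'b::comm_monoid_add"
  shows "(\<Sum>e\<in>lattice_steps. g e) = (\<Sum>i\<in>UNIV. g (axis i 1) + g (axis i (- 1)))"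
proof -
  have disj: "range (\<lambda>i. axis i 1 :: int ^ 'd) \<inter> range (\<lambda>i. axis i (- 1)) = {}"
    by (auto simp: axis_eq_axis)
  have inj: "inj (\<lambda>i. axis i (1::int) :: int ^ 'd)" "inj (\<lambda>i. axis i (- 1::int) :: int ^ 'd)"
    by (auto simp: inj_def axis_eq_axis)
  show ?thesis
    unfolding lattice_steps_eq
    by (subst sum.union_disjoint) (simp_all add: disj sum.reindex inj sum.distrib)
qed

lemma card_lattice_steps: "card (lattice_steps :: (int ^ 'd) set) = 2 * CARD('d)"
  using sum_lattice_steps[of "\<lambda>_ :: int ^ 'd. 1 :: nat"] by simp

definition step_avg :: "(int ^ 'd \<Rightarrow> real) \<Rightarrow> int ^ 'd \<Rightarrow> real" where
  "step_avg g z = (\<Sum>e\<in>lattice_steps. g (z + e)) / (2 * real CARD('d))"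

lemma step_avg_mono: "(\<And>e. e \<in> lattice_steps \<Longrightarrow> f (z + e) \<le> g (z + e)) \<Longrightarrow> step_avg f z \<le> step_avg g z"
  unfolding step_avg_def by (intro divide_right_mono sum_mono) auto

lemma step_avg_nonneg: "(\<And>e. e \<in> lattice_steps \<Longrightarrow> 0 \<le> g (z + e)) \<Longrightarrow> 0 \<le> step_avg g z"
  unfolding step_avg_def by (intro divide_nonneg_nonneg sum_nonneg) auto

lemma step_avg_cong: "(\<And>e. e \<in> lattice_steps \<Longrightarrow> f (z + e) = g (z + e)) \<Longrightarrow> step_avg f z = step_avg g z"
  unfolding step_avg_def by simp

lemma step_avg_const [simp]: "step_avg (\<lambda>_. c) z = c"
  by (simp add: step_avg_def card_lattice_steps)

lemma step_avg_add: "step_avg (\<lambda>v. f v + g v) z = step_avg f z + step_avg g z"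
  by (simp add: step_avg_def sum.distrib add_divide_distrib)

lemma step_avg_diff: "step_avg (\<lambda>v. f v - g v) z = step_avg f z - step_avg g z"
  by (simp add: step_avg_def sum_subtractf diff_divide_distrib)

lemma step_avg_cmult: "step_avg (\<lambda>v. c * f v) z = c * step_avg f z"
  by (simp add: step_avg_def sum_distrib_left)

lemma step_avg_cdiv: "step_avg (\<lambda>v. f v / c) z = step_avg f z / c"
  by (simp add: step_avg_def sum_divide_distrib field_simps)

text \<open>With \<open>H\<close> the hitting time of \<open>y\<close> by simple random walk \<open>X\<close> started at \<open>z\<close>, these are
  \<open>E [(\<Prod>m<H. \<phi> (X m)); H \<le> n]\<close>, \<open>E [(\<Prod>m<n. \<phi> (X m)); X n = y]\<close> and \<open>E [(\<Sum>m<n. V (X m)); X n = y]\<close>.\<close>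

primrec hit_weight :: "nat \<Rightarrow> (int ^ 'd \<Rightarrow> real) \<Rightarrow> int ^ 'd \<Rightarrow> int ^ 'd \<Rightarrow> real" where
  "hit_weight 0 \<phi> y z = (if z = y then 1 else 0)"
| "hit_weight (Suc n) \<phi> y z = (if z = y then 1 else \<phi> z * step_avg (hit_weight n \<phi> y) z)"

primrec end_weight :: "nat \<Rightarrow> (int ^ 'd \<Rightarrow> real) \<Rightarrow> int ^ 'd \<Rightarrow> int ^ 'd \<Rightarrow> real" where
  "end_weight 0 \<phi> y z = (if z = y then 1 else 0)"
| "end_weight (Suc n) \<phi> y z = \<phi> z * step_avg (end_weight n \<phi> y) z"

primrec end_accum :: "nat \<Rightarrow> (int ^ 'd \<Rightarrow> real) \<Rightarrow> int ^ 'd \<Rightarrow> int ^ 'd \<Rightarrow> real" where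
  "end_accum 0 V y z = 0"
| "end_accum (Suc n) V y z =
     V z * step_avg (end_weight n (\<lambda>_. 1) y) z + step_avg (end_accum n V y) z"

lemma hit_weight_bounds:
  assumes "\<And>v. 0 \<le> \<phi> v" "\<And>v. \<phi> v \<le> 1"
  shows "0 \<le> hit_weight n \<phi> y z \<and> hit_weight n \<phi> y z \<le> 1"
proof (induction n arbitrary: z)
  case (Suc n)
  have "0 \<le> step_avg (hit_weight n \<phi> y) z" "step_avg (hit_weight n \<phi> y) z \<le> 1"
    using Suc.IH step_avg_nonneg step_avg_mono[of "hit_weight n \<phi> y" z "\<lambda>_. 1"] by auto
  then show ?case
    using assms[of z] by (auto intro: mult_le_one)
qed auto

lemma hit_weight_mono:
  assumes "\<And>v. 0 \<le> \<phi> v" "\<And>v. \<phi> v \<le> 1" "\<And>v. \<phi> v \<le> \<psi> v" "\<And>v. \<psi> v \<le> 1"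
  shows "hit_weight n \<phi> y z \<le> hit_weight n \<psi> y z"
proof (induction n arbitrary: z)
  case (Suc n)
  show ?case
    using Suc.IH assms(1,3)
    by (auto intro!: mult_mono step_avg_mono step_avg_nonneg
        simp: hit_weight_bounds[OF assms(1,2)] order_trans[OF assms(1,3)])
qed auto

lemma hit_weight_Suc_ge:
  assumes "\<And>v. 0 \<le> \<phi> v" "\<And>v. \<phi> v \<le> 1"
  shows "hit_weight n \<phi> y z \<le> hit_weight (Suc n) \<phi> y z"
proof (induction n arbitrary: z)
  case 0
  have "0 \<le> step_avg (hit_weight 0 \<phi> y) z"
    by (rule step_avg_nonneg) simp
  then show ?case using assms by simp
next
  case (Suc n)
  show ?case
    unfolding hit_weight.simps(2)[of "Suc n"] using Suc.IH assms(1)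
    by (auto intro!: mult_left_mono step_avg_mono simp del: hit_weight.simps(2) simp: hit_weight.simps(2)[of n "\<phi>" y z])
qed

lemma end_weight_nonneg:
  assumes "\<And>v. 0 \<le> \<phi> v"
  shows "0 \<le> end_weight n \<phi> y z"
  by (induction n arbitrary: z) (auto intro!: mult_nonneg_nonneg step_avg_nonneg assms)

lemma end_weight_mono:
  assumes "\<And>v. 0 \<le> \<phi> v" "\<And>v. \<phi> v \<le> \<psi> v"
  shows "end_weight n \<phi> y z \<le> end_weight n \<psi> y z"
proof (induction n arbitrary: z)
  case (Suc n)
  show ?case
    using Suc.IH assms order_trans[OF assms(1,2)]
    by (auto intro!: mult_mono step_avg_mono step_avg_nonneg end_weight_nonneg)
qed auto

text \<open>A path that is at \<open>y\<close> at time \<open>n\<close> has hit \<open>y\<close> by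
  then, and the factors collected after the first hit are at most 1.\<close>

lemma end_weight_le_hit_weight:
  assumes "\<And>v. 0 \<le> \<phi> v" "\<And>v. \<phi> v \<le> 1"
  shows "end_weight n \<phi> y z \<le> hit_weight n \<phi> y z"
proof -
  have le1: "end_weight n \<phi> y z \<le> 1" for n z
  proof (induction n arbitrary: z)
    case (Suc n)
    have "0 \<le> step_avg (end_weight n \<phi> y) z"
      by (rule step_avg_nonneg) (rule end_weight_nonneg[OF assms(1)])
    moreover have "step_avg (end_weight n \<phi> y) z \<le> 1"
      using Suc.IH step_avg_mono[of "end_weight n \<phi> y" z "\<lambda>_. 1"] by auto
    ultimately show ?case
      using assms[of z] by (auto intro: mult_le_one)
  qed auto
  show ?thesis
  proof (induction n arbitrary: z)
    case (Suc n)
    show ?case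
      using Suc.IH assms le1[of "Suc n" z] by (auto intro!: mult_left_mono step_avg_mono)
  qed auto
qed

text \<open>Jensen's inequality for the law of the walk conditioned to end at \<^term>\<open>y\<close>, with
  \<open>exp\<close> replaced by its tangent at \<^term>\<open>a\<close> so that it can be proved one step at a time.\<close>

lemma end_weight_exp_ge:
  "exp (- a) * ((1 + a) * end_weight n (\<lambda>_. 1) y z - end_accum n V y z)
     \<le> end_weight n (\<lambda>v. exp (- V v)) y z"
proof (induction n arbitrary: a z)
  case 0
  show ?case
    using exp_ge_add_one_self[of a] by (auto simp: exp_minus field_simps)
next
  case (Suc n)
  \<comment> \<open>The first step collects \<open>V z\<close>, so the tangent point for the rest of
    the path moves to \<open>a - V z\<close>; hence the induction over all \<open>a\<close>.\<close>
  let ?b = "a - V z"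
  have "exp (- a) * ((1 + a) * end_weight (Suc n) (\<lambda>_. 1) y z - end_accum (Suc n) V y z)
      = exp (- V z) * step_avg (\<lambda>v. exp (- ?b) * ((1 + ?b) * end_weight n (\<lambda>_. 1) y v - end_accum n V y v)) z"
  proof -
    have e: "exp (- a) = exp (- V z) * exp (- ?b)"
      by (simp flip: exp_add)
    show ?thesis
      unfolding e step_avg_cmult step_avg_diff by (simp add: algebra_simps)
  qed
  also have "\<dots> \<le> exp (- V z) * step_avg (end_weight n (\<lambda>v. exp (- V v)) y) z"
    by (intro mult_left_mono step_avg_mono Suc.IH) auto
  finally show ?case by simp
qed

text \<open>The tangent is taken at the mean potential of the bridge, where the bracket in the
  previous bound reduces to \<open>end_weight\<close> itself.\<close>

lemma end_weight_exp_ge_Jensen: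
  assumes "0 < end_weight n (\<lambda>_. 1) y z"
  shows "end_weight n (\<lambda>_. 1) y z * exp (- (end_accum n V y z / end_weight n (\<lambda>_. 1) y z))
     \<le> end_weight n (\<lambda>v. exp (- V v)) y z"
proof -
  let ?P = "end_weight n (\<lambda>_. 1) y z" and ?S = "end_accum n V y z"
  have "exp (- (?S / ?P)) * ((1 + ?S / ?P) * ?P - ?S) = ?P * exp (- (?S / ?P))"
    using assms by (simp add: field_simps)
  then show ?thesis
    using end_weight_exp_ge[of "?S / ?P" n y z V] by (simp add: mult.commute)
qed

text \<open>The left side is the probability of using each step \<open>e\<close> exactly
  \<open>a e\<close> times, in any order. Conditioning on the first step gives the recursion of the
  multinomial coefficients, because the counts add up to \<open>k\<close>.\<close>

lemma end_weight_ge_multinomial: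
  fixes a :: "int ^ 'd \<Rightarrow> nat"
  assumes "(\<Sum>e\<in>lattice_steps. a e) = k"
  shows "fact k / ((2 * real CARD('d)) ^ k * (\<Prod>e\<in>lattice_steps. fact (a e)))
    \<le> end_weight k (\<lambda>_. 1) (z + (\<Sum>e\<in>lattice_steps. int (a e) *s e)) z"
  using assms
proof (induction k arbitrary: a z)
  case 0
  then have "\<And>e. e \<in> lattice_steps \<Longrightarrow> a e = 0"
    by simp
  then show ?case
    by (simp add: vec_eq_iff)
next
  case (Suc k)
  let ?D = "2 * real CARD('d)" and ?y = "z + (\<Sum>e\<in>lattice_steps. int (a e) *s e)"
  let ?\<Pi> = "(\<Prod>e\<in>lattice_steps. fact (a e)) :: real"
  have pos: "0 < ?\<Pi>"
    by (intro prod_pos) simp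
  \<comment> \<open>If \<open>e\<close> comes first, its count drops by one. A direction with count
    0 contributes 0 on the left and only needs nonnegativity on the right.\<close>
  have step: "real (a e) * (fact k / (?D ^ k * ?\<Pi>)) \<le> end_weight k (\<lambda>_. 1) ?y (z + e)"
    if e: "e \<in> lattice_steps" for e
  proof (cases "a e")
    case 0
    then show ?thesis by (simp add: end_weight_nonneg)
  next
    case (Suc m)
    let ?a = "a(e := m)"
    have s: "(\<Sum>e\<in>lattice_steps. ?a e) = k"
      using Suc.prems e \<open>a e = Suc m\<close> by (simp add: sum.remove)
    have y: "z + e + (\<Sum>e\<in>lattice_steps. int (?a e) *s e) = ?y"
    proof -
      have "(\<Sum>e'\<in>lattice_steps. int (a e') *s e') = int (a e) *s e + (\<Sum>e'\<in>lattice_steps - {e}. int (a e') *s e')"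
        "(\<Sum>e'\<in>lattice_steps. int (?a e') *s e') = int m *s e + (\<Sum>e'\<in>lattice_steps - {e}. int (a e') *s e')"
        using e by (simp_all add: sum.remove)
      then show ?thesis
        using Suc by (simp add: vec_eq_iff algebra_simps)
    qed
    have p: "?\<Pi> = real (a e) * (\<Prod>e\<in>lattice_steps. fact (?a e))"
      using e Suc by (simp add: prod.remove algebra_simps)
    have "real (a e) * (fact k / (?D ^ k * ?\<Pi>)) = fact k / (?D ^ k * (\<Prod>e\<in>lattice_steps. fact (?a e)))"
      unfolding p using Suc by (simp del: of_nat_Suc fun_upd_apply)
    also have "\<dots> \<le> end_weight k (\<lambda>_. 1) ?y (z + e)"
      using Suc.IH[OF s, of "z + e"] unfolding y .
    finally show ?thesis .
  qed
  have "fact (Suc k) / (?D ^ Suc k * ?\<Pi>)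
      = (\<Sum>e\<in>lattice_steps. real (a e) * (fact k / (?D ^ k * ?\<Pi>))) / ?D"
    unfolding sum_distrib_right[symmetric] of_nat_sum[symmetric] Suc.prems by (simp add: field_simps)
  also have "\<dots> \<le> step_avg (end_weight k (\<lambda>_. 1) ?y) z"
    unfolding step_avg_def using step by (intro divide_right_mono sum_mono) auto
  finally show ?case by simp
qed

text \<open>This Stirling bound and the next compare increments in \<open>n\<close> by
  \<open>ln x \<le> x - 1\<close>. Their gap is logarithmic, hence negligible against the length of
  a bridge.\<close>

lemma ln_fact_ge: "real n * ln (real n) - real n \<le> ln (fact n)"
proof (induction n)
  case (Suc n)
  show ?case
  proof (cases "n = 0")
    case False
    have "ln (real (Suc n) / real n) \<le> real (Suc n) / real n - 1"
      using False by (intro ln_le_minus_one) auto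
    then have "real n * (ln (real (Suc n)) - ln (real n)) \<le> 1"
      using False by (simp add: ln_div field_simps)
    moreover have "ln (fact (Suc n) :: real) = ln (real (Suc n)) + ln (fact n)"
      by (subst fact_Suc) (simp add: ln_mult)
    ultimately show ?thesis
      using Suc by (simp add: algebra_simps)
  qed simp
qed simp

lemma ln_fact_le:
  assumes "0 < n"
  shows "ln (fact n) \<le> real n * ln (real n) - real n + ln (real n) + 1"
  using assms
proof (induction n)
  case (Suc n)
  show ?case
  proof (cases "n = 0")
    case False
    have "ln (real n / real (Suc n)) \<le> real n / real (Suc n) - 1"
      using False by (intro ln_le_minus_one) auto
    then have "1 \<le> real (Suc n) * (ln (real (Suc n)) - ln (real n))"
      using False by (simp add: ln_div field_simps)
    moreover have "ln (fact (Suc n) :: real) = ln (real (Suc n)) + ln (fact n)"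
      by (subst fact_Suc) (simp add: ln_mult)
    ultimately show ?thesis
      using Suc False by (simp add: algebra_simps)
  qed simp
qed simp

subsection \<open>Entropy bound for bridges\<close>

text \<open>The difference of the two sides has derivative \<open>t ^ 3 / (1 + t)\<close>, which has
  the sign of \<open>t\<close>, so its minimum is the value 0 at \<open>t = 0\<close>.\<close>

lemma ln_one_plus_le_cubic:
  assumes "- 1 < (u::real)"
  shows "ln (1 + u) \<le> u - u\<^sup>2 / 2 + u ^ 3 / 3"
proof -
  define h where "h t = t - t\<^sup>2 / 2 + t ^ 3 / 3 - ln (1 + t)" for t :: real
  have d: "(h has_real_derivative (t ^ 3 / (1 + t))) (at t)" if "- 1 < t" for t
    unfolding h_def using that
    by (auto intro!: derivative_eq_intros simp: field_simps power2_eq_square power3_eq_cube)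
  have "h 0 \<le> h u"
  proof (cases "0 \<le> u")
    case True
    show ?thesis
    proof (rule DERIV_nonneg_imp_nondecreasing[OF True])
      fix t :: real assume "0 \<le> t" "t \<le> u"
      then show "\<exists>y. DERIV h t :> y \<and> 0 \<le> y"
        using d[of t] by (intro exI[of _ "t ^ 3 / (1 + t)"]) auto
    qed
  next
    case False
    show ?thesis
    proof (rule DERIV_nonpos_imp_nonincreasing[of u 0 h])
      fix t :: real assume t: "u \<le> t" "t \<le> 0"
      then have "t ^ 3 / (1 + t) \<le> 0"
        using assms by (intro divide_nonpos_pos) (auto simp: power3_eq_cube mult_nonneg_nonpos)
      then show "\<exists>y. DERIV h t :> y \<and> y \<le> 0"
        using d[of t] t assms by auto
    qed (use False in auto)
  qed
  then show ?thesis by (simp add: h_def)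
qed

text \<open>Odd powers cancel between \<open>u\<close> and \<open>- u\<close>. The square is the
  Gaussian part of the entropy; the remainder, 2/3 of \<open>u ^ 4\<close>, is rounded up.\<close>

lemma binary_entropy_le:
  assumes "\<bar>u :: real\<bar> < 1"
  shows "(1 + u) * ln (1 + u) + (1 - u) * ln (1 - u) \<le> u\<^sup>2 + u ^ 4"
proof -
  have "(1 + u) * ln (1 + u) \<le> (1 + u) * (u - u\<^sup>2 / 2 + u ^ 3 / 3)"
    using assms by (intro mult_left_mono ln_one_plus_le_cubic) auto
  moreover have "(1 - u) * ln (1 - u) \<le> (1 - u) * (- u - u\<^sup>2 / 2 - u ^ 3 / 3)"
    using assms ln_one_plus_le_cubic[of "- u"] by (intro mult_left_mono) auto
  moreover have "(1 + u) * (u - u\<^sup>2 / 2 + u ^ 3 / 3) + (1 - u) * (- u - u\<^sup>2 / 2 - u ^ 3 / 3)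
      = u\<^sup>2 + 2 / 3 * u ^ 4"
    by (simp add: field_simps power2_eq_square power3_eq_cube power4_eq_xxxx)
  moreover have "0 \<le> u ^ 4" by simp
  ultimately show ?thesis by linarith
qed

text \<open>The bridge takes \<open>n * (N + z $ i)\<close> steps in direction
  \<open>axis i 1\<close> and \<open>n * (N - z $ i)\<close> in the opposite one. Its displacement
  is then twice \<open>n\<close> times \<open>z\<close>, whence the factor 2 in the target, which
  also removes any parity condition. The drift relative to \<open>N\<close> is the argument
  \<open>u\<close> of \<open>binary_entropy_le\<close>.\<close>

lemma end_weight_entropy_bound:
  fixes z :: "int ^ 'd" and N n :: nat
  assumes N: "\<And>i. \<bar>z $ i\<bar> < int N" and n: "0 < n"
  defines "p \<equiv> end_weight (2 * CARD('d) * N * n) (\<lambda>_. 1) (int n *s (\<chi> i. 2 * z $ i)) 0"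
  shows "0 < p"
    and "- ln p \<le> real n * real N * (\<Sum>i\<in>UNIV. (real_of_int (z $ i) / real N)\<^sup>2 + (real_of_int (z $ i) / real N) ^ 4)
      + 2 * real CARD('d) * (ln (2 * real N * real n) + 1)"
proof -
  let ?S = "lattice_steps :: (int ^ 'd) set"
  let ?D = "2 * real CARD('d)"
  define b where "b e = nat (int N + (\<Sum>i\<in>UNIV. z $ i * e $ i))" for e :: "int ^ 'd"
  have sum_axis: "(\<Sum>j\<in>UNIV. z $ j * axis i c $ j) = z $ i * c" for i c
    by (simp add: axis_def if_distrib cong: if_cong)
  have b1: "real (b (axis i 1)) = real N + real_of_int (z $ i)" "int (b (axis i 1)) = int N + z $ i"
    and b2: "real (b (axis i (- 1))) = real N - real_of_int (z $ i)" "int (b (axis i (- 1))) = int N - z $ i" for i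
    using N[of i] by (auto simp: b_def sum_axis)
  have bpos: "0 < b e" and ble: "b e \<le> 2 * N" if e: "e \<in> ?S" for e
  proof -
    obtain i where "e = axis i 1 \<or> e = axis i (- 1)"
      using e unfolding lattice_steps_eq by blast
    then show "0 < b e" "b e \<le> 2 * N"
      using b1(2)[of i] b2(2)[of i] N[of i] by auto
  qed
  have N0: "0 < N" using N[of undefined] by linarith
  have sumb: "(\<Sum>e\<in>?S. b e) = 2 * CARD('d) * N"
  proof -
    have "int (\<Sum>e\<in>?S. b e) = int (2 * CARD('d) * N)"
      by (simp add: sum_lattice_steps b1 b2)
    then show ?thesis by linarith
  qed
  define K where "K = 2 * CARD('d) * N * n"
  have suma: "(\<Sum>e\<in>?S. n * b e) = K"
    unfolding sum_distrib_left[symmetric] sumb K_def by simp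
  have y: "(\<Sum>e\<in>?S. int (n * b e) *s e) = int n *s (\<chi> i. 2 * z $ i)"
  proof -
    have "(\<Sum>e\<in>?S. int (n * b e) *s e) $ j = (int n *s (\<chi> i. 2 * z $ i)) $ j" for j
      by (simp add: sum_lattice_steps b1 b2)
        (simp add: axis_def algebra_simps if_distrib sum.distrib cong: if_cong)
    then show ?thesis by (simp add: vec_eq_iff)
  qed
  have K0: "0 < K" using N0 n by (simp add: K_def)
  let ?q = "fact K / (?D ^ K * (\<Prod>e\<in>?S. fact (n * b e))) :: real"
  have pp: "0 < (\<Prod>e\<in>?S. fact (n * b e) :: real)"
    by (intro prod_pos) simp
  have q: "?q \<le> p"
    using end_weight_ge_multinomial[OF suma, of 0] unfolding p_def y K_def by simp
  have q0: "0 < ?q" using pp by simp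
  then show "0 < p" using q by linarith
  have "- ln p \<le> - ln ?q" using q q0 by simp
  also have "- ln ?q = (\<Sum>e\<in>?S. ln (fact (n * b e))) + real K * ln ?D - ln (fact K)"
  proof -
    have "ln ?q = ln (fact K) - (ln (?D ^ K) + ln (\<Prod>e\<in>?S. fact (n * b e)))"
      using pp by (simp add: ln_div ln_mult)
    moreover have "ln (?D ^ K) = real K * ln ?D"
      by (rule ln_realpow)
    moreover have "ln (\<Prod>e\<in>?S. fact (n * b e) :: real) = (\<Sum>e\<in>?S. ln (fact (n * b e)))"
      by (rule ln_prod) simp_all
    ultimately show ?thesis by linarith
  qed
  also have "\<dots> \<le> (\<Sum>e\<in>?S. real (n * b e) * ln (real (n * b e)) - real (n * b e) + (ln (2 * real N * real n) + 1))
      + real K * ln ?D - (real K * ln (real K) - real K)"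
  proof -
    have "ln (fact (n * b e)) \<le> real (n * b e) * ln (real (n * b e)) - real (n * b e) + (ln (2 * real N * real n) + 1)"
      if e: "e \<in> ?S" for e
    proof -
      have 1: "0 < n * b e" using bpos[OF e] n by simp
      have "real (n * b e) \<le> 2 * real N * real n"
        using of_nat_mono[OF mult_le_mono2[OF ble[OF e], of n], where 'a = real] by (simp add: mult_ac)
      then have "ln (real (n * b e)) \<le> ln (2 * real N * real n)"
        using 1 by (subst ln_le_cancel_iff) (auto intro: less_le_trans)
      then show ?thesis using ln_fact_le[OF 1] by linarith
    qed
    then have "(\<Sum>e\<in>?S. ln (fact (n * b e))) \<le> (\<Sum>e\<in>?S. real (n * b e) * ln (real (n * b e)) - real (n * b e) + (ln (2 * real N * real n) + 1))"
      by (rule sum_mono)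
    then show ?thesis using ln_fact_ge[of K] by linarith
  qed
  also have "\<dots> = (\<Sum>e\<in>?S. real (n * b e) * ln (real (n * b e))) + ?D * (ln (2 * real N * real n) + 1)
      + real K * ln ?D - real K * ln (real K)"
  proof -
    have "(\<Sum>e\<in>?S. real (n * b e)) = real K"
      by (simp flip: suma)
    then show ?thesis
      unfolding sum.distrib sum_subtractf sum_constant card_lattice_steps by (simp add: distrib_left)
  qed
  \<comment> \<open>Splitting off \<open>ln (n * N)\<close> leaves \<open>n\<close> times the
    entropy of the counts relative to the uniform step law. The split-off part cancels against
    \<open>ln (fact K)\<close> and the power of \<open>?D\<close>, because the counts add up to
    \<open>K\<close>.\<close>
  also have "(\<Sum>e\<in>?S. real (n * b e) * ln (real (n * b e)))
      = real K * ln (real n * real N) + real n * (\<Sum>e\<in>?S. real (b e) * ln (real (b e) / real N))"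
  proof -
    have "real (n * b e) * ln (real (n * b e))
        = real (n * b e) * ln (real n * real N) + real n * (real (b e) * ln (real (b e) / real N))"
      if "e \<in> ?S" for e
    proof -
      have "ln (real (n * b e)) = ln (real n * real N) + ln (real (b e) / real N)"
        using bpos[OF that] n N0 by (simp add: ln_div ln_mult)
      then show ?thesis
        unfolding of_nat_mult by (simp only: distrib_left mult.assoc)
    qed
    then have "(\<Sum>e\<in>?S. real (n * b e) * ln (real (n * b e)))
      = (\<Sum>e\<in>?S. real (n * b e)) * ln (real n * real N) + real n * (\<Sum>e\<in>?S. real (b e) * ln (real (b e) / real N))"
      unfolding sum_distrib_left sum_distrib_right sum.distrib[symmetric] by (rule sum.cong[OF refl])
    also have "(\<Sum>e\<in>?S. real (n * b e)) = real K"
      by (simp flip: suma)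
    finally show ?thesis .
  qed
  also have "real K * ln (real n * real N) + real n * (\<Sum>e\<in>?S. real (b e) * ln (real (b e) / real N))
      + ?D * (ln (2 * real N * real n) + 1) + real K * ln ?D - real K * ln (real K)
      = real n * (\<Sum>e\<in>?S. real (b e) * ln (real (b e) / real N)) + ?D * (ln (2 * real N * real n) + 1)"
  proof -
    have "ln (real K) = ln (real n * real N) + ln ?D"
      unfolding K_def using N0 n by (simp add: ln_mult)
    then show ?thesis by (simp only: distrib_left)
  qed
  also have "(\<Sum>e\<in>?S. real (b e) * ln (real (b e) / real N))
      \<le> real N * (\<Sum>i\<in>UNIV. (real_of_int (z $ i) / real N)\<^sup>2 + (real_of_int (z $ i) / real N) ^ 4)"
    unfolding sum_lattice_steps sum_distrib_left
  proof (rule sum_mono)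
    fix i :: 'd
    let ?u = "real_of_int (z $ i) / real N"
    have u: "\<bar>?u\<bar> < 1"
      using N[of i] N0 by (simp add: abs_divide)
    have "real (b (axis i 1)) * ln (real (b (axis i 1)) / real N) + real (b (axis i (- 1))) * ln (real (b (axis i (- 1))) / real N)
      = real N * ((1 + ?u) * ln (1 + ?u) + (1 - ?u) * ln (1 - ?u))"
      unfolding b1 b2 using N0 by (simp add: add_divide_distrib diff_divide_distrib algebra_simps)
    also have "\<dots> \<le> real N * (?u\<^sup>2 + ?u ^ 4)"
      by (intro mult_left_mono binary_entropy_le u) simp
    finally show "real (b (axis i 1)) * ln (real (b (axis i 1)) / real N) + real (b (axis i (- 1))) * ln (real (b (axis i (- 1))) / real N)
      \<le> real N * (?u\<^sup>2 + ?u ^ 4)" .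
  qed
  finally show "- ln p \<le> real n * real N * (\<Sum>i\<in>UNIV. (real_of_int (z $ i) / real N)\<^sup>2 + (real_of_int (z $ i) / real N) ^ 4)
      + 2 * real CARD('d) * (ln (2 * real N * real n) + 1)"
    by (simp add: mult_left_mono mult.assoc)
qed

subsection \<open>The walk in a uniform environment\<close>

definition uniform_env :: "(int ^ 'd \<Rightarrow> (int ^ 'd) measure) \<Rightarrow> bool" where
  "uniform_env \<omega> \<longleftrightarrow> \<omega> \<in> space (\<Pi>\<^sub>M x\<in>UNIV. step_laws) \<and>
     (\<forall>y e. lattice_l1 e = 1 \<longrightarrow> measure (\<omega> y) {e} = 1 / (2 * real CARD('d)))"

lemma emeasure_step_kernel_uniform:
  fixes \<omega> :: "int ^ 'd \<Rightarrow> (int ^ 'd) measure"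
  assumes "uniform_env \<omega>"
  shows "emeasure (step_kernel \<omega> z) {v} = (if v - z \<in> lattice_steps then ennreal (1 / (2 * real CARD('d))) else 0)"
proof -
  have sp: "\<omega> \<in> space (\<Pi>\<^sub>M x\<in>UNIV. step_laws)"
    and un: "\<And>y e. lattice_l1 e = 1 \<Longrightarrow> measure (\<omega> y) {e} = 1 / (2 * real CARD('d))"
    using assms by (auto simp: uniform_env_def)
  have pr: "prob_space (\<omega> z)" and st: "sets (\<omega> z) = sets (count_space {e. lattice_l1 e = 1})"
    using sp by (auto simp: space_PiM PiE_iff step_laws_def space_prob_algebra)
  show ?thesis
  proof (cases "v - z \<in> lattice_steps")
    case True
    then have l: "lattice_l1 (v - z) = 1" by (simp add: lattice_steps_def)
    have "emeasure (step_kernel \<omega> z) {z + (v - z)} = emeasure (\<omega> z) {v - z}"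
      by (rule emeasure_step_kernel[OF sp l])
    also have "\<dots> = ennreal (measure (\<omega> z) {v - z})"
      by (rule finite_measure.emeasure_eq_measure[OF prob_space.finite_measure[OF pr]])
    also have "\<dots> = ennreal (1 / (2 * real CARD('d)))"
      unfolding un[OF l] ..
    finally show ?thesis
      unfolding if_P[OF True] add_diff_cancel_left' diff_add_cancel add_diff_eq by simp
  next
    case False
    have "(\<lambda>e. z + e) \<in> measurable (\<omega> z) (count_space UNIV)"
      unfolding measurable_cong_sets[OF st refl] by simp
    moreover have "(\<lambda>e. z + e) -` {v} \<inter> space (\<omega> z) = {}"
      unfolding sets_eq_imp_space_eq[OF st] using False by (auto simp: lattice_steps_def)
    ultimately show ?thesis
      unfolding if_not_P[OF False] step_kernel_def by (subst emeasure_distr) simp_all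
  qed
qed

text \<open>The step average on \<open>ennreal\<close>, so that the Markov property can be stated
  for arbitrary functions without integrability.\<close>

definition estep_avg :: "(int ^ 'd \<Rightarrow> ennreal) \<Rightarrow> int ^ 'd \<Rightarrow> ennreal" where
  "estep_avg g z = (\<Sum>e\<in>lattice_steps. g (z + e) * ennreal (1 / (2 * real CARD('d))))"

lemma nn_integral_step_kernel_uniform:
  assumes "uniform_env \<omega>"
  shows "(\<integral>\<^sup>+v. h v * emeasure (step_kernel \<omega> z) {v} \<partial>count_space UNIV) = estep_avg h z"
proof -
  have "(\<integral>\<^sup>+v. h v * emeasure (step_kernel \<omega> z) {v} \<partial>count_space UNIV)
      = (\<Sum>v\<in>(+) z ` lattice_steps. h v * emeasure (step_kernel \<omega> z) {v})"
  proof (rule nn_integral_count_space')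
    fix v assume "v \<notin> (+) z ` lattice_steps"
    then have "v - z \<notin> lattice_steps"
      by (metis add_diff_cancel_left' diff_add_cancel imageI add.commute)
    then show "h v * emeasure (step_kernel \<omega> z) {v} = 0"
      by (simp add: emeasure_step_kernel_uniform[OF assms])
  qed auto
  also have "\<dots> = estep_avg h z"
    unfolding estep_avg_def
    by (subst sum.reindex) (auto simp: emeasure_step_kernel_uniform[OF assms])
  finally show ?thesis .
qed

lemma estep_avg_ennreal:
  fixes g :: "int ^ 'd \<Rightarrow> real"
  assumes "\<And>v. 0 \<le> g v"
  shows "estep_avg (\<lambda>v. ennreal (g v)) z = ennreal (step_avg g z)"
proof -
  have "estep_avg (\<lambda>v. ennreal (g v)) z = (\<Sum>e\<in>lattice_steps. ennreal (g (z + e) * (1 / (2 * real CARD('d)))))"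
    unfolding estep_avg_def by (intro sum.cong refl ennreal_mult[symmetric] assms) simp
  also have "\<dots> = ennreal (\<Sum>e\<in>lattice_steps. g (z + e) * (1 / (2 * real CARD('d))))"
    by (rule sum_ennreal) (simp add: assms)
  finally show ?thesis
    by (simp add: step_avg_def sum_divide_distrib)
qed

lemma measurable_path_coordinate:
  assumes "\<omega> \<in> space (\<Pi>\<^sub>M x\<in>UNIV. step_laws)"
  shows "(\<lambda>X. X n) \<in> measurable (walk_law \<omega> x) (count_space UNIV)"
  unfolding measurable_cong_sets[OF sets_walk_law[OF assms] refl] by (rule measurable_component_singleton) simp

text \<open>Markov property at time \<open>n\<close>, for a functional \<open>F\<close> of the path
  up to \<open>n\<close>. There are only countably many initial segments, so both sides are sums
  over segments, and the law is needed only on cylinders, where \<open>emeasure_walk_law\<close> is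
  explicit.\<close>

lemma nn_integral_walk_step:
  fixes \<omega> :: "int ^ 'd \<Rightarrow> (int ^ 'd) measure" and F :: "(nat \<Rightarrow> int ^ 'd) \<Rightarrow> ennreal"
  assumes \<omega>: "uniform_env \<omega>"
    and F: "\<And>X Y. (\<And>i. i \<le> n \<Longrightarrow> X i = Y i) \<Longrightarrow> F X = F Y"
  shows "(\<integral>\<^sup>+X. F X * h (X (Suc n)) \<partial>walk_law \<omega> x) = (\<integral>\<^sup>+X. F X * estep_avg h (X n) \<partial>walk_law \<omega> x)"
proof -
  let ?W = "walk_law \<omega> x"
  have sp: "\<omega> \<in> space (\<Pi>\<^sub>M x\<in>UNIV. step_laws)"
    using \<omega> by (simp add: uniform_env_def)
  note [measurable] = measurable_path_coordinate[OF sp]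
  define pre where "pre X = map X [0..<Suc n]" for X :: "nat \<Rightarrow> int ^ 'd"
  \<comment> \<open>Beyond the length of \<open>p\<close> the value \<open>p ! i\<close> is
    unspecified, which is harmless because \<open>F\<close> only looks at indices up to
    \<open>n\<close>.\<close>
  define F' where "F' p = F (\<lambda>i. p ! i)" for p :: "(int ^ 'd) list"
  have F': "F X = F' (pre X)" for X
    unfolding F'_def by (rule F) (simp add: pre_def del: upt_Suc)
  have preD: "pre X = p \<longleftrightarrow> length p = Suc n \<and> (\<forall>i\<le>n. X i = p ! i)" for X p
    by (auto simp: pre_def list_eq_iff_nth_eq less_Suc_eq_le simp del: upt_Suc)
  have [measurable]: "{X. pre X = p} \<in> sets ?W" "{X. pre X = p \<and> X (Suc n) = v} \<in> sets ?W" for p v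
  proof -
    have s: "space ?W = UNIV"
      using sets_eq_imp_space_eq[OF sets_walk_law[OF sp, of x]] by (simp add: space_PiM)
    have "{X\<in>space ?W. length p = Suc n \<and> (\<forall>i\<le>n. X i = p ! i)} \<in> sets ?W" by measurable
    then show "{X. pre X = p} \<in> sets ?W" by (simp add: s preD)
    have "{X\<in>space ?W. (length p = Suc n \<and> (\<forall>i\<le>n. X i = p ! i)) \<and> X (Suc n) = v} \<in> sets ?W" by measurable
    then show "{X. pre X = p \<and> X (Suc n) = v} \<in> sets ?W" by (simp add: s preD)
  qed
  have cyl: "emeasure ?W {X. pre X = p \<and> X (Suc n) = v} = emeasure ?W {X. pre X = p} * emeasure (step_kernel \<omega> (p ! n)) {v}" for p v
  proof (cases "length p = Suc n")
    case True
    let ?q = "\<lambda>i. if i \<le> n then p ! i else v"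
    have "{X. pre X = p \<and> X (Suc n) = v} = {X. \<forall>i\<le>Suc n. X i = ?q i}"
      using True by (auto simp: preD le_Suc_eq)
    moreover have "{X. pre X = p} = {X. \<forall>i\<le>n. X i = p ! i}"
      using True by (auto simp: preD)
    ultimately show ?thesis
      by (simp add: emeasure_walk_law[OF sp] mult.assoc)
  next
    case False
    then show ?thesis by (simp add: preD)
  qed
  let ?c = "\<lambda>q. F' (fst q) * h (snd q)" and ?E = "\<lambda>q. {X. pre X = fst q \<and> X (Suc n) = snd q}"
  have "(\<integral>\<^sup>+X. F X * h (X (Suc n)) \<partial>?W) = (\<integral>\<^sup>+X. (\<integral>\<^sup>+q. ?c q * indicator (?E q) X \<partial>count_space UNIV) \<partial>?W)"
  proof (rule nn_integral_cong)
    fix X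
    have "(\<integral>\<^sup>+q. ?c q * indicator (?E q) X \<partial>count_space UNIV) = (\<Sum>q\<in>{(pre X, X (Suc n))}. ?c q * indicator (?E q) X)"
      by (rule nn_integral_count_space') (auto simp: indicator_def)
    then show "F X * h (X (Suc n)) = (\<integral>\<^sup>+q. ?c q * indicator (?E q) X \<partial>count_space UNIV)"
      by (simp add: F')
  qed
  also have "\<dots> = (\<integral>\<^sup>+q. (\<integral>\<^sup>+X. ?c q * indicator (?E q) X \<partial>?W) \<partial>count_space UNIV)"
    by (rule nn_integral_count_space_nn_integral) auto
  also have "\<dots> = (\<integral>\<^sup>+q. ?c q * (emeasure ?W {X. pre X = fst q} * emeasure (step_kernel \<omega> (fst q ! n)) {snd q}) \<partial>count_space UNIV)"
  proof (rule nn_integral_cong)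
    fix q
    have "(\<integral>\<^sup>+X. ?c q * indicator (?E q) X \<partial>?W) = ?c q * emeasure ?W (?E q)"
      by (rule nn_integral_cmult_indicator) simp
    then show "(\<integral>\<^sup>+X. ?c q * indicator (?E q) X \<partial>?W) = ?c q * (emeasure ?W {X. pre X = fst q} * emeasure (step_kernel \<omega> (fst q ! n)) {snd q})"
      by (simp only: cyl)
  qed
  also have "\<dots> = (\<integral>\<^sup>+p. \<integral>\<^sup>+v. F' p * h v * (emeasure ?W {X. pre X = p} * emeasure (step_kernel \<omega> (p ! n)) {v}) \<partial>count_space UNIV \<partial>count_space UNIV)"
    by (subst nn_integral_fst_count_space[symmetric]) simp
  also have "\<dots> = (\<integral>\<^sup>+p. F' p * emeasure ?W {X. pre X = p} * (\<integral>\<^sup>+v. h v * emeasure (step_kernel \<omega> (p ! n)) {v} \<partial>count_space UNIV) \<partial>count_space UNIV)"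
    by (subst nn_integral_cmult[symmetric]) (simp_all add: mult_ac)
  also have "\<dots> = (\<integral>\<^sup>+p. F' p * estep_avg h (p ! n) * emeasure ?W {X. pre X = p} \<partial>count_space UNIV)"
    by (simp add: nn_integral_step_kernel_uniform[OF \<omega>] mult_ac)
  also have "\<dots> = (\<integral>\<^sup>+p. (\<integral>\<^sup>+X. F' p * estep_avg h (p ! n) * indicator {X. pre X = p} X \<partial>?W) \<partial>count_space UNIV)"
    by (intro nn_integral_cong, subst nn_integral_cmult_indicator) simp_all
  also have "\<dots> = (\<integral>\<^sup>+X. (\<integral>\<^sup>+p. F' p * estep_avg h (p ! n) * indicator {X. pre X = p} X \<partial>count_space UNIV) \<partial>?W)"
    by (rule nn_integral_count_space_nn_integral[symmetric]) auto
  also have "\<dots> = (\<integral>\<^sup>+X. F X * estep_avg h (X n) \<partial>?W)"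
  proof (rule nn_integral_cong)
    fix X
    have "pre X ! n = X n" by (simp add: pre_def del: upt_Suc)
    then show "(\<integral>\<^sup>+p. F' p * estep_avg h (p ! n) * indicator {X. pre X = p} X \<partial>count_space UNIV) = F X * estep_avg h (X n)"
      by (subst nn_integral_count_space'[where A="{pre X}"]) (auto simp: indicator_def F')
  qed
  finally show ?thesis .
qed

text \<open>The last step is integrated first and replaces \<open>g\<close> by a weighted average;
  hence \<open>g\<close> is arbitrary in the induction and the iterate is unfolded on the
  right.\<close>

lemma nn_integral_walk_iterate:
  fixes \<omega> :: "int ^ 'd \<Rightarrow> (int ^ 'd) measure"
  assumes \<omega>: "uniform_env \<omega>"
  shows "(\<integral>\<^sup>+X. (\<Prod>m<n. a (X m)) * g (X n) \<partial>walk_law \<omega> x) = ((\<lambda>g z. a z * estep_avg g z) ^^ n) g x"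
proof (induction n arbitrary: g)
  case 0
  have sp: "\<omega> \<in> space (\<Pi>\<^sub>M x\<in>UNIV. step_laws)"
    using \<omega> by (simp add: uniform_env_def)
  have s: "space (walk_law \<omega> x) = UNIV"
    using sets_eq_imp_space_eq[OF sets_walk_law[OF sp, of x]] by (simp add: space_PiM)
  have one: "emeasure (walk_law \<omega> x) {X. X 0 = z} = indicator {x} z" for z
    using emeasure_walk_law[OF sp, of x 0 "\<lambda>_. z"] by simp
  note [measurable] = measurable_path_coordinate[OF sp]
  have m: "{X\<in>space (walk_law \<omega> x). X 0 = z} \<in> sets (walk_law \<omega> x)" for z
    by measurable
  have "(\<integral>\<^sup>+X. g (X 0) \<partial>walk_law \<omega> x) = (\<integral>\<^sup>+X. (\<integral>\<^sup>+z. g z * indicator {X. X 0 = z} X \<partial>count_space UNIV) \<partial>walk_law \<omega> x)"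
    by (intro nn_integral_cong, subst nn_integral_count_space'[where A="{X 0}" for X]) (auto simp: indicator_def)
  also have "\<dots> = (\<integral>\<^sup>+z. g z * indicator {x} z \<partial>count_space UNIV)"
    using m by (subst nn_integral_count_space_nn_integral) (auto simp: s nn_integral_cmult_indicator one)
  also have "\<dots> = g x"
    by (subst nn_integral_count_space'[where A="{x}"]) (auto simp: indicator_def)
  finally show ?case by simp
next
  case (Suc n)
  have "(\<integral>\<^sup>+X. (\<Prod>m<Suc n. a (X m)) * g (X (Suc n)) \<partial>walk_law \<omega> x)
      = (\<integral>\<^sup>+X. (\<Prod>m<Suc n. a (X m)) * estep_avg g (X n) \<partial>walk_law \<omega> x)"
    by (rule nn_integral_walk_step[OF \<omega>]) auto
  also have "\<dots> = (\<integral>\<^sup>+X. (\<Prod>m<n. a (X m)) * (a (X n) * estep_avg g (X n)) \<partial>walk_law \<omega> x)"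
    by (simp add: mult.assoc)
  also have "\<dots> = ((\<lambda>g z. a z * estep_avg g z) ^^ n) (\<lambda>z. a z * estep_avg g z) x"
    by (rule Suc.IH)
  finally show ?case by (simp only: funpow_Suc_right o_apply)
qed

subsection \<open>Laplace transforms of hitting times\<close>

definition holding_env :: "(int ^ 'd \<Rightarrow> real measure) \<Rightarrow> bool" where
  "holding_env \<sigma> \<longleftrightarrow> \<sigma> \<in> space (\<Pi>\<^sub>M x\<in>UNIV. holding_laws)"

definition holding_laplace :: "real \<Rightarrow> real measure \<Rightarrow> real" where
  "holding_laplace \<theta> s = (\<integral>t. exp (- \<theta> * t) \<partial>s)"

lemma holding_lawsD:
  assumes "s \<in> space holding_laws"
  shows "prob_space s" "sets s = sets (restrict_space borel {0<..})" "space s = {0<..}"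
proof -
  show "prob_space s" and st: "sets s = sets (restrict_space borel {0<..})"
    using assms by (auto simp: holding_laws_def space_prob_algebra)
  show "space s = {0<..}"
    using sets_eq_imp_space_eq[OF st] by (simp add: space_restrict_space)
qed

lemma holding_laws_measurable_borel:
  assumes "s \<in> space holding_laws" "f \<in> borel_measurable borel"
  shows "f \<in> borel_measurable s"
  unfolding measurable_cong_sets[OF holding_lawsD(2)[OF assms(1)] refl]
  using assms(2) by (rule measurable_restrict_space1)

lemma holding_envD: "holding_env \<sigma> \<Longrightarrow> \<sigma> z \<in> space holding_laws"
  by (auto simp: holding_env_def space_PiM PiE_iff)

lemma holding_laplace:
  assumes s: "s \<in> space holding_laws" and "0 \<le> \<theta>"
  shows "(\<integral>\<^sup>+t. ennreal (exp (- \<theta> * t)) \<partial>s) = ennreal (holding_laplace \<theta> s)"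
    and "integrable s (\<lambda>t. exp (- \<theta> * t))"
    and "0 < holding_laplace \<theta> s" and "holding_laplace \<theta> s \<le> 1"
proof -
  interpret prob_space s by (rule holding_lawsD(1)[OF s])
  have m: "(\<lambda>t. exp (- \<theta> * t)) \<in> borel_measurable s"
    by (rule holding_laws_measurable_borel[OF s]) simp
  have b: "exp (- \<theta> * t) \<le> 1" if "t \<in> space s" for t
    using that assms holding_lawsD(3)[OF s] by simp
  show i: "integrable s (\<lambda>t. exp (- \<theta> * t))"
    by (rule integrable_const_bound[where B=1]) (use b m in \<open>auto intro!: AE_I2\<close>)
  show "(\<integral>\<^sup>+t. ennreal (exp (- \<theta> * t)) \<partial>s) = ennreal (holding_laplace \<theta> s)"
    unfolding holding_laplace_def by (rule nn_integral_eq_integral[OF i]) simp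
  show "0 < holding_laplace \<theta> s"
    unfolding holding_laplace_def using i by (rule integral_less_AE_space[of "\<lambda>_. 0", simplified]) (simp_all add: emeasure_space_1)
  have "holding_laplace \<theta> s \<le> (\<integral>t. 1 \<partial>s)"
    unfolding holding_laplace_def by (rule integral_mono[OF i]) (use b in auto)
  then show "holding_laplace \<theta> s \<le> 1" by (simp add: prob_space)
qed

text \<open>With \<open>H\<close> the hitting time of \<open>y\<close>, this is the weight of the
  walk on the event \<open>H = n\<close>. These are the terms of the series into which the Laplace
  transform will be expanded.\<close>

primrec first_hit :: "nat \<Rightarrow> (int ^ 'd \<Rightarrow> real) \<Rightarrow> int ^ 'd \<Rightarrow> int ^ 'd \<Rightarrow> real" where
  "first_hit 0 \<phi> y z = (if z = y then 1 else 0)"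
| "first_hit (Suc n) \<phi> y z = (if z = y then 0 else \<phi> z * step_avg (first_hit n \<phi> y) z)"

lemma first_hit_nonneg:
  assumes "\<And>v. 0 \<le> \<phi> v"
  shows "0 \<le> first_hit n \<phi> y z"
  by (induction n arbitrary: z) (auto intro!: mult_nonneg_nonneg step_avg_nonneg assms)

lemma step_avg_sum: "step_avg (\<lambda>v. \<Sum>j\<in>J. f j v) z = (\<Sum>j\<in>J. step_avg (f j) z)"
  unfolding step_avg_def sum_divide_distrib by (rule sum.swap)

lemma sum_first_hit: "(\<Sum>j\<le>n. first_hit j \<phi> y z) = hit_weight n \<phi> y z"
proof (induction n arbitrary: z)
  case (Suc n)
  show ?case
  proof (cases "z = y")
    case False
    have "(\<Sum>j\<le>Suc n. first_hit j \<phi> y z) = (\<Sum>j\<le>n. first_hit (Suc j) \<phi> y z)"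
      by (subst sum.atMost_Suc_shift) (simp add: False)
    also have "\<dots> = \<phi> z * step_avg (\<lambda>v. \<Sum>j\<le>n. first_hit j \<phi> y v) z"
      by (simp add: False step_avg_sum sum_distrib_left)
    finally show ?thesis by (simp add: Suc.IH False)
  qed (simp add: sum.atMost_Suc_shift del: sum.atMost_Suc)
qed simp

text \<open>The factor 0 at \<open>y\<close> before time \<open>n\<close> removes the paths that
  have already visited \<open>y\<close>, so the indicator at time \<open>n\<close> marks a first
  visit.\<close>

lemma nn_integral_walk_first_hit:
  fixes \<omega> :: "int ^ 'd \<Rightarrow> (int ^ 'd) measure"
  assumes \<omega>: "uniform_env \<omega>" and \<phi>: "\<And>v. 0 \<le> \<phi> v"
  shows "(\<integral>\<^sup>+X. (\<Prod>m<n. if X m = y then 0 else ennreal (\<phi> (X m))) * indicator {y} (X n) \<partial>walk_law \<omega> x)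
    = ennreal (first_hit n \<phi> y x)"
proof -
  let ?a = "\<lambda>z. if z = y then 0 else ennreal (\<phi> z)"
  have "((\<lambda>g z. ?a z * estep_avg g z) ^^ n) (indicator {y}) = (\<lambda>z. ennreal (first_hit n \<phi> y z))"
  proof (induction n)
    case 0
    show ?case by (auto simp: fun_eq_iff indicator_def)
  next
    case (Suc n)
    have "?a z * estep_avg (\<lambda>z. ennreal (first_hit n \<phi> y z)) z = ennreal (first_hit (Suc n) \<phi> y z)" for z
      using \<phi>[of z] step_avg_nonneg[of "first_hit n \<phi> y" z] first_hit_nonneg[OF \<phi>]
      by (simp add: estep_avg_ennreal first_hit_nonneg[OF \<phi>] ennreal_mult)
    then show ?case by (simp add: Suc.IH fun_eq_iff)
  qed
  then show ?thesis
    using nn_integral_walk_iterate[OF \<omega>, where a = ?a and n = n and g = "indicator {y}"] by simp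
qed

lemma nn_integral_holding_law_prod:
  fixes \<sigma> :: "int ^ 'd \<Rightarrow> real measure"
  assumes \<sigma>: "holding_env \<sigma>" and J: "finite J" and f: "f \<in> borel_measurable borel"
  shows "(\<integral>\<^sup>+\<tau>. (\<Prod>j\<in>J. f (\<tau> j)) \<partial>holding_law \<sigma>) = (\<Prod>j\<in>J. \<integral>\<^sup>+t. f t \<partial>\<sigma> (snd j))"
proof -
  let ?M = "\<lambda>(n::nat, x). \<sigma> x"
  have M: "?M j = \<sigma> (snd j)" for j by (cases j) simp
  interpret product_prob_space ?M UNIV
    by (intro product_prob_spaceI) (simp add: M holding_lawsD(1)[OF holding_envD[OF \<sigma>]])
  have fm: "f \<in> borel_measurable (?M j)" for j
    unfolding M by (rule holding_laws_measurable_borel[OF holding_envD[OF \<sigma>] f])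
  have "(\<lambda>\<tau>. f (\<tau> j)) \<in> borel_measurable (PiM J ?M)" if "j \<in> J" for j
    using measurable_component_singleton[OF that] fm by (rule measurable_compose)
  then have pm: "(\<lambda>\<tau>. \<Prod>j\<in>J. f (\<tau> j)) \<in> borel_measurable (PiM J ?M)"
    by (rule borel_measurable_prod_ennreal)
  have "(\<integral>\<^sup>+\<tau>. (\<Prod>j\<in>J. f (\<tau> j)) \<partial>distr (PiM UNIV ?M) (PiM J ?M) (\<lambda>x. restrict x J))
      = (\<integral>\<^sup>+\<tau>. (\<Prod>j\<in>J. f (restrict \<tau> J j)) \<partial>PiM UNIV ?M)"
    by (subst nn_integral_distr) (simp_all add: pm measurable_restrict_subset)
  then have "(\<integral>\<^sup>+\<tau>. (\<Prod>j\<in>J. f (\<tau> j)) \<partial>holding_law \<sigma>)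
      = (\<integral>\<^sup>+\<tau>. (\<Prod>j\<in>J. f (\<tau> j)) \<partial>distr (PiM UNIV ?M) (PiM J ?M) (\<lambda>x. restrict x J))"
    unfolding holding_law_def by simp
  also have "distr (PiM UNIV ?M) (PiM J ?M) (\<lambda>x. restrict x J) = PiM J ?M"
    by (rule distr_PiM_restrict_finite[OF J]) simp
  also have "(\<integral>\<^sup>+\<tau>. (\<Prod>j\<in>J. f (\<tau> j)) \<partial>PiM J ?M) = (\<Prod>j\<in>J. \<integral>\<^sup>+t. f t \<partial>?M j)"
    by (rule product_nn_integral_prod[OF J fm])
  finally show ?thesis by (simp add: M)
qed

section \<open>From the continuous-time process to the embedded walk\<close>

lemma process_at_jump:
  assumes \<tau>: "\<And>j. 0 < \<tau> j" and "jump_time X \<tau> n \<le> t" "t < jump_time X \<tau> (Suc n)"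
  shows "process X \<tau> t = Some (X n)"
proof -
  have sm: "strict_mono (jump_time X \<tau>)"
    by (rule strict_mono_Suc_iff[THEN iffD2]) (simp add: jump_time_def \<tau>)
  have "m = n" if "jump_time X \<tau> m \<le> t \<and> t < jump_time X \<tau> (Suc m)" for m
  proof -
    have "jump_time X \<tau> m < jump_time X \<tau> (Suc n)" "jump_time X \<tau> n < jump_time X \<tau> (Suc m)"
      using that assms(2,3) by linarith+
    then show "m = n"
      unfolding strict_mono_less[OF sm] by linarith
  qed
  then have "(THE n. jump_time X \<tau> n \<le> t \<and> t < jump_time X \<tau> (Suc n)) = n"
    using assms(2,3) by (intro the_equality) blast+
  moreover have "\<exists>n. jump_time X \<tau> n \<le> t \<and> t < jump_time X \<tau> (Suc n)"
    using assms(2,3) by blast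
  ultimately show ?thesis unfolding process_def by simp
qed

lemma process_eq_SomeD:
  assumes "\<And>j. 0 < \<tau> j" and "process X \<tau> t = Some y"
  obtains n where "jump_time X \<tau> n \<le> t" "t < jump_time X \<tau> (Suc n)" "X n = y"
proof -
  from assms(2) obtain n where n: "jump_time X \<tau> n \<le> t" "t < jump_time X \<tau> (Suc n)"
    by (auto simp: process_def split: if_splits)
  have "X n = y"
    using process_at_jump[OF assms(1) n] assms(2) by simp
  with n show thesis by (rule that)
qed

lemma hitting_time_eq:
  assumes \<tau>: "\<And>j. 0 < \<tau> j" and "X n = y" and before: "\<And>m. m < n \<Longrightarrow> X m \<noteq> y"
  shows "hitting_time X \<tau> y = ereal (jump_time X \<tau> n)"
proof -
  have sm: "strict_mono (jump_time X \<tau>)"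
    by (rule strict_mono_Suc_iff[THEN iffD2]) (simp add: jump_time_def \<tau>)
  have nn: "0 \<le> jump_time X \<tau> n"
    unfolding jump_time_def by (intro sum_nonneg less_imp_le \<tau>)
  show ?thesis
    unfolding hitting_time_def
  proof (rule Inf_eqI)
    have "jump_time X \<tau> n < jump_time X \<tau> (Suc n)"
      using sm by (simp add: strict_mono_less)
    then have "process X \<tau> (jump_time X \<tau> n) = Some y"
      using process_at_jump[of \<tau> X n] \<tau> assms(2) by simp
    then show "\<And>i. (\<And>u. u \<in> {ereal t |t. 0 \<le> t \<and> process X \<tau> t = Some y} \<Longrightarrow> i \<le> u) \<Longrightarrow> i \<le> ereal (jump_time X \<tau> n)"
      using nn by blast
  next
    fix u assume "u \<in> {ereal t |t. 0 \<le> t \<and> process X \<tau> t = Some y}"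
    then obtain t where t: "u = ereal t" "process X \<tau> t = Some y" by blast
    from \<tau> t(2) obtain k where k: "jump_time X \<tau> k \<le> t" "X k = y"
      by (rule process_eq_SomeD)
    have "n \<le> k"
    proof (rule ccontr)
      assume "\<not> n \<le> k"
      then show False using before[of k] k(2) by simp
    qed
    then have "jump_time X \<tau> n \<le> t"
      using sm k(1) by (meson order_trans strict_mono_less_eq)
    then show "ereal (jump_time X \<tau> n) \<le> u" by (simp add: t)
  qed
qed

lemma hitting_time_infinite:
  assumes \<tau>: "\<And>j. 0 < \<tau> j" and "\<And>n. X n \<noteq> y"
  shows "hitting_time X \<tau> y = \<infinity>"
proof -
  have none: "\<not> process X \<tau> t = Some y" for t
  proof
    assume "process X \<tau> t = Some y"
    with \<tau> obtain n where "X n = y"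
      by (rule process_eq_SomeD)
    with assms(2) show False by blast
  qed
  then have e: "{ereal t |t. 0 \<le> t \<and> process X \<tau> t = Some y} = {}" by blast
  show ?thesis
    unfolding hitting_time_def e by (simp add: top_ereal_def)
qed

text \<open>Only the index of the first visit to \<open>y\<close> contributes: before it the
  indicator vanishes, after it the product does. The terms involve coordinates only, so the series
  gives both the measurability and the integral of the left side.\<close>

lemma hitting_weight_expansion:
  assumes \<tau>: "\<And>j. 0 < \<tau> j"
  shows "ennreal (if hitting_time X \<tau> y < \<infinity> then exp (- \<theta> * real_of_ereal (hitting_time X \<tau> y)) else 0)
    = (\<Sum>n. (\<Prod>m<n. if X m = y then 0 else ennreal (exp (- \<theta> * \<tau> (m, X m)))) * indicator {y} (X n))"
    (is "_ = suminf ?f")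
proof (cases "\<exists>n. X n = y")
  case False
  then have "hitting_time X \<tau> y = \<infinity>"
    using \<tau> by (intro hitting_time_infinite) auto
  then show ?thesis using False by simp
next
  case True
  define n where "n = (LEAST n. X n = y)"
  have n: "X n = y" and before: "\<And>m. m < n \<Longrightarrow> X m \<noteq> y"
    unfolding n_def using True by (rule LeastI_ex) (rule not_less_Least)
  have zero: "?f k = 0" if "k \<noteq> n" for k
  proof (cases "k < n")
    case True
    then show ?thesis by (simp add: before)
  next
    case False
    then have "n < k" using that by simp
    then have "(\<Prod>m<k. if X m = y then 0 else ennreal (exp (- \<theta> * \<tau> (m, X m)))) = 0"
      using n by (intro prod_zero) auto
    then show ?thesis by simp
  qed
  have "suminf ?f = sum ?f {n}"
    by (rule suminf_finite) (use zero in blast)+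
  also have "\<dots> = ?f n"
    by (simp only: sum.insert sum.empty finite.emptyI empty_iff not_False_eq_True add_0_right)
  also have "?f n = (\<Prod>m<n. ennreal (exp (- \<theta> * \<tau> (m, X m))))"
  proof -
    have "(\<Prod>m<n. if X m = y then 0 else ennreal (exp (- \<theta> * \<tau> (m, X m)))) = (\<Prod>m<n. ennreal (exp (- \<theta> * \<tau> (m, X m))))"
      by (rule prod.cong[OF refl]) (simp add: before)
    then show ?thesis by (simp add: n)
  qed
  also have "\<dots> = ennreal (exp (- \<theta> * jump_time X \<tau> n))"
  proof -
    have "(\<Prod>m<n. ennreal (exp (- \<theta> * \<tau> (m, X m)))) = ennreal (\<Prod>m<n. exp (- \<theta> * \<tau> (m, X m)))"
      by (rule prod_ennreal) simp
    then show ?thesis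
      unfolding jump_time_def sum_distrib_left by (subst exp_sum) simp_all
  qed
  also have "\<dots> = ennreal (if hitting_time X \<tau> y < \<infinity> then exp (- \<theta> * real_of_ereal (hitting_time X \<tau> y)) else 0)"
    using hitting_time_eq[where X = X and n = n and \<tau> = \<tau> and y = y, OF \<tau> n before] by simp
  finally show ?thesis by (rule sym)
qed

lemma hitting_laplace_LIMSEQ:
  fixes \<omega> :: "int ^ 'd \<Rightarrow> (int ^ 'd) measure" and \<sigma> :: "int ^ 'd \<Rightarrow> real measure"
  assumes \<omega>: "uniform_env \<omega>" and \<sigma>: "holding_env \<sigma>" and \<theta>: "0 \<le> \<theta>"
  shows "(\<lambda>n. hit_weight n (\<lambda>z. holding_laplace \<theta> (\<sigma> z)) y x) \<longlonglongrightarrow> hitting_laplace \<theta> x y \<omega> \<sigma>"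
proof -
  let ?W = "walk_law \<omega> x" and ?H = "holding_law \<sigma>" and ?\<phi> = "\<lambda>z. holding_laplace \<theta> (\<sigma> z)"
  have sp: "\<omega> \<in> space (\<Pi>\<^sub>M x\<in>UNIV. step_laws)"
    using \<omega> by (simp add: uniform_env_def)
  have \<phi>0: "0 \<le> ?\<phi> z" for z
    using holding_laplace(3)[OF holding_envD[OF \<sigma>] \<theta>, of z] by simp
  let ?M = "\<lambda>(n::nat, x). \<sigma> x"
  have M: "?M j = \<sigma> (snd j)" for j by (cases j) simp
  interpret H: prob_space ?H
    unfolding holding_law_def
    by (rule prob_space_PiM) (auto simp: holding_lawsD(1)[OF holding_envD[OF \<sigma>]])
  have pos: "0 < \<tau> j" if "\<tau> \<in> space ?H" for \<tau> j
  proof -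
    have "\<tau> j \<in> space (?M j)"
      using that unfolding holding_law_def space_PiM PiE_iff by blast
    then show ?thesis by (simp add: M holding_lawsD(3)[OF holding_envD[OF \<sigma>]])
  qed
  have m\<tau>: "(\<lambda>\<tau>. \<tau> j) \<in> borel_measurable ?H" for j
  proof -
    have "(\<lambda>\<tau>. \<tau> j) \<in> measurable ?H (?M j)"
      unfolding holding_law_def by (rule measurable_component_singleton) simp
    moreover have "(\<lambda>t. t) \<in> borel_measurable (?M j)"
      unfolding M by (rule holding_laws_measurable_borel[OF holding_envD[OF \<sigma>]]) simp
    ultimately show ?thesis by (rule measurable_compose)
  qed
  have mX [measurable]: "(\<lambda>p. fst p n) \<in> measurable (?W \<Otimes>\<^sub>M ?H) (count_space UNIV)" for n
    by (rule measurable_compose[OF measurable_fst measurable_path_coordinate[OF sp]])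
  \<comment> \<open>The holding time is read at a random site. As there are countably many sites,
    measurability of each fixed coordinate is enough.\<close>
  have mt [measurable]: "(\<lambda>p. snd p (n, fst p n)) \<in> borel_measurable (?W \<Otimes>\<^sub>M ?H)" for n
    by (rule measurable_compose_countable[where f = "\<lambda>z p. snd p (n, z)" and g = "\<lambda>p. fst p n", OF measurable_compose[OF measurable_snd m\<tau>] mX])
  define h where "h n p = (\<Prod>m<n. if fst p m = y then 0 else ennreal (exp (- \<theta> * snd p (m, fst p m)))) * indicator {y} (fst p n)"
    for n and p :: "(nat \<Rightarrow> int ^ 'd) \<times> (nat \<times> (int ^ 'd) \<Rightarrow> real)"
  have [measurable]: "h n \<in> borel_measurable (?W \<Otimes>\<^sub>M ?H)" for n
    unfolding h_def by measurable
  let ?g = "\<lambda>(X, \<tau>). if hitting_time X \<tau> y < \<infinity> then exp (- \<theta> * real_of_ereal (hitting_time X \<tau> y)) else 0"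
  have g: "ennreal (?g p) = (\<Sum>n. h n p)" if "p \<in> space (?W \<Otimes>\<^sub>M ?H)" for p
  proof -
    have "snd p \<in> space ?H" using that by (auto simp: space_pair_measure)
    then have "\<And>j. 0 < snd p j" by (rule pos)
    then show ?thesis
      unfolding h_def case_prod_beta by (rule hitting_weight_expansion)
  qed
  have gm: "?g \<in> borel_measurable (?W \<Otimes>\<^sub>M ?H)"
  proof -
    have "(\<lambda>p. enn2real (\<Sum>n. h n p)) \<in> borel_measurable (?W \<Otimes>\<^sub>M ?H)"
      by measurable
    moreover have "enn2real (\<Sum>n. h n p) = ?g p" if "p \<in> space (?W \<Otimes>\<^sub>M ?H)" for p
      unfolding g[OF that, symmetric] by (auto simp: case_prod_beta)
    ultimately show ?thesis by (rule measurable_cong[THEN iffD1, rotated])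
  qed
  have hn: "(\<integral>\<^sup>+p. h n p \<partial>(?W \<Otimes>\<^sub>M ?H)) = ennreal (first_hit n ?\<phi> y x)" for n
  proof -
    have "(\<integral>\<^sup>+p. h n p \<partial>(?W \<Otimes>\<^sub>M ?H)) = (\<integral>\<^sup>+X. (\<integral>\<^sup>+\<tau>. h n (X, \<tau>) \<partial>?H) \<partial>?W)"
      by (rule H.nn_integral_fst[symmetric]) measurable
    also have "\<dots> = (\<integral>\<^sup>+X. (\<Prod>m<n. if X m = y then 0 else ennreal (?\<phi> (X m))) * indicator {y} (X n) \<partial>?W)"
    proof (rule nn_integral_cong)
      fix X :: "nat \<Rightarrow> int ^ 'd"
      let ?J = "(\<lambda>m. (m, X m)) ` {..<n}" and ?c = "(\<Prod>m<n. if X m = y then 0 else 1) * indicator {y} (X n) :: ennreal"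
      \<comment> \<open>The index \<open>m\<close> is part of the pair, so each visit to a site,
        even a repeated one, has its own independent holding time and the product
        factorises.\<close>
      have inj: "inj_on (\<lambda>m. (m, X m)) {..<n}" by (auto simp: inj_on_def)
      have "h n (X, \<tau>) = ?c * (\<Prod>j\<in>?J. ennreal (exp (- \<theta> * \<tau> j)))" for \<tau>
      proof -
        have eq: "(\<Prod>m<n. if X m = y then 0 else ennreal (exp (- \<theta> * \<tau> (m, X m))))
          = (\<Prod>m<n. (if X m = y then 0 else 1) * ennreal (exp (- \<theta> * \<tau> (m, X m))))"
          by (rule prod.cong) auto
        show ?thesis
          unfolding h_def fst_conv snd_conv eq prod.distrib prod.reindex[OF inj] o_def by (simp add: mult_ac)
      qed
      then have "(\<integral>\<^sup>+\<tau>. h n (X, \<tau>) \<partial>?H) = ?c * (\<integral>\<^sup>+\<tau>. (\<Prod>j\<in>?J. ennreal (exp (- \<theta> * \<tau> j))) \<partial>?H)"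
        using m\<tau> by (simp add: nn_integral_cmult)
      also have "(\<integral>\<^sup>+\<tau>. (\<Prod>j\<in>?J. ennreal (exp (- \<theta> * \<tau> j))) \<partial>?H) = (\<Prod>j\<in>?J. \<integral>\<^sup>+t. ennreal (exp (- \<theta> * t)) \<partial>\<sigma> (snd j))"
        by (rule nn_integral_holding_law_prod[OF \<sigma>]) auto
      also have "\<dots> = (\<Prod>m<n. ennreal (?\<phi> (X m)))"
        by (simp add: prod.reindex[OF inj] holding_laplace(1)[OF holding_envD[OF \<sigma>] \<theta>, simplified])
      also have "?c * \<dots> = (\<Prod>m<n. if X m = y then 0 else ennreal (?\<phi> (X m))) * indicator {y} (X n)"
      proof -
        have "(\<Prod>m<n. if X m = y then 0 else ennreal (?\<phi> (X m))) = (\<Prod>m<n. (if X m = y then 0 else 1) * ennreal (?\<phi> (X m)))"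
          by (rule prod.cong) auto
        then show ?thesis by (simp add: prod.distrib mult_ac)
      qed
      finally show "(\<integral>\<^sup>+\<tau>. h n (X, \<tau>) \<partial>?H) = (\<Prod>m<n. if X m = y then 0 else ennreal (?\<phi> (X m))) * indicator {y} (X n)" .
    qed
    also have "\<dots> = ennreal (first_hit n ?\<phi> y x)"
      by (rule nn_integral_walk_first_hit[OF \<omega> \<phi>0])
    finally show ?thesis .
  qed
  have fh: "0 \<le> first_hit n ?\<phi> y x" for n
    by (rule first_hit_nonneg[OF \<phi>0])
  have le1: "(\<Sum>j<n. first_hit j ?\<phi> y x) \<le> 1" for n
  proof (cases n)
    case (Suc k)
    then show ?thesis
      using hit_weight_bounds[where \<phi> = ?\<phi> and n = k and y = y and z = x, OF \<phi>0 holding_laplace(4)[OF holding_envD[OF \<sigma>] \<theta>]]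
      by (simp only: lessThan_Suc_atMost sum_first_hit)
  qed simp
  have sm: "summable (\<lambda>n. first_hit n ?\<phi> y x)"
    using fh le1 by (intro summableI_nonneg_bounded[where x = 1]) auto
  have "hitting_laplace \<theta> x y \<omega> \<sigma> = enn2real (\<integral>\<^sup>+p. ennreal (?g p) \<partial>(?W \<Otimes>\<^sub>M ?H))"
    unfolding hitting_laplace_def quenched_law_def
    using gm by (intro integral_eq_nn_integral) (auto intro!: AE_I2)
  also have "(\<integral>\<^sup>+p. ennreal (?g p) \<partial>(?W \<Otimes>\<^sub>M ?H)) = (\<integral>\<^sup>+p. (\<Sum>n. h n p) \<partial>(?W \<Otimes>\<^sub>M ?H))"
    by (rule nn_integral_cong[OF g])
  also have "\<dots> = (\<Sum>n. ennreal (first_hit n ?\<phi> y x))"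
    by (subst nn_integral_suminf) (simp_all add: hn)
  also have "\<dots> = ennreal (\<Sum>n. first_hit n ?\<phi> y x)"
    by (rule suminf_ennreal2[OF fh sm])
  finally have "hitting_laplace \<theta> x y \<omega> \<sigma> = (\<Sum>n. first_hit n ?\<phi> y x)"
    by (simp add: suminf_nonneg[OF sm fh])
  then have "(\<lambda>n. first_hit n ?\<phi> y x) sums hitting_laplace \<theta> x y \<omega> \<sigma>"
    using sm by (simp add: sums_iff)
  then show ?thesis
    unfolding sums_def_le sum_first_hit .
qed

subsection \<open>Crossing a slab\<close>

lemma sinh_real_ge: "0 \<le> x \<Longrightarrow> x \<le> sinh (x::real)"
proof -
  assume x: "0 \<le> x"
  have "sinh 0 - 0 \<le> sinh x - x"
  proof (rule DERIV_nonneg_imp_nondecreasing[OF x])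
    fix t :: real
    have "((\<lambda>t. sinh t - t) has_real_derivative cosh t - 1) (at t)"
      by (auto intro!: derivative_eq_intros)
    then show "\<exists>y. ((\<lambda>t. sinh t - t) has_real_derivative y) (at t) \<and> 0 \<le> y"
      using cosh_real_ge_1[of t] by (intro exI[of _ "cosh t - 1"]) auto
  qed
  then show ?thesis by simp
qed

lemma sinh_real_le: "0 \<le> x \<Longrightarrow> sinh (x::real) \<le> x * cosh x"
proof -
  assume x: "0 \<le> x"
  have "0 * cosh 0 - sinh 0 \<le> x * cosh x - sinh x"
  proof (rule DERIV_nonneg_imp_nondecreasing[OF x])
    fix t :: real assume "0 \<le> t"
    have "((\<lambda>t. t * cosh t - sinh t) has_real_derivative t * sinh t) (at t)"
      by (auto intro!: derivative_eq_intros)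
    then show "\<exists>y. ((\<lambda>t. t * cosh t - sinh t) has_real_derivative y) (at t) \<and> 0 \<le> y"
      using \<open>0 \<le> t\<close> by (intro exI[of _ "t * sinh t"]) auto
  qed
  then show ?thesis by simp
qed

lemma cosh_minus_one: "cosh (x::real) - 1 = 2 * (sinh (\<bar>x\<bar> / 2))\<^sup>2"
proof -
  have "cosh x = cosh (2 * (\<bar>x\<bar> / 2))" by simp
  also have "\<dots> = 1 + 2 * (sinh (\<bar>x\<bar> / 2))\<^sup>2"
    by (subst cosh_double) (simp add: cosh_square_eq)
  finally show ?thesis by simp
qed

lemma cosh_ge_quadratic: "1 + x\<^sup>2 / 2 \<le> cosh (x::real)"
proof -
  have "(\<bar>x\<bar> / 2)\<^sup>2 \<le> (sinh (\<bar>x\<bar> / 2))\<^sup>2"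
    by (intro power_mono sinh_real_ge) auto
  then show ?thesis
    using cosh_minus_one[of x] by (simp add: power_divide)
qed

text \<open>The error is kept as a factor \<open>cosh x\<close>, which tends to 1 at 0, so the sharp
  coefficient 1/2 is not lost. It comes from \<open>sinh y \<le> y * cosh y\<close> at half the
  argument.\<close>

lemma cosh_le_quadratic: "cosh (x::real) \<le> 1 + x\<^sup>2 / 2 * cosh x"
proof -
  have "(sinh (\<bar>x\<bar> / 2))\<^sup>2 \<le> (\<bar>x\<bar> / 2 * cosh (\<bar>x\<bar> / 2))\<^sup>2"
    by (intro power_mono sinh_real_le) auto
  also have "\<dots> = x\<^sup>2 / 4 * (cosh (\<bar>x\<bar> / 2))\<^sup>2"
    by (simp add: power_mult_distrib power_divide)
  also have "(cosh (\<bar>x\<bar> / 2))\<^sup>2 = 1 + (cosh x - 1) / 2"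
    using cosh_minus_one[of x] by (simp add: cosh_square_eq)
  finally have "cosh x - 1 \<le> x\<^sup>2 / 2 * ((cosh x + 1) / 2)"
    using cosh_minus_one[of x] by (simp add: field_simps)
  also have "\<dots> \<le> x\<^sup>2 / 2 * cosh x"
    using cosh_real_ge_1[of x] by (intro mult_left_mono) auto
  finally show ?thesis by simp
qed

section \<open>Levels in direction r and the moment generating function of a step\<close>

definition level :: "real ^ 'd \<Rightarrow> int ^ 'd \<Rightarrow> real" where
  "level r z = r \<bullet> lattice_to_real z"

lemma level_add: "level r (z + e) = level r z + level r e"
  by (simp add: level_def lattice_to_real_def inner_vec_def distrib_left sum.distrib)

lemma level_axis: "level r (axis i c) = r $ i * real_of_int c"
  by (simp add: level_def lattice_to_real_def inner_vec_def axis_def if_distrib cong: if_cong)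

lemma level_scale: "level r (int n *s z) = real n * level r z"
  by (simp add: level_def lattice_to_real_def inner_vec_def sum_distrib_left mult_ac)

lemma level_step_le:
  assumes "norm r = 1" "e \<in> lattice_steps"
  shows "\<bar>level r e\<bar> \<le> 1"
  using assms(2) component_le_norm_cart[of r] assms(1) unfolding lattice_steps_eq by (auto simp: level_axis)

lemma sum_square_unit:
  fixes r :: "real ^ 'd"
  assumes "norm r = 1" shows "(\<Sum>i\<in>UNIV. (r $ i)\<^sup>2) = 1"
proof -
  have "r \<bullet> r = 1" using assms by (simp add: norm_eq_1)
  then show ?thesis by (simp add: inner_vec_def power2_eq_square)
qed

text \<open>The moment generating function at \<open>g\<close> of the level increment of one step:
  opposite steps combine to a hyperbolic cosine.\<close>

definition step_laplace :: "real ^ 'd \<Rightarrow> real \<Rightarrow> real" where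
  "step_laplace r g = (\<Sum>i\<in>UNIV. cosh (g * r $ i)) / real CARD('d)"

text \<open>To second order in \<open>g\<close> the direction \<open>r\<close> enters only through
  the sum of its squared components. This isotropy is why the Euclidean norm governs the small-speed
  asymptotics.\<close>

lemma step_laplace_ge:
  fixes r :: "real ^ 'd"
  assumes "norm r = 1"
  shows "1 + g\<^sup>2 / (2 * real CARD('d)) \<le> step_laplace r g"
proof -
  have "(\<Sum>i\<in>(UNIV::'d set). 1 + (g * r $ i)\<^sup>2 / 2) \<le> (\<Sum>i\<in>UNIV. cosh (g * r $ i))"
    by (intro sum_mono cosh_ge_quadratic)
  also have "(\<Sum>i\<in>(UNIV::'d set). 1 + (g * r $ i)\<^sup>2 / 2) = real CARD('d) + g\<^sup>2 / 2 * (\<Sum>i\<in>UNIV. (r $ i)\<^sup>2)"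
    by (simp add: sum.distrib power_mult_distrib sum_distrib_left)
  finally have "(real CARD('d) + g\<^sup>2 / 2) / real CARD('d) \<le> step_laplace r g"
    unfolding step_laplace_def sum_square_unit[OF assms] by (intro divide_right_mono) auto
  then show ?thesis by (simp add: add_divide_distrib)
qed

lemma step_laplace_le:
  fixes r :: "real ^ 'd"
  assumes "norm r = 1"
  shows "step_laplace r g \<le> 1 + g\<^sup>2 * cosh g / (2 * real CARD('d))"
proof -
  have "cosh (g * r $ i) \<le> 1 + (g * r $ i)\<^sup>2 / 2 * cosh g" for i
  proof -
    have "\<bar>g * r $ i\<bar> \<le> \<bar>g\<bar>"
      using component_le_norm_cart[of r i] assms by (simp add: abs_mult mult_left_le)
    then have "cosh (g * r $ i) \<le> cosh g"
      by (metis abs_ge_zero cosh_real_abs cosh_real_nonneg_le_iff)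
    then have "(g * r $ i)\<^sup>2 / 2 * cosh (g * r $ i) \<le> (g * r $ i)\<^sup>2 / 2 * cosh g"
      by (intro mult_left_mono) auto
    then show ?thesis using cosh_le_quadratic[of "g * r $ i"] by linarith
  qed
  then have "(\<Sum>i\<in>UNIV. cosh (g * r $ i)) \<le> (\<Sum>i\<in>(UNIV::'d set). 1 + (g * r $ i)\<^sup>2 / 2 * cosh g)"
    by (intro sum_mono)
  also have "\<dots> = real CARD('d) + g\<^sup>2 / 2 * cosh g * (\<Sum>i\<in>UNIV. (r $ i)\<^sup>2)"
    by (simp add: sum.distrib power_mult_distrib sum_distrib_left mult_ac)
  finally show ?thesis
    by (simp add: step_laplace_def sum_square_unit[OF assms] field_simps)
qed

text \<open>By the addition theorem the hyperbolic sines of opposite steps cancel, so a hyperbolic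
  cosine of the level is an eigenfunction of averaging.\<close>

lemma step_avg_cosh:
  fixes r :: "real ^ 'd"
  shows "(\<Sum>e\<in>lattice_steps. cosh (p + g * level r e)) / (2 * real CARD('d)) = cosh p * step_laplace r g"
proof -
  have "(\<Sum>e\<in>lattice_steps. cosh (p + g * level r e)) = (\<Sum>i\<in>UNIV. 2 * (cosh p * cosh (g * r $ i)))"
    unfolding sum_lattice_steps level_axis by (intro sum.cong) (simp_all add: cosh_add cosh_diff)
  then show ?thesis
    by (simp add: step_laplace_def sum_distrib_left sum_divide_distrib)
qed

lemma step_avg_exp:
  fixes r :: "real ^ 'd"
  shows "step_avg (\<lambda>v. exp (g * (level r v - a))) z = exp (g * (level r z - a)) * step_laplace r g"
proof -
  have "(\<Sum>e\<in>lattice_steps. exp (g * (level r (z + e) - a)))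
      = (\<Sum>i\<in>UNIV. exp (g * (level r z - a)) * (2 * cosh (g * r $ i)))"
    unfolding sum_lattice_steps level_add level_axis
    by (intro sum.cong) (simp_all add: cosh_def algebra_simps flip: exp_add)
  then show ?thesis
    by (simp add: step_avg_def step_laplace_def sum_distrib_left sum_divide_distrib)
qed

text \<open>Switching the potential off below \<open>b\<close> can only raise weights in [0, 1], and
  it makes the result independent of the field below level \<open>b\<close>.\<close>

definition above :: "real ^ 'd \<Rightarrow> real \<Rightarrow> (int ^ 'd \<Rightarrow> real) \<Rightarrow> int ^ 'd \<Rightarrow> real" where
  "above r b \<phi> v = (if b \<le> level r v then \<phi> v else 1)"

text \<open>With \<open>T\<close> the first passage of level \<open>b + R\<close> (level \<open>a\<close> for \<open>staying\<close>), \<open>crossing\<close> is the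
  weight collected above level \<open>b\<close> before \<open>T\<close>, with paths having \<open>T > n\<close> weighted by \<open>c\<close> at time \<open>n\<close>,
  and \<open>staying\<close> is the probability that \<open>T > n\<close>.\<close>

primrec crossing :: "real \<Rightarrow> real ^ 'd \<Rightarrow> real \<Rightarrow> real \<Rightarrow> (int ^ 'd \<Rightarrow> real) \<Rightarrow> nat \<Rightarrow> int ^ 'd \<Rightarrow> real" where
  "crossing c r b R \<phi> 0 v = (if b + R \<le> level r v then 1 else c)"
| "crossing c r b R \<phi> (Suc n) v =
     (if b + R \<le> level r v then 1 else above r b \<phi> v * step_avg (crossing c r b R \<phi> n) v)"

primrec staying :: "real ^ 'd \<Rightarrow> real \<Rightarrow> nat \<Rightarrow> int ^ 'd \<Rightarrow> real" where
  "staying r a 0 v = (if a \<le> level r v then 0 else 1)"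
| "staying r a (Suc n) v = (if a \<le> level r v then 0 else step_avg (staying r a n) v)"

lemma above_bounds:
  assumes "\<And>v. 0 \<le> \<phi> v" "\<And>v. \<phi> v \<le> 1"
  shows "0 \<le> above r b \<phi> v" "above r b \<phi> v \<le> 1"
  using assms by (auto simp: above_def)

lemma crossing_bounds:
  assumes "\<And>v. 0 \<le> \<phi> v" "\<And>v. \<phi> v \<le> 1" "0 \<le> c" "c \<le> 1"
  shows "0 \<le> crossing c r b R \<phi> n v \<and> crossing c r b R \<phi> n v \<le> 1"
proof (induction n arbitrary: v)
  case (Suc n)
  have 1: "0 \<le> step_avg (crossing c r b R \<phi> n) v"
    by (rule step_avg_nonneg) (simp add: Suc.IH)
  have "step_avg (crossing c r b R \<phi> n) v \<le> step_avg (\<lambda>_. 1) v"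
    by (rule step_avg_mono) (simp add: Suc.IH)
  then have 2: "step_avg (crossing c r b R \<phi> n) v \<le> 1" by simp
  show ?case
    using 1 2 above_bounds[of \<phi> r b v, OF assms(1,2)] by (simp add: mult_le_one)
qed (use assms in auto)

text \<open>A path that passes by time \<open>t\<close> gets at most its full weight on the left;
  one that has not passed by \<open>t\<close> keeps on the right the weight collected so far, which
  later factors can only lower. This frees the horizon \<open>t\<close> from
  \<open>n\<close>.\<close>

lemma crossing_le_truncated:
  assumes "\<And>v. 0 \<le> \<phi> v" "\<And>v. \<phi> v \<le> 1"
  shows "crossing 0 r b R \<phi> n v \<le> crossing 1 r b R \<phi> t v"
proof (induction t arbitrary: n v)
  case 0
  show ?case
    using crossing_bounds[of \<phi> 0 r b R n v] assms by auto
next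
  case (Suc t)
  show ?case
  proof (cases n)
    case 0
    then show ?thesis
      using crossing_bounds[of \<phi> 1 r b R "Suc t" v] assms by auto
  next
    case (Suc k)
    have "step_avg (crossing 0 r b R \<phi> k) v \<le> step_avg (crossing 1 r b R \<phi> t) v"
      by (rule step_avg_mono) (rule Suc.IH)
    then show ?thesis
      using Suc above_bounds[of \<phi> r b v, OF assms] by (simp add: mult_left_mono)
  qed
qed

lemma staying_bounds: "0 \<le> staying r a n v \<and> staying r a n v \<le> 1"
proof (induction n arbitrary: v)
  case (Suc n)
  have 1: "0 \<le> step_avg (staying r a n) v"
    by (rule step_avg_nonneg) (simp add: Suc.IH)
  have "step_avg (staying r a n) v \<le> step_avg (\<lambda>_. 1) v"
    by (rule step_avg_mono) (simp add: Suc.IH)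
  then show ?case using 1 by simp
qed auto

text \<open>The function \<open>u\<close> is constant below the slab, where the walk is not penalised, and
  solves the equation with constant potential above.  Shifting it by one lattice step keeps it
  a supersolution at the kink.\<close>

lemma crossing_constant_le:
  fixes r :: "real ^ 'd"
  assumes r: "norm r = 1" and g: "0 \<le> g" "1 + g\<^sup>2 * cosh g / (2 * real CARD('d)) \<le> exp c"
    and c: "0 \<le> c" and R: "1 \<le> R"
  shows "crossing 1 r b R (\<lambda>_. exp (- c)) t v
    \<le> cosh (g * max 0 (level r v - b - 1)) / cosh (g * (R - 1)) + staying r (b + R) t v"
proof -
  define u where "u v = cosh (g * max 0 (level r v - b - 1))" for v
  have u_step: "above r b (\<lambda>_. exp (- c)) v * step_avg u v \<le> u v" for v
  proof (cases "b \<le> level r v")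
    case False
    have "step_avg u v = step_avg (\<lambda>_. 1) v"
    proof (rule step_avg_cong)
      fix e :: "int ^ 'd" assume "e \<in> lattice_steps"
      then have "level r (v + e) - b - 1 \<le> 0"
        using level_step_le[OF r, of e] False unfolding level_add by linarith
      then show "u (v + e) = 1" by (simp add: u_def max_def)
    qed
    then show ?thesis using False cosh_real_ge_1 by (simp add: above_def u_def)
  next
    case True
    define p where "p = max 0 (level r v - b - 1)"
    have "u (v + e) \<le> cosh (g * p + g * level r e)" for e
    proof -
      \<comment> \<open>Replacing the positive part by the absolute value bounds \<open>u\<close> by
        an unkinked hyperbolic cosine, to which the eigenfunction identity applies.\<close>
      have "max 0 (level r (v + e) - b - 1) \<le> \<bar>p + level r e\<bar>"
        unfolding level_add p_def by linarith
      then have "g * max 0 (level r (v + e) - b - 1) \<le> \<bar>g * p + g * level r e\<bar>"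
        using g(1) by (simp add: abs_mult mult_left_mono flip: distrib_left)
      then show ?thesis
        unfolding u_def using g(1) by (metis abs_ge_zero cosh_real_abs cosh_real_nonneg_le_iff max.cobounded1 mult_nonneg_nonneg)
    qed
    then have "step_avg u v \<le> (\<Sum>e\<in>lattice_steps. cosh (g * p + g * level r e)) / (2 * real CARD('d))"
      unfolding step_avg_def by (intro divide_right_mono sum_mono) auto
    also have "\<dots> = u v * step_laplace r g"
      by (simp add: step_avg_cosh u_def p_def)
    also have "\<dots> \<le> u v * exp c"
      using step_laplace_le[OF r, of g] g(2) cosh_real_nonneg by (intro mult_left_mono) (auto simp: u_def)
    finally have "exp (- c) * step_avg u v \<le> exp (- c) * (u v * exp c)"
      by (intro mult_left_mono) auto
    also have "\<dots> = u v" by (simp add: exp_minus)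
    finally show ?thesis using True by (simp add: above_def)
  qed
  have C: "0 < cosh (g * (R - 1))" by (rule cosh_real_pos)
  have "crossing 1 r b R (\<lambda>_. exp (- c)) t v \<le> u v / cosh (g * (R - 1)) + staying r (b + R) t v"
  proof (induction t arbitrary: v)
    case 0
    have top: "1 \<le> u v / cosh (g * (R - 1))" if "b + R \<le> level r v" for v
    proof -
      have "g * (R - 1) \<le> g * max 0 (level r v - b - 1)"
        using that g(1) R by (intro mult_left_mono) auto
      then have "cosh (g * (R - 1)) \<le> u v"
        unfolding u_def using g(1) R by (subst cosh_real_nonneg_le_iff) auto
      then show ?thesis using C by simp
    qed
    have "0 \<le> u v / cosh (g * (R - 1))" for v
      using C by (simp add: u_def)
    then show ?case using top[of v] by auto
  next
    case (Suc t)
    show ?case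
    proof (cases "b + R \<le> level r v")
      case True
      have "g * (R - 1) \<le> g * max 0 (level r v - b - 1)"
        using True g(1) R by (intro mult_left_mono) auto
      then have "cosh (g * (R - 1)) \<le> u v"
        unfolding u_def using g(1) R by (subst cosh_real_nonneg_le_iff) auto
      then show ?thesis using C True by simp
    next
      case False
      let ?k = "above r b (\<lambda>_. exp (- c)) v"
      have k: "0 \<le> ?k" "?k \<le> 1"
        using above_bounds[of "\<lambda>_. exp (- c)" r b v] c by auto
      have st: "0 \<le> step_avg (staying r (b + R) t) v"
        by (rule step_avg_nonneg) (simp add: staying_bounds)
      have "crossing 1 r b R (\<lambda>_. exp (- c)) (Suc t) v = ?k * step_avg (crossing 1 r b R (\<lambda>_. exp (- c)) t) v"
        using False by simp
      also have "\<dots> \<le> ?k * step_avg (\<lambda>v. u v / cosh (g * (R - 1)) + staying r (b + R) t v) v"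
        by (intro mult_left_mono step_avg_mono Suc.IH k)
      also have "\<dots> = ?k * step_avg u v / cosh (g * (R - 1)) + ?k * step_avg (staying r (b + R) t) v"
        by (simp add: step_avg_add step_avg_cdiv distrib_left)
      also have "\<dots> \<le> u v / cosh (g * (R - 1)) + 1 * step_avg (staying r (b + R) t) v"
        using C by (intro add_mono divide_right_mono u_step mult_right_mono k st) auto
      finally show ?thesis using False by simp
    qed
  qed
  then show ?thesis by (simp add: u_def)
qed

text \<open>Since \<open>step_laplace r g \<ge> 1 / \<beta>\<close>, the process
  \<open>\<beta> ^ n * exp (g * (level r (X n) - (a + 1)))\<close> is a submartingale. At the
  passage it is at most 1, because a step overshoots \<open>a\<close> by at most 1; on paths still
  below \<open>a\<close> at time \<open>t\<close> it is at most \<open>\<beta> ^ t\<close>. The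
  lemma is optional stopping, proved one step at a time.\<close>

lemma staying_exp_bound:
  fixes r :: "real ^ 'd"
  assumes r: "norm r = 1" and g: "0 \<le> g" and v: "level r v \<le> a + 1"
  defines "\<beta> \<equiv> 1 / (1 + g\<^sup>2 / (2 * real CARD('d)))"
  shows "exp (g * (level r v - (a + 1))) \<le> 1 - staying r a t v + \<beta> ^ t * staying r a t v"
  using v
proof (induction t arbitrary: v)
  case 0
  then show ?case using g by (auto simp: mult_nonneg_nonpos)
next
  case (Suc t)
  have \<beta>: "0 < \<beta>" "\<beta> \<le> 1" "\<beta> * (1 + g\<^sup>2 / (2 * real CARD('d))) = 1"
  proof -
    have "0 \<le> g\<^sup>2 / (2 * real CARD('d))" by simp
    then have 1: "1 \<le> 1 + g\<^sup>2 / (2 * real CARD('d))" by linarith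
    have "0 < 1 / D" "1 / D \<le> 1" "1 / D * D = 1" if "1 \<le> D" for D :: real
      using that by simp_all
    from this[OF 1] show "0 < \<beta>" "\<beta> \<le> 1" "\<beta> * (1 + g\<^sup>2 / (2 * real CARD('d))) = 1"
      unfolding \<beta>_def .
  qed
  show ?case
  proof (cases "a \<le> level r v")
    case True
    then show ?thesis using Suc.prems g by (auto simp: mult_nonneg_nonpos)
  next
    case False
    let ?S = "step_avg (staying r a t) v" and ?E = "exp (g * (level r v - (a + 1)))"
    have "?E = \<beta> * (?E * (1 + g\<^sup>2 / (2 * real CARD('d))))"
      using \<beta>(3) by (simp add: mult.left_commute)
    also have "\<dots> \<le> \<beta> * (?E * step_laplace r g)"
      using \<beta> step_laplace_ge[OF r, of g] by (intro mult_left_mono) auto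
    also have "?E * step_laplace r g = step_avg (\<lambda>v. exp (g * (level r v - (a + 1)))) v"
      by (simp add: step_avg_exp)
    also have "\<beta> * \<dots> \<le> \<beta> * step_avg (\<lambda>v. 1 - staying r a t v + \<beta> ^ t * staying r a t v) v"
    proof (intro mult_left_mono step_avg_mono Suc.IH)
      fix e :: "int ^ 'd" assume "e \<in> lattice_steps"
      then show "level r (v + e) \<le> a + 1"
        using level_step_le[OF r, of e] False unfolding level_add by linarith
    qed (use \<beta> in auto)
    also have "\<dots> = \<beta> * (1 - ?S) + \<beta> ^ Suc t * ?S"
      by (simp add: step_avg_add step_avg_diff step_avg_cmult algebra_simps)
    also have "\<dots> \<le> 1 * (1 - ?S) + \<beta> ^ Suc t * ?S"
    proof -
      have "?S \<le> step_avg (\<lambda>_. 1) v"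
        by (rule step_avg_mono) (simp add: staying_bounds)
      then show ?thesis using \<beta> by (intro add_right_mono mult_right_mono) auto
    qed
    finally show ?thesis using False by simp
  qed
qed

text \<open>The condition on \<open>t\<close> makes \<open>\<beta> ^ t \<le> 1 / 2\<close> by
  Bernoulli's inequality. The submartingale bound then leaves half the staying probability below
  \<open>1 - exp (- g * (R + 1))\<close>, so failing to climb \<open>R\<close> within
  \<open>t\<close> steps has probability of order \<open>R / sqrt t\<close> for the smallest
  admissible \<open>g\<close>.\<close>

lemma staying_le:
  fixes r :: "real ^ 'd"
  assumes r: "norm r = 1" and g: "0 < g" and R: "0 \<le> R" and t: "2 * real CARD('d) \<le> g\<^sup>2 * real t"
  shows "staying r (level r v + R) t v \<le> 2 * g * (R + 1)"
proof -
  let ?S = "staying r (level r v + R) t v" and ?x = "g\<^sup>2 / (2 * real CARD('d))"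
  have x: "0 \<le> ?x" "1 \<le> real t * ?x" using t by (simp_all add: field_simps)
  have "1 + real t * ?x \<le> (1 + ?x) ^ t"
    using x(1) by (intro Bernoulli_inequality) linarith
  then have "2 \<le> (1 + ?x) ^ t" using x(2) by linarith
  then have \<beta>: "(1 / (1 + ?x)) ^ t \<le> 1 / 2"
    unfolding power_one_over by (intro frac_le) auto
  have S: "0 \<le> ?S" by (simp add: staying_bounds)
  have "1 - g * (R + 1) \<le> exp (- (g * (R + 1)))"
    using exp_ge_add_one_self[of "- (g * (R + 1))"] by simp
  also have "\<dots> = exp (g * (level r v - (level r v + R + 1)))"
    by (simp add: algebra_simps)
  also have "\<dots> \<le> 1 - ?S + (1 / (1 + ?x)) ^ t * ?S"
    by (rule staying_exp_bound[OF r]) (use g R in auto)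
  also have "\<dots> \<le> 1 - ?S + 1 / 2 * ?S"
    using \<beta> S by (intro add_left_mono mult_right_mono) auto
  finally show ?thesis by simp
qed

subsection \<open>Fluctuations along the walk\<close>

text \<open>The exponential is 1-Lipschitz on the relevant half-line, and the arithmetic-geometric
  mean inequality trades the distance for its square, whose mean can be computed from
  covariances.\<close>

lemma exp_minus_le_square:
  fixes x y \<epsilon> :: real
  assumes "0 \<le> x" "0 \<le> y" "0 < \<epsilon>"
  shows "exp (- x) \<le> exp (- y) + \<epsilon> / 2 + (x - y)\<^sup>2 / (2 * \<epsilon>)"
proof -
  have "exp (- x) - exp (- y) \<le> \<bar>x - y\<bar>"
  proof (cases "y \<le> x")
    case True
    then have "exp (- x) \<le> exp (- y)" by simp
    then show ?thesis by linarith
  next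
    case False
    have "exp (- y) = exp (- x) * exp (- (y - x))" by (simp flip: exp_add)
    then have "exp (- x) - exp (- y) = exp (- x) * (1 - exp (- (y - x)))"
      by (simp add: algebra_simps)
    also have "\<dots> \<le> 1 * (1 - exp (- (y - x)))"
      using assms False by (intro mult_right_mono) auto
    also have "\<dots> \<le> y - x"
      unfolding mult_1 using exp_ge_add_one_self[of "- (y - x)"] by linarith
    finally show ?thesis by linarith
  qed
  moreover have "\<bar>x - y\<bar> \<le> \<epsilon> / 2 + (x - y)\<^sup>2 / (2 * \<epsilon>)"
  proof -
    have "0 \<le> (\<bar>x - y\<bar> - \<epsilon>)\<^sup>2 / (2 * \<epsilon>)" using assms(3) by simp
    also have "\<dots> = (x - y)\<^sup>2 / (2 * \<epsilon>) - \<bar>x - y\<bar> + \<epsilon> / 2"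
    proof -
      have "(\<bar>x - y\<bar> - \<epsilon>)\<^sup>2 = (x - y)\<^sup>2 - 2 * \<epsilon> * \<bar>x - y\<bar> + \<epsilon> * \<epsilon>"
        by (simp add: power2_diff power2_eq_square[of \<epsilon>])
      then show ?thesis
        using assms(3) by (simp add: add_divide_distrib diff_divide_distrib)
    qed
    finally show ?thesis by linarith
  qed
  ultimately show ?thesis by linarith
qed

text \<open>Moments of \<open>\<Sum>m<T. G (X m)\<close> for the first passage \<open>T\<close> of level \<open>a\<close>, capped at time \<open>t\<close>;
  \<open>dev_sq\<close> is the second moment about \<open>- s\<close>.\<close>

primrec dev_sq :: "real ^ 'd \<Rightarrow> real \<Rightarrow> (int ^ 'd \<Rightarrow> real) \<Rightarrow> nat \<Rightarrow> int ^ 'd \<Rightarrow> real \<Rightarrow> real" where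
  "dev_sq r a G 0 v s = s\<^sup>2"
| "dev_sq r a G (Suc t) v s =
     (if a \<le> level r v then s\<^sup>2 else step_avg (\<lambda>u. dev_sq r a G t u (s + G v)) v)"

primrec dev_mean :: "real ^ 'd \<Rightarrow> real \<Rightarrow> (int ^ 'd \<Rightarrow> real) \<Rightarrow> nat \<Rightarrow> int ^ 'd \<Rightarrow> real" where
  "dev_mean r a G 0 v = 0"
| "dev_mean r a G (Suc t) v = (if a \<le> level r v then 0 else G v + step_avg (dev_mean r a G t) v)"

primrec dev_var :: "real ^ 'd \<Rightarrow> real \<Rightarrow> (int ^ 'd \<Rightarrow> real) \<Rightarrow> nat \<Rightarrow> int ^ 'd \<Rightarrow> real" where
  "dev_var r a G 0 v = 0"
| "dev_var r a G (Suc t) v = (if a \<le> level r v then 0 else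
     (G v)\<^sup>2 + 2 * (G v * step_avg (dev_mean r a G t) v) + step_avg (dev_var r a G t) v)"

text \<open>Along the recursion of \<open>dev_sq\<close> the shift \<open>s\<close> becomes random
  through \<open>G\<close>. Expanding the square removes it and leaves two recursions suited to
  expectations over the field.\<close>

lemma dev_sq_eq: "dev_sq r a G t v s = s\<^sup>2 + 2 * s * dev_mean r a G t v + dev_var r a G t v"
proof (induction t arbitrary: v s)
  case (Suc t)
  show ?case
  proof (cases "a \<le> level r v")
    case False
    let ?s = "s + G v"
    have "dev_sq r a G (Suc t) v s = step_avg (\<lambda>u. ?s\<^sup>2 + 2 * ?s * dev_mean r a G t u + dev_var r a G t u) v"
      using False by (simp add: Suc.IH)
    also have "\<dots> = ?s\<^sup>2 + 2 * ?s * step_avg (dev_mean r a G t) v + step_avg (dev_var r a G t) v"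
      by (simp only: step_avg_add step_avg_cmult step_avg_const)
    finally show ?thesis
      using False by (simp add: power2_eq_square algebra_simps)
  qed simp
qed simp

text \<open>The numbers \<open>x\<close> and \<open>y\<close> are the true and the averaged
  potential collected so far along the same path. They evolve together until the passage or time
  \<open>t\<close>, where \<open>exp_minus_le_square\<close> compares the two weights and
  \<open>dev_sq\<close> averages the squared gap.\<close>

lemma crossing_compare:
  assumes V: "\<And>v. 0 \<le> V v" and "0 \<le> c" "0 < \<epsilon>" and "0 \<le> x" "0 \<le> y"
  shows "exp (- x) * crossing 1 r b R (\<lambda>v. exp (- V v)) t v
    \<le> exp (- y) * crossing 1 r b R (\<lambda>_. exp (- c)) t v + \<epsilon> / 2
      + dev_sq r (b + R) (\<lambda>v. if b \<le> level r v then V v - c else 0) t v (x - y) / (2 * \<epsilon>)"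
  using assms(4,5)
proof (induction t arbitrary: v x y)
  case 0
  then show ?case using exp_minus_le_square[of x y \<epsilon>] assms(3) by simp
next
  case (Suc t)
  show ?case
  proof (cases "b + R \<le> level r v")
    case True
    then show ?thesis using exp_minus_le_square[of x y \<epsilon>] assms(3) Suc.prems by simp
  next
    case False
    define V' where "V' = (if b \<le> level r v then V v else 0)"
    define c' where "c' = (if b \<le> level r v then c else 0)"
    let ?G = "\<lambda>v. if b \<le> level r v then V v - c else 0"
    have G: "?G v = V' - c'" by (simp add: V'_def c'_def)
    have e: "above r b (\<lambda>v. exp (- V v)) v = exp (- V')" "above r b (\<lambda>_. exp (- c)) v = exp (- c')"
      by (simp_all add: above_def V'_def c'_def)
    have nn: "0 \<le> x + V'" "0 \<le> y + c'"
      using Suc.prems V assms(2) by (auto simp: V'_def c'_def)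
    have "exp (- x) * crossing 1 r b R (\<lambda>v. exp (- V v)) (Suc t) v
      = step_avg (\<lambda>u. exp (- (x + V')) * crossing 1 r b R (\<lambda>v. exp (- V v)) t u) v"
      using False by (simp only: crossing.simps if_False e step_avg_cmult mult.assoc[symmetric] minus_add_distrib exp_add)
    also have "\<dots> \<le> step_avg (\<lambda>u. exp (- (y + c')) * crossing 1 r b R (\<lambda>_. exp (- c)) t u + \<epsilon> / 2
        + dev_sq r (b + R) ?G t u (x + V' - (y + c')) / (2 * \<epsilon>)) v"
      by (intro step_avg_mono Suc.IH nn)
    also have "\<dots> = exp (- y) * crossing 1 r b R (\<lambda>_. exp (- c)) (Suc t) v + \<epsilon> / 2
        + dev_sq r (b + R) ?G (Suc t) v (x - y) / (2 * \<epsilon>)"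
    proof -
      have s: "x + V' - (y + c') = x - y + ?G v" unfolding G by simp
      show ?thesis
        unfolding s using False
        by (simp only: crossing.simps dev_sq.simps if_False e step_avg_add step_avg_cmult step_avg_cdiv
            step_avg_const mult.assoc[symmetric] minus_add_distrib exp_add)
    qed
    finally show ?thesis .
  qed
qed

text \<open>The truncated Green function: the expected number of visits to \<open>v\<close> before
  time \<open>t\<close> by the unstopped walk from \<open>u\<close>.\<close>

primrec green :: "int ^ 'd \<Rightarrow> nat \<Rightarrow> int ^ 'd \<Rightarrow> real" where
  "green v 0 u = 0"
| "green v (Suc t) u = (if u = v then 1 else 0) + step_avg (green v t) u"

lemma step_avg_coordinate:
  fixes u :: "int ^ 'd"
  shows "step_avg (\<lambda>u. h (u $ i)) u = h (u $ i) + (h (u $ i + 1) + h (u $ i - 1) - 2 * h (u $ i)) / (2 * real CARD('d))"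
proof -
  have "(\<Sum>e\<in>lattice_steps. h ((u + e) $ i))
    = (\<Sum>j\<in>UNIV. 2 * h (u $ i) + (if j = i then h (u $ i + 1) + h (u $ i - 1) - 2 * h (u $ i) else 0))"
    unfolding sum_lattice_steps by (intro sum.cong) (auto simp: axis_def)
  also have "\<dots> = 2 * real CARD('d) * h (u $ i) + (h (u $ i + 1) + h (u $ i - 1) - 2 * h (u $ i))"
    by (simp add: sum.distrib)
  finally show ?thesis
    by (simp add: step_avg_def add_divide_distrib)
qed

text \<open>Tanaka's formula for one coordinate: \<open>\<bar>x\<bar>\<close> is harmonic off \<open>0\<close>, and
  \<open>\<bar>x\<bar> \<le> (x\<^sup>2 / s + s) / 2\<close> trades its expectation for that of \<open>x\<^sup>2\<close>.\<close>

lemma green_le: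
  fixes u v :: "int ^ 'd"
  assumes s: "0 < s"
  shows "green v t u \<le> real CARD('d) * ((((real_of_int (u $ i - v $ i))\<^sup>2 + real t / real CARD('d)) / s + s) / 2
    - \<bar>real_of_int (u $ i - v $ i)\<bar>)"
proof (induction t arbitrary: u)
  case 0
  have "\<bar>x\<bar> \<le> (x\<^sup>2 / s + s) / 2" for x :: real
  proof -
    have "0 \<le> (\<bar>x\<bar> - s)\<^sup>2 / s" using s by simp
    also have "\<dots> = x\<^sup>2 / s - 2 * \<bar>x\<bar> + s"
    proof -
      have "(\<bar>x\<bar> - s)\<^sup>2 = x\<^sup>2 - 2 * \<bar>x\<bar> * s + s * s"
        by (simp add: power2_diff power2_eq_square[of s])
      then show ?thesis using s by (simp add: add_divide_distrib diff_divide_distrib)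
    qed
    finally have "0 \<le> x\<^sup>2 / s - 2 * \<bar>x\<bar> + s" .
    moreover have "\<bar>x\<bar> \<le> (p + s) / 2" if "0 \<le> p - 2 * \<bar>x\<bar> + s" for p
      using that by (simp add: field_simps)
    ultimately show ?thesis by blast
  qed
  from this[of "real_of_int (u $ i - v $ i)"] show ?case by simp
next
  case (Suc t)
  let ?d = "real CARD('d)"
  define q where "q t x = ?d * ((((real_of_int (x - v $ i))\<^sup>2 + real t / ?d) / s + s) / 2 - \<bar>real_of_int (x - v $ i)\<bar>)" for t x
  have "green v (Suc t) u \<le> (if u = v then 1 else 0) + step_avg (\<lambda>u. q t (u $ i)) u"
    unfolding green.simps q_def by (intro add_left_mono step_avg_mono Suc.IH)
  \<comment> \<open>A visit to \<open>v\<close> forces coordinate \<open>i\<close> to be at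
    \<open>v $ i\<close>, so the local time of one coordinate dominates, in every dimension.\<close>
  also have "\<dots> \<le> (if u $ i = v $ i then 1 else 0) + step_avg (\<lambda>u. q t (u $ i)) u"
    by auto
  also have "\<dots> = q (Suc t) (u $ i)"
  proof -
    let ?x = "real_of_int (u $ i - v $ i)"
    have a: "\<bar>?x + 1\<bar> + \<bar>?x - 1\<bar> = 2 * \<bar>?x\<bar> + (if u $ i = v $ i then 2 else 0)"
    proof (cases "u $ i = v $ i")
      case False
      then have "1 \<le> \<bar>?x\<bar>" by linarith
      then show ?thesis using False by (auto simp: abs_if)
    qed simp
    have "q t (u $ i + 1) + q t (u $ i - 1) - 2 * q t (u $ i)
      = ?d * ((2 / s) / 2 - (\<bar>?x + 1\<bar> + \<bar>?x - 1\<bar> - 2 * \<bar>?x\<bar>))"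
    proof -
      have x: "real_of_int (u $ i + 1 - v $ i) = ?x + 1" "real_of_int (u $ i - 1 - v $ i) = ?x - 1" by simp_all
      have "((x + 1)\<^sup>2 + k) / s + ((x - 1)\<^sup>2 + k) / s - 2 * ((x\<^sup>2 + k) / s) = 2 / s" for x k :: real
        using s by (simp add: field_simps power2_eq_square)
      from this[of ?x "real t / ?d"]
      have "((?x + 1)\<^sup>2 + real t / ?d) / s + ((?x - 1)\<^sup>2 + real t / ?d) / s - 2 * ((?x\<^sup>2 + real t / ?d) / s) = 2 / s" .
      moreover have "?d * ((P + s) / 2 - A) + ?d * ((Q + s) / 2 - B) - 2 * (?d * ((O' + s) / 2 - C))
          = ?d * (E / 2 - (A + B - 2 * C))" if "P + Q - 2 * O' = E" for P Q O' A B C E :: real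
        by (simp flip: that add: field_simps)
      ultimately show ?thesis
        unfolding q_def x by blast
    qed
    then have "(q t (u $ i + 1) + q t (u $ i - 1) - 2 * q t (u $ i)) / (2 * ?d) = 1 / s / 2 - (if u $ i = v $ i then 1 else 0)"
      unfolding a by simp
    moreover have "q (Suc t) (u $ i) = q t (u $ i) + 1 / s / 2"
      unfolding q_def using s by (simp add: field_simps)
    ultimately show ?thesis by (simp add: step_avg_coordinate)
  qed
  finally show ?case unfolding q_def .
qed

text \<open>The scale \<open>s = sqrt t\<close> balances the two terms of \<open>green_le\<close>.
  The start is a neighbour of \<open>v\<close> because the covariance of a site with the rest of the
  path begins one step after leaving it.\<close>

lemma green_neighbour_le:
  fixes v e :: "int ^ 'd"
  assumes e: "e \<in> lattice_steps" and "j \<le> t" "1 \<le> t"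
  shows "green v j (v + e) \<le> 2 * real CARD('d) * sqrt (real t)"
proof -
  fix i :: 'd
  let ?d = "real CARD('d)" and ?s = "sqrt (real t)" and ?x = "real_of_int ((v + e) $ i - v $ i)"
  have s: "1 \<le> ?s" using assms by simp
  have ss: "?s * ?s = real t" by simp
  have "?x\<^sup>2 \<le> 1"
    using e unfolding lattice_steps_eq by (auto simp: axis_def)
  moreover have "real j / ?d \<le> real t"
  proof -
    have "real j / ?d \<le> real j / 1" by (intro divide_left_mono) (auto simp: Suc_le_eq)
    then show ?thesis using assms by simp
  qed
  ultimately have "(?x\<^sup>2 + real j / ?d) / ?s \<le> (1 + real t) / ?s"
    using s by (intro divide_right_mono) auto
  also have "\<dots> = 1 / ?s + ?s"
    using s ss by (simp add: add_divide_distrib real_div_sqrt)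
  also have "1 / ?s \<le> ?s"
    using s ss assms(3) by (simp add: divide_le_eq)
  finally have le: "(?x\<^sup>2 + real j / ?d) / ?s \<le> ?s + ?s" by simp
  have "(p + q) / 2 - z \<le> 2 * q" if "p \<le> q + q" "1 \<le> q" "0 \<le> z" for p q z :: real
    using that by (simp add: field_simps)
  note this[OF le s abs_ge_zero[of ?x]]
  then have "?d * (((?x\<^sup>2 + real j / ?d) / ?s + ?s) / 2 - \<bar>?x\<bar>) \<le> ?d * (2 * ?s)"
    by (intro mult_left_mono) auto
  moreover have "0 < ?s" using assms(3) by simp
  ultimately have "green v j (v + e) \<le> ?d * (2 * ?s)"
    using order_trans[OF green_le] by blast
  then show ?thesis by (simp add: mult_ac)
qed

lemma green_nonneg: "0 \<le> green v t u"
  by (induction t arbitrary: u) (auto intro!: add_nonneg_nonneg step_avg_nonneg)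

subsection \<open>Renewal at slab crossings\<close>

text \<open>In the application \<open>W v\<close> is the truncated mean holding time at
  \<open>v\<close> and \<open>B\<close> the truncation level.\<close>

locale iid_field = prob_space M for M :: "'a measure" +
  fixes W :: "int ^ 'd \<Rightarrow> 'a \<Rightarrow> real" and B m :: real
  assumes indep: "indep_vars (\<lambda>_. borel) W UNIV"
    and W_bounds: "\<And>v \<omega>. \<omega> \<in> space M \<Longrightarrow> 0 \<le> W v \<omega> \<and> W v \<omega> \<le> B"
    and W_mean: "\<And>v. expectation (W v) = m"
begin

text \<open>A bounded functional of the sites in \<open>A\<close>. The explicit \<open>F\<close> on
  the product space lets independence over disjoint sets of sites be applied; the bound makes all
  expectations finite.\<close>

definition local_rv :: "(int ^ 'd) set \<Rightarrow> ('a \<Rightarrow> real) \<Rightarrow> bool" where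
  "local_rv A f \<longleftrightarrow> (\<exists>F\<in>borel_measurable (PiM A (\<lambda>_. borel)). \<forall>\<omega>\<in>space M. f \<omega> = F (restrict (\<lambda>v. W v \<omega>) A)) \<and>
     (\<exists>C. \<forall>\<omega>\<in>space M. \<bar>f \<omega>\<bar> \<le> C)"

lemma local_rvI:
  assumes "F \<in> borel_measurable (PiM A (\<lambda>_. borel))"
    and "\<And>\<omega>. \<omega> \<in> space M \<Longrightarrow> f \<omega> = F (restrict (\<lambda>v. W v \<omega>) A)"
    and "\<And>\<omega>. \<omega> \<in> space M \<Longrightarrow> \<bar>f \<omega>\<bar> \<le> C"
  shows "local_rv A f"
  using assms unfolding local_rv_def by blast

lemma local_rvE:
  assumes "local_rv A f"
  obtains F C where "F \<in> borel_measurable (PiM A (\<lambda>_. borel))"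
    and "\<And>\<omega>. \<omega> \<in> space M \<Longrightarrow> f \<omega> = F (restrict (\<lambda>v. W v \<omega>) A)"
    and "\<And>\<omega>. \<omega> \<in> space M \<Longrightarrow> \<bar>f \<omega>\<bar> \<le> C"
  using assms unfolding local_rv_def by blast

lemma W_measurable [measurable]: "W v \<in> borel_measurable M"
  using indep by (simp add: indep_vars_def)

lemma restrict_W_measurable: "(\<lambda>\<omega>. restrict (\<lambda>v. W v \<omega>) A) \<in> measurable M (PiM A (\<lambda>_. borel))"
  by (rule measurable_restrict) (rule W_measurable)

lemma local_rv_measurable:
  assumes "local_rv A f" shows "f \<in> borel_measurable M"
proof -
  obtain F where F: "F \<in> borel_measurable (PiM A (\<lambda>_. borel))" "\<And>\<omega>. \<omega> \<in> space M \<Longrightarrow> f \<omega> = F (restrict (\<lambda>v. W v \<omega>) A)"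
    using assms by (rule local_rvE) blast
  have "(\<lambda>\<omega>. F (restrict (\<lambda>v. W v \<omega>) A)) \<in> borel_measurable M"
    using restrict_W_measurable F(1) by (rule measurable_compose)
  then show ?thesis
    using F(2) by (simp cong: measurable_cong)
qed

lemma local_rv_integrable:
  assumes "local_rv A f" shows "integrable M f"
proof -
  obtain C where C: "\<And>\<omega>. \<omega> \<in> space M \<Longrightarrow> \<bar>f \<omega>\<bar> \<le> C"
    using assms by (rule local_rvE) blast
  show ?thesis
    by (rule integrable_const_bound[where B = C]) (use C local_rv_measurable[OF assms] in \<open>auto intro!: AE_I2\<close>)
qed

lemma local_rv_expectation_mult:
  assumes f: "local_rv A f" and g: "local_rv A' g" and disj: "A \<inter> A' = {}"
  shows "expectation (\<lambda>\<omega>. f \<omega> * g \<omega>) = expectation f * expectation g"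
proof -
  obtain F where F: "F \<in> borel_measurable (PiM A (\<lambda>_. borel))" "\<And>\<omega>. \<omega> \<in> space M \<Longrightarrow> f \<omega> = F (restrict (\<lambda>v. W v \<omega>) A)"
    using f by (rule local_rvE) blast
  obtain G where G: "G \<in> borel_measurable (PiM A' (\<lambda>_. borel))" "\<And>\<omega>. \<omega> \<in> space M \<Longrightarrow> g \<omega> = G (restrict (\<lambda>v. W v \<omega>) A')"
    using g by (rule local_rvE) blast
  let ?F = "F \<circ> (\<lambda>\<omega>. restrict (\<lambda>v. W v \<omega>) A)" and ?G = "G \<circ> (\<lambda>\<omega>. restrict (\<lambda>v. W v \<omega>) A')"
  have iv: "indep_var borel ?F borel ?G"
    using indep_var_restrict[OF indep disj] F(1) G(1) by (intro indep_var_compose) auto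
  have iF: "integrable M ?F"
    using local_rv_integrable[OF f] F(2) by (subst Bochner_Integration.integrable_cong[OF refl, of _ _ f]) auto
  have iG: "integrable M ?G"
    using local_rv_integrable[OF g] G(2) by (subst Bochner_Integration.integrable_cong[OF refl, of _ _ g]) auto
  have "expectation (\<lambda>\<omega>. f \<omega> * g \<omega>) = expectation (\<lambda>\<omega>. ?F \<omega> * ?G \<omega>)"
    by (rule Bochner_Integration.integral_cong) (simp_all add: F(2) G(2))
  also have "\<dots> = expectation ?F * expectation ?G"
    by (rule indep_var_lebesgue_integral[OF iv iF iG])
  also have "expectation ?F = expectation f"
    by (rule Bochner_Integration.integral_cong) (simp_all add: F(2))
  also have "expectation ?G = expectation g"
    by (rule Bochner_Integration.integral_cong) (simp_all add: G(2))
  finally show ?thesis .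
qed

lemma local_rv_const: "local_rv A (\<lambda>_. c)"
  by (rule local_rvI[where F = "\<lambda>_. c" and C = "\<bar>c\<bar>"]) auto

lemma local_rv_add:
  assumes "local_rv A f" "local_rv A g"
  shows "local_rv A (\<lambda>\<omega>. f \<omega> + g \<omega>)"
proof -
  obtain F C where F: "F \<in> borel_measurable (PiM A (\<lambda>_. borel))" "\<And>\<omega>. \<omega> \<in> space M \<Longrightarrow> f \<omega> = F (restrict (\<lambda>v. W v \<omega>) A)"
    "\<And>\<omega>. \<omega> \<in> space M \<Longrightarrow> \<bar>f \<omega>\<bar> \<le> C"
    using assms(1) by (rule local_rvE) blast
  obtain G D where G: "G \<in> borel_measurable (PiM A (\<lambda>_. borel))" "\<And>\<omega>. \<omega> \<in> space M \<Longrightarrow> g \<omega> = G (restrict (\<lambda>v. W v \<omega>) A)"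
    "\<And>\<omega>. \<omega> \<in> space M \<Longrightarrow> \<bar>g \<omega>\<bar> \<le> D"
    using assms(2) by (rule local_rvE) blast
  have "(\<lambda>x. F x + G x) \<in> borel_measurable (PiM A (\<lambda>_. borel))"
    using F(1) G(1) by simp
  moreover have "\<bar>f \<omega> + g \<omega>\<bar> \<le> C + D" if "\<omega> \<in> space M" for \<omega>
    using F(3)[OF that] G(3)[OF that] by linarith
  ultimately show ?thesis
    using F(2) G(2) by (intro local_rvI[where F = "\<lambda>x. F x + G x"]) simp_all
qed

lemma local_rv_mult:
  assumes "local_rv A f" "local_rv A g"
  shows "local_rv A (\<lambda>\<omega>. f \<omega> * g \<omega>)"
proof -
  obtain F C where F: "F \<in> borel_measurable (PiM A (\<lambda>_. borel))" "\<And>\<omega>. \<omega> \<in> space M \<Longrightarrow> f \<omega> = F (restrict (\<lambda>v. W v \<omega>) A)"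
    "\<And>\<omega>. \<omega> \<in> space M \<Longrightarrow> \<bar>f \<omega>\<bar> \<le> C"
    using assms(1) by (rule local_rvE) blast
  obtain G D where G: "G \<in> borel_measurable (PiM A (\<lambda>_. borel))" "\<And>\<omega>. \<omega> \<in> space M \<Longrightarrow> g \<omega> = G (restrict (\<lambda>v. W v \<omega>) A)"
    "\<And>\<omega>. \<omega> \<in> space M \<Longrightarrow> \<bar>g \<omega>\<bar> \<le> D"
    using assms(2) by (rule local_rvE) blast
  have "(\<lambda>x. F x * G x) \<in> borel_measurable (PiM A (\<lambda>_. borel))"
    using F(1) G(1) by simp
  moreover have "\<bar>f \<omega> * g \<omega>\<bar> \<le> C * D" if "\<omega> \<in> space M" for \<omega>
    unfolding abs_mult using F(3)[OF that] G(3)[OF that] by (intro mult_mono) auto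
  ultimately show ?thesis
    using F(2) G(2) by (intro local_rvI[where F = "\<lambda>x. F x * G x"]) simp_all
qed

lemma local_rv_sum:
  assumes "\<And>i. i \<in> I \<Longrightarrow> local_rv A (f i)"
  shows "local_rv A (\<lambda>\<omega>. \<Sum>i\<in>I. f i \<omega>)"
  using assms
  by (induction I rule: infinite_finite_induct) (auto intro: local_rv_const local_rv_add)

lemma local_rv_step_avg:
  fixes f :: "'a \<Rightarrow> int ^ 'd \<Rightarrow> real"
  assumes "\<And>e. e \<in> lattice_steps \<Longrightarrow> local_rv A (\<lambda>\<omega>. f \<omega> (v + e))"
  shows "local_rv A (\<lambda>\<omega>. step_avg (f \<omega>) v)"
proof -
  have "local_rv A (\<lambda>\<omega>. (1 / (2 * real CARD('d))) * (\<Sum>e\<in>lattice_steps. f \<omega> (v + e)))"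
    by (intro local_rv_mult local_rv_const local_rv_sum assms)
  then show ?thesis by (simp add: step_avg_def)
qed

lemma expectation_step_avg:
  fixes f :: "'a \<Rightarrow> int ^ 'd \<Rightarrow> real"
  assumes "\<And>e. e \<in> lattice_steps \<Longrightarrow> local_rv A (\<lambda>\<omega>. f \<omega> (v + e))"
  shows "expectation (\<lambda>\<omega>. step_avg (f \<omega>) v) = step_avg (\<lambda>u. expectation (\<lambda>\<omega>. f \<omega> u)) v"
  unfolding step_avg_def
  by (simp add: Bochner_Integration.integral_sum local_rv_integrable[OF assms])

lemma local_rv_comp:
  assumes "v \<in> A" and h: "h \<in> borel_measurable borel" and bd: "\<And>x. 0 \<le> x \<Longrightarrow> x \<le> B \<Longrightarrow> \<bar>h x\<bar> \<le> C"
  shows "local_rv A (\<lambda>\<omega>. h (W v \<omega>))"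
proof -
  have "(\<lambda>x. x v) \<in> measurable (PiM A (\<lambda>_. borel)) borel"
    using assms(1) by (rule measurable_component_singleton)
  then have "(\<lambda>x. h (x v)) \<in> borel_measurable (PiM A (\<lambda>_. borel :: real measure))"
    using h by (rule measurable_compose)
  moreover have "h (W v \<omega>) = h (restrict (\<lambda>v. W v \<omega>) A v)" for \<omega>
    using assms(1) by simp
  moreover have "\<bar>h (W v \<omega>)\<bar> \<le> C" if "\<omega> \<in> space M" for \<omega>
    using bd W_bounds[OF that] by blast
  ultimately show ?thesis
    by (intro local_rvI[where F = "\<lambda>x. h (x v)"])
qed

lemma local_rv_mono:
  assumes f: "local_rv A f" and "A \<subseteq> A'"
  shows "local_rv A' f"
proof -
  obtain F C where F: "F \<in> borel_measurable (PiM A (\<lambda>_. borel))" "\<And>\<omega>. \<omega> \<in> space M \<Longrightarrow> f \<omega> = F (restrict (\<lambda>v. W v \<omega>) A)"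
    "\<And>\<omega>. \<omega> \<in> space M \<Longrightarrow> \<bar>f \<omega>\<bar> \<le> C"
    using f by (rule local_rvE) blast
  have "(\<lambda>x. restrict x A) \<in> measurable (PiM A' (\<lambda>_. borel)) (PiM A (\<lambda>_. borel :: real measure))"
    using assms(2) by (rule measurable_restrict_subset)
  then have "(\<lambda>x. F (restrict x A)) \<in> borel_measurable (PiM A' (\<lambda>_. borel))"
    using F(1) by (rule measurable_compose)
  moreover have "f \<omega> = F (restrict (restrict (\<lambda>v. W v \<omega>) A') A)" if "\<omega> \<in> space M" for \<omega>
    using F(2)[OF that] assms(2) by (simp add: Int_absorb1)
  ultimately show ?thesis
    using F(3) by (rule local_rvI[where F = "\<lambda>x. F (restrict x A)"])
qed

text \<open>Here \<open>c\<close> will be \<open>(1 - \<delta>) * \<theta>\<close>; by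
  \<open>holding_laplace_le_trunc\<close> this weight dominates the Laplace transform at the
  site.\<close>

definition survival :: "real \<Rightarrow> 'a \<Rightarrow> int ^ 'd \<Rightarrow> real" where
  "survival c \<omega> v = exp (- (c * W v \<omega>))"

lemma survival_bounds:
  assumes "0 \<le> c" "\<omega> \<in> space M"
  shows "0 \<le> survival c \<omega> v" "survival c \<omega> v \<le> 1"
  using assms W_bounds[OF assms(2), of v] by (auto simp: survival_def)

lemma local_rv_above:
  assumes c: "0 \<le> c" and v: "b \<le> level r v \<Longrightarrow> v \<in> A"
  shows "local_rv A (\<lambda>\<omega>. above r b (survival c \<omega>) v)"
proof (cases "b \<le> level r v")
  case True
  have "local_rv A (\<lambda>\<omega>. exp (- (c * W v \<omega>)))"
  proof (rule local_rv_comp[OF v[OF True]])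
    show "\<bar>exp (- (c * x))\<bar> \<le> 1" if "0 \<le> x" for x using that c by simp
  qed simp
  then show ?thesis using True by (simp add: above_def survival_def)
next
  case False
  then show ?thesis by (simp add: above_def local_rv_const)
qed

lemma local_rv_hit_weight:
  assumes c: "0 \<le> c"
  shows "local_rv {u. b \<le> level r u} (\<lambda>\<omega>. hit_weight n (above r b (survival c \<omega>)) y v)"
proof (induction n arbitrary: v)
  case (Suc n)
  have "local_rv {u. b \<le> level r u} (\<lambda>\<omega>. above r b (survival c \<omega>) v * step_avg (hit_weight n (above r b (survival c \<omega>)) y) v)"
    by (intro local_rv_mult local_rv_above c local_rv_step_avg Suc.IH) simp
  then show ?case
    by (cases "v = y") (simp_all add: local_rv_const)
qed (simp add: local_rv_const)

lemma local_rv_hit_weight_survival: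
  assumes c: "0 \<le> c"
  shows "local_rv UNIV (\<lambda>\<omega>. hit_weight n (survival c \<omega>) y v)"
proof (induction n arbitrary: v)
  case (Suc n)
  have "local_rv UNIV (\<lambda>\<omega>. survival c \<omega> v)" for v
    using local_rv_above[OF c, of "level 0 v" 0 v UNIV] by (simp add: above_def)
  then have "local_rv UNIV (\<lambda>\<omega>. survival c \<omega> v * step_avg (hit_weight n (survival c \<omega>) y) v)"
    by (intro local_rv_mult local_rv_step_avg Suc.IH)
  then show ?case
    by (cases "v = y") (simp_all add: local_rv_const)
qed (simp add: local_rv_const)

lemma local_rv_crossing:
  assumes c: "0 \<le> c"
  shows "local_rv UNIV (\<lambda>\<omega>. crossing k r b R (survival c \<omega>) n v)"
proof (induction n arbitrary: v)
  case (Suc n)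
  have "local_rv UNIV (\<lambda>\<omega>. above r b (survival c \<omega>) v * step_avg (crossing k r b R (survival c \<omega>) n) v)"
    by (intro local_rv_mult local_rv_above c local_rv_step_avg Suc.IH) simp
  then show ?case
    by (cases "b + R \<le> level r v") (simp_all add: local_rv_const)
qed (simp add: local_rv_const)

text \<open>Before the first passage the weight involves only sites below level \<^term>\<open>b + R\<close>; after
  it, once the sites below the passage point are discarded, only sites above.  The factor
  \<^term>\<open>f\<close> collects the weight accumulated so far.\<close>

lemma renewal_step:
  fixes r :: "real ^ 'd"
  assumes r: "norm r = 1" and R: "0 \<le> R" and c: "0 \<le> c"
    and later: "\<And>n z. b + R \<le> level r z \<Longrightarrow> level r z \<le> b + R + 1
        \<Longrightarrow> expectation (\<lambda>\<omega>. hit_weight n (above r (level r z) (survival c \<omega>)) y z) \<le> \<rho>"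
    and y: "b + R < level r y"
    and f: "local_rv {u. level r u < b + R} f" "\<And>\<omega>. \<omega> \<in> space M \<Longrightarrow> 0 \<le> f \<omega>"
    and v: "level r v \<le> b + R + 1"
  shows "expectation (\<lambda>\<omega>. f \<omega> * hit_weight n (above r b (survival c \<omega>)) y v)
    \<le> \<rho> * expectation (\<lambda>\<omega>. f \<omega> * crossing 0 r b R (survival c \<omega>) n v)"
proof -
  have top: "expectation (\<lambda>\<omega>. f \<omega> * hit_weight n (above r b (survival c \<omega>)) y v) \<le> \<rho> * expectation f"
    if v: "b + R \<le> level r v" "level r v \<le> b + R + 1"
      and f: "local_rv {u. level r u < b + R} f" "\<And>\<omega>. \<omega> \<in> space M \<Longrightarrow> 0 \<le> f \<omega>" for n v f
  proof -
    let ?h = "\<lambda>\<omega>. hit_weight n (above r (level r v) (survival c \<omega>)) y v"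
    have disj: "{u. level r u < b + R} \<inter> {u. level r v \<le> level r u} = {}"
      using v by auto
    have "expectation (\<lambda>\<omega>. f \<omega> * hit_weight n (above r b (survival c \<omega>)) y v) \<le> expectation (\<lambda>\<omega>. f \<omega> * ?h \<omega>)"
    proof (rule integral_mono)
      show "integrable M (\<lambda>\<omega>. f \<omega> * hit_weight n (above r b (survival c \<omega>)) y v)"
        by (rule local_rv_integrable[of UNIV])
          (intro local_rv_mult local_rv_mono[OF f(1)] local_rv_mono[OF local_rv_hit_weight[OF c]] subset_UNIV)
      show "integrable M (\<lambda>\<omega>. f \<omega> * ?h \<omega>)"
        by (rule local_rv_integrable[of UNIV])
          (intro local_rv_mult local_rv_mono[OF f(1)] local_rv_mono[OF local_rv_hit_weight[OF c]] subset_UNIV)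
    next
      fix \<omega> assume \<omega>: "\<omega> \<in> space M"
      have "hit_weight n (above r b (survival c \<omega>)) y v \<le> ?h \<omega>"
      proof (intro hit_weight_mono above_bounds survival_bounds[OF c \<omega>])
        show "above r b (survival c \<omega>) u \<le> above r (level r v) (survival c \<omega>) u" for u
          using survival_bounds(2)[OF c \<omega>, of u] v R by (simp add: above_def)
      qed
      then show "f \<omega> * hit_weight n (above r b (survival c \<omega>)) y v \<le> f \<omega> * ?h \<omega>"
        using f(2)[OF \<omega>] by (rule mult_left_mono)
    qed
    also have "\<dots> = expectation f * expectation ?h"
      by (rule local_rv_expectation_mult[OF f(1) local_rv_hit_weight[OF c] disj])
    also have "\<dots> \<le> expectation f * \<rho>"
      using f(2) later[OF v] by (intro mult_left_mono Bochner_Integration.integral_nonneg) auto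
    finally show ?thesis by (simp add: mult.commute)
  qed
  show ?thesis
    using v f
  proof (induction n arbitrary: v f)
    case 0
    show ?case
    proof (cases "b + R \<le> level r v")
      case True
      show ?thesis using top[OF True 0, of 0] True by simp
    next
      case False
      then have "v \<noteq> y" using y by auto
      then show ?thesis using False by simp
    qed
  next
    case (Suc n)
    show ?case
    proof (cases "b + R \<le> level r v")
      case True
      show ?thesis using top[OF True Suc.prems, of "Suc n"] True by (simp del: hit_weight.simps)
    next
      case False
      \<comment> \<open>The target lies above the slab, so it cannot be hit before the passage and
        both recursions take the same step.\<close>
      then have vy: "v \<noteq> y" using y by auto
      define f' where "f' \<omega> = f \<omega> * above r b (survival c \<omega>) v" for \<omega>
      have f': "local_rv {u. level r u < b + R} f'"
        unfolding f'_def using False by (intro local_rv_mult Suc.prems local_rv_above c) auto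
      have f'0: "0 \<le> f' \<omega>" if "\<omega> \<in> space M" for \<omega>
        unfolding f'_def by (intro mult_nonneg_nonneg Suc.prems(3) above_bounds survival_bounds[OF c that] that)
      have nb: "level r (v + e) \<le> b + R + 1" if "e \<in> lattice_steps" for e
        using level_step_le[OF r that] False unfolding level_add by linarith
      have l1: "local_rv UNIV (\<lambda>\<omega>. f' \<omega> * hit_weight n (above r b (survival c \<omega>)) y u)" for u
        by (intro local_rv_mult local_rv_mono[OF f'] local_rv_mono[OF local_rv_hit_weight[OF c]] subset_UNIV)
      have l2: "local_rv UNIV (\<lambda>\<omega>. f' \<omega> * crossing 0 r b R (survival c \<omega>) n u)" for u
        by (intro local_rv_mult local_rv_mono[OF f'] local_rv_crossing c subset_UNIV)
      have "expectation (\<lambda>\<omega>. f \<omega> * hit_weight (Suc n) (above r b (survival c \<omega>)) y v)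
        = expectation (\<lambda>\<omega>. step_avg (\<lambda>u. f' \<omega> * hit_weight n (above r b (survival c \<omega>)) y u) v)"
        using vy by (simp add: step_avg_cmult f'_def mult.assoc)
      also have "\<dots> = step_avg (\<lambda>u. expectation (\<lambda>\<omega>. f' \<omega> * hit_weight n (above r b (survival c \<omega>)) y u)) v"
        by (rule expectation_step_avg[OF l1])
      also have "\<dots> \<le> step_avg (\<lambda>u. \<rho> * expectation (\<lambda>\<omega>. f' \<omega> * crossing 0 r b R (survival c \<omega>) n u)) v"
        by (intro step_avg_mono Suc.IH nb f' f'0)
      also have "\<dots> = \<rho> * expectation (\<lambda>\<omega>. step_avg (\<lambda>u. f' \<omega> * crossing 0 r b R (survival c \<omega>) n u) v)"
        unfolding expectation_step_avg[OF l2] by (rule step_avg_cmult)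
      also have "\<dots> = \<rho> * expectation (\<lambda>\<omega>. f \<omega> * crossing 0 r b R (survival c \<omega>) (Suc n) v)"
        using False by (simp add: step_avg_cmult f'_def mult.assoc)
      finally show ?thesis .
    qed
  qed
qed

text \<open>Induction on the number of slabs. One crossing uses up at most \<open>R + 1\<close>
  levels: the width \<open>R\<close> and an overshoot of at most 1 at the passage, from which the
  next slab is measured.\<close>

lemma renewal_bound:
  fixes r :: "real ^ 'd"
  assumes r: "norm r = 1" and R: "0 \<le> R" and c: "0 \<le> c" and \<rho>0: "0 \<le> \<rho>"
    and \<rho>: "\<And>n z. expectation (\<lambda>\<omega>. crossing 0 r (level r z) R (survival c \<omega>) n z) \<le> \<rho>"
    and y: "level r z + real i * (R + 1) \<le> level r y"
  shows "expectation (\<lambda>\<omega>. hit_weight n (above r (level r z) (survival c \<omega>)) y z) \<le> \<rho> ^ i"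
  using y
proof (induction i arbitrary: n z)
  case 0
  have "expectation (\<lambda>\<omega>. hit_weight n (above r (level r z) (survival c \<omega>)) y z) \<le> expectation (\<lambda>_. 1)"
  proof (rule integral_mono)
    show "integrable M (\<lambda>\<omega>. hit_weight n (above r (level r z) (survival c \<omega>)) y z)"
      by (rule local_rv_integrable[OF local_rv_hit_weight[OF c]])
  next
    fix \<omega> assume \<omega>: "\<omega> \<in> space M"
    show "hit_weight n (above r (level r z) (survival c \<omega>)) y z \<le> 1"
      by (intro conjunct2[OF hit_weight_bounds] above_bounds survival_bounds[OF c \<omega>])
  qed simp
  then show ?case by (simp add: prob_space)
next
  case (Suc i)
  let ?b = "level r z"
  have yy: "?b + R + 1 \<le> level r y"
  proof -
    have "0 \<le> real i * (R + 1)" using R by simp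
    moreover have "real (Suc i) * (R + 1) = real i * (R + 1) + (R + 1)"
      by (simp add: algebra_simps)
    ultimately show ?thesis using Suc.prems by linarith
  qed
  have "expectation (\<lambda>\<omega>. 1 * hit_weight n (above r ?b (survival c \<omega>)) y z)
    \<le> \<rho> ^ i * expectation (\<lambda>\<omega>. 1 * crossing 0 r ?b R (survival c \<omega>) n z)"
  proof (rule renewal_step[OF r R c])
    fix n z' assume z': "?b + R \<le> level r z'" "level r z' \<le> ?b + R + 1"
    show "expectation (\<lambda>\<omega>. hit_weight n (above r (level r z') (survival c \<omega>)) y z') \<le> \<rho> ^ i"
    proof (rule Suc.IH)
      show "level r z' + real i * (R + 1) \<le> level r y"
        using Suc.prems z' by (simp add: algebra_simps)
    qed
  next
    show "?b + R < level r y" using yy by linarith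
    show "level r z \<le> ?b + R + 1" using R by linarith
  qed (simp_all add: local_rv_const)
  also have "\<dots> \<le> \<rho> ^ i * \<rho>"
    using \<rho>[of z n] \<rho>0 by (intro mult_left_mono) auto
  finally show ?case by (simp add: mult.commute)
qed

lemma expectation_hit_weight_le:
  fixes r :: "real ^ 'd"
  assumes r: "norm r = 1" and R: "0 \<le> R" and c: "0 \<le> c" and \<rho>0: "0 \<le> \<rho>"
    and \<rho>: "\<And>n z. expectation (\<lambda>\<omega>. crossing 0 r (level r z) R (survival c \<omega>) n z) \<le> \<rho>"
    and y: "level r z + real i * (R + 1) \<le> level r y"
  shows "expectation (\<lambda>\<omega>. hit_weight n (survival c \<omega>) y z) \<le> \<rho> ^ i"
proof -
  have "expectation (\<lambda>\<omega>. hit_weight n (survival c \<omega>) y z) \<le> expectation (\<lambda>\<omega>. hit_weight n (above r (level r z) (survival c \<omega>)) y z)"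
  proof (intro integral_mono local_rv_integrable[OF local_rv_hit_weight[OF c]]
      local_rv_integrable[OF local_rv_hit_weight_survival[OF c]])
    fix \<omega> assume \<omega>: "\<omega> \<in> space M"
    show "hit_weight n (survival c \<omega>) y z \<le> hit_weight n (above r (level r z) (survival c \<omega>)) y z"
    proof (intro hit_weight_mono above_bounds survival_bounds[OF c \<omega>])
      show "survival c \<omega> u \<le> above r (level r z) (survival c \<omega>) u" for u
        using survival_bounds(2)[OF c \<omega>, of u] by (simp add: above_def)
    qed
  qed
  also have "\<dots> \<le> \<rho> ^ i"
    by (rule renewal_bound[OF r R c \<rho>0 \<rho> y])
  finally show ?thesis .
qed

section \<open>Covariances of the field along the walk\<close>

lemma mean_bounds: "0 \<le> m" "m \<le> B"
proof -
  have i: "integrable M (W v)" for v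
    using local_rv_integrable[OF local_rv_comp[of v UNIV "\<lambda>x. x" B]] by simp
  have "expectation (\<lambda>_. 0) \<le> expectation (W v)" for v
    by (rule integral_mono[OF _ i]) (use W_bounds in auto)
  then show "0 \<le> m" using W_mean by simp
  have "expectation (W v) \<le> expectation (\<lambda>_. B)" for v
    by (rule integral_mono[OF i]) (use W_bounds in auto)
  then show "m \<le> B" using W_mean by (simp add: prob_space)
qed

definition fluctuation :: "real ^ 'd \<Rightarrow> real \<Rightarrow> real \<Rightarrow> 'a \<Rightarrow> int ^ 'd \<Rightarrow> real" where
  "fluctuation r b c \<omega> v = (if b \<le> level r v then c * W v \<omega> - c * m else 0)"

lemma fluctuation_abs_le:
  assumes "0 \<le> c" "\<omega> \<in> space M"
  shows "\<bar>fluctuation r b c \<omega> v\<bar> \<le> c * B"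
proof -
  have "\<bar>W v \<omega> - m\<bar> \<le> B"
    using W_bounds[OF assms(2), of v] mean_bounds by linarith
  then have "\<bar>c * (W v \<omega> - m)\<bar> \<le> c * B"
    using assms(1) by (simp add: abs_mult mult_left_mono)
  moreover have "0 \<le> c * B" using assms(1) mean_bounds by simp
  ultimately show ?thesis by (simp add: fluctuation_def right_diff_distrib)
qed

lemma local_rv_fluctuation:
  assumes "0 \<le> c" "v \<in> A"
  shows "local_rv A (\<lambda>\<omega>. fluctuation r b c \<omega> v)"
proof (cases "b \<le> level r v")
  case True
  have "local_rv A (\<lambda>\<omega>. c * W v \<omega> - c * m)"
  proof (rule local_rv_comp[OF assms(2)])
    show "\<bar>c * x - c * m\<bar> \<le> c * B" if "0 \<le> x" "x \<le> B" for x
    proof -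
      have "\<bar>x - m\<bar> \<le> B" using that mean_bounds by linarith
      then have "\<bar>c * (x - m)\<bar> \<le> c * B"
        using assms(1) by (simp add: abs_mult mult_left_mono)
      then show ?thesis by (simp add: right_diff_distrib)
    qed
  qed simp
  then show ?thesis using True by (simp add: fluctuation_def)
next
  case False
  then show ?thesis by (simp add: fluctuation_def local_rv_const)
qed

lemma expectation_fluctuation:
  assumes "0 \<le> c" shows "expectation (\<lambda>\<omega>. fluctuation r b c \<omega> v) = 0"
proof -
  have i: "integrable M (W v)"
    using local_rv_integrable[OF local_rv_comp[of v UNIV "\<lambda>x. x" B]] by simp
  then show ?thesis
    by (cases "b \<le> level r v") (simp_all add: fluctuation_def W_mean prob_space)
qed

lemma expectation_fluctuation_mult_le:
  assumes c: "0 \<le> c"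
  shows "expectation (\<lambda>\<omega>. fluctuation r b c \<omega> v * fluctuation r b c \<omega> u) \<le> (c * B)\<^sup>2 * (if u = v then 1 else 0)"
proof (cases "u = v")
  case True
  have "expectation (\<lambda>\<omega>. fluctuation r b c \<omega> v * fluctuation r b c \<omega> v) \<le> expectation (\<lambda>_. (c * B)\<^sup>2)"
  proof (rule integral_mono)
    show "integrable M (\<lambda>\<omega>. fluctuation r b c \<omega> v * fluctuation r b c \<omega> v)"
      by (rule local_rv_integrable[of UNIV]) (intro local_rv_mult local_rv_fluctuation c UNIV_I)
  next
    fix \<omega> assume \<omega>: "\<omega> \<in> space M"
    have "\<bar>fluctuation r b c \<omega> v\<bar>\<^sup>2 \<le> (c * B)\<^sup>2"
      by (intro power_mono fluctuation_abs_le c \<omega>) simp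
    then show "fluctuation r b c \<omega> v * fluctuation r b c \<omega> v \<le> (c * B)\<^sup>2"
      by (simp add: power2_eq_square[of "fluctuation r b c \<omega> v"])
  qed simp
  then show ?thesis using True by (simp add: prob_space)
next
  case False
  then have "expectation (\<lambda>\<omega>. fluctuation r b c \<omega> v * fluctuation r b c \<omega> u) = 0"
    by (subst local_rv_expectation_mult[of "{v}" _ "{u}"])
      (simp_all add: local_rv_fluctuation c expectation_fluctuation)
  then show ?thesis using False by simp
qed

lemma local_rv_dev_mean:
  assumes c: "0 \<le> c"
  shows "local_rv UNIV (\<lambda>\<omega>. dev_mean r a (fluctuation r b c \<omega>) t v)"
proof (induction t arbitrary: v)
  case (Suc t)
  have "local_rv UNIV (\<lambda>\<omega>. fluctuation r b c \<omega> v + step_avg (dev_mean r a (fluctuation r b c \<omega>) t) v)"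
    by (intro local_rv_add local_rv_fluctuation c local_rv_step_avg Suc.IH UNIV_I)
  then show ?case
    by (cases "a \<le> level r v") (simp_all add: local_rv_const)
qed (simp add: local_rv_const)

lemma local_rv_dev_var:
  assumes c: "0 \<le> c"
  shows "local_rv UNIV (\<lambda>\<omega>. dev_var r a (fluctuation r b c \<omega>) t v)"
proof (induction t arbitrary: v)
  case (Suc t)
  have "local_rv UNIV (\<lambda>\<omega>. fluctuation r b c \<omega> v * fluctuation r b c \<omega> v
      + 2 * (fluctuation r b c \<omega> v * step_avg (dev_mean r a (fluctuation r b c \<omega>) t) v)
      + step_avg (dev_var r a (fluctuation r b c \<omega>) t) v)"
    by (intro local_rv_add local_rv_mult local_rv_const local_rv_fluctuation c local_rv_step_avg
        local_rv_dev_mean Suc.IH UNIV_I)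
  then show ?case
    by (cases "a \<le> level r v") (simp_all add: local_rv_const power2_eq_square)
qed (simp add: local_rv_const)

text \<open>By independence only visits to \<open>v\<close> itself correlate with the value there,
  each contributing at most the variance bound. Stopping at level \<open>a\<close> only drops
  visits, so the unstopped Green function is an upper bound.\<close>

lemma expectation_fluctuation_dev_mean_le:
  assumes c: "0 \<le> c"
  shows "expectation (\<lambda>\<omega>. fluctuation r b c \<omega> v * dev_mean r a (fluctuation r b c \<omega>) t u) \<le> (c * B)\<^sup>2 * green v t u"
proof (induction t arbitrary: u)
  case (Suc t)
  show ?case
  proof (cases "a \<le> level r u")
    case True
    then show ?thesis using green_nonneg[of v "Suc t" u] by (simp del: green.simps)
  next
    case False
    let ?G = "fluctuation r b c"
    have l: "local_rv UNIV (\<lambda>\<omega>. ?G \<omega> v * dev_mean r a (?G \<omega>) t u)" for u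
      by (intro local_rv_mult local_rv_fluctuation c local_rv_dev_mean UNIV_I)
    have "expectation (\<lambda>\<omega>. ?G \<omega> v * dev_mean r a (?G \<omega>) (Suc t) u)
      = expectation (\<lambda>\<omega>. ?G \<omega> v * ?G \<omega> u + step_avg (\<lambda>u. ?G \<omega> v * dev_mean r a (?G \<omega>) t u) u)"
      using False by (simp add: distrib_left step_avg_cmult)
    also have "\<dots> = expectation (\<lambda>\<omega>. ?G \<omega> v * ?G \<omega> u)
        + expectation (\<lambda>\<omega>. step_avg (\<lambda>u. ?G \<omega> v * dev_mean r a (?G \<omega>) t u) u)"
      by (rule Bochner_Integration.integral_add)
        (rule local_rv_integrable[of UNIV], intro local_rv_mult local_rv_fluctuation c local_rv_step_avg l UNIV_I)+
    also have "\<dots> \<le> (c * B)\<^sup>2 * (if u = v then 1 else 0) + step_avg (\<lambda>u. (c * B)\<^sup>2 * green v t u) u"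
      unfolding expectation_step_avg[OF l]
      by (intro add_mono expectation_fluctuation_mult_le c step_avg_mono Suc.IH)
    also have "\<dots> = (c * B)\<^sup>2 * green v (Suc t) u"
      unfolding step_avg_cmult green.simps distrib_left ..
    finally show ?thesis .
  qed
qed simp

text \<open>Each step adds the variance at its site and twice the covariance with the rest of the
  path, the latter starting from a neighbour. The horizon \<open>T\<close> is held fixed while
  \<open>t\<close> varies, so that the cost per step is constant in the induction.\<close>

lemma expectation_dev_var_le:
  assumes c: "0 \<le> c" and T: "1 \<le> T" and t: "t \<le> T"
  shows "expectation (\<lambda>\<omega>. dev_var r a (fluctuation r b c \<omega>) t v)
    \<le> real t * ((c * B)\<^sup>2 * (1 + 4 * real CARD('d) * sqrt (real T)))"
  using t
proof (induction t arbitrary: v)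
  case (Suc t)
  let ?G = "fluctuation r b c" and ?K = "(c * B)\<^sup>2 * (1 + 4 * real CARD('d) * sqrt (real T))"
  have K: "0 \<le> ?K" by simp
  show ?case
  proof (cases "a \<le> level r v")
    case True
    then show ?thesis using K by simp
  next
    case False
    have l: "local_rv UNIV (\<lambda>\<omega>. ?G \<omega> v * dev_mean r a (?G \<omega>) t u)" for u
      by (intro local_rv_mult local_rv_fluctuation c local_rv_dev_mean UNIV_I)
    have l2: "local_rv UNIV (\<lambda>\<omega>. ?G \<omega> v * ?G \<omega> v)"
      by (intro local_rv_mult local_rv_fluctuation c UNIV_I)
    have l3: "local_rv UNIV (\<lambda>\<omega>. dev_var r a (?G \<omega>) t u)" for u
      by (rule local_rv_dev_var[OF c])
    note i = local_rv_integrable[OF l2] local_rv_integrable[OF local_rv_step_avg[OF l]]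
      local_rv_integrable[OF local_rv_step_avg[OF l3]]
    have "expectation (\<lambda>\<omega>. dev_var r a (?G \<omega>) (Suc t) v)
      = expectation (\<lambda>\<omega>. ?G \<omega> v * ?G \<omega> v + 2 * step_avg (\<lambda>u. ?G \<omega> v * dev_mean r a (?G \<omega>) t u) v
          + step_avg (dev_var r a (?G \<omega>) t) v)"
      using False by (simp add: step_avg_cmult power2_eq_square)
    also have "\<dots> = expectation (\<lambda>\<omega>. ?G \<omega> v * ?G \<omega> v)
        + 2 * expectation (\<lambda>\<omega>. step_avg (\<lambda>u. ?G \<omega> v * dev_mean r a (?G \<omega>) t u) v)
        + expectation (\<lambda>\<omega>. step_avg (dev_var r a (?G \<omega>) t) v)"
      using i by simp
    also have "\<dots> \<le> (c * B)\<^sup>2 * 1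
        + 2 * step_avg (\<lambda>u. (c * B)\<^sup>2 * (2 * real CARD('d) * sqrt (real T))) v
        + step_avg (\<lambda>u. real t * ?K) v"
      unfolding expectation_step_avg[OF l] expectation_step_avg[OF l3]
    proof (intro add_mono mult_left_mono step_avg_mono)
      show "expectation (\<lambda>\<omega>. ?G \<omega> v * ?G \<omega> v) \<le> (c * B)\<^sup>2 * 1"
        using expectation_fluctuation_mult_le[OF c, of r b v v] by simp
    next
      fix e :: "int ^ 'd" assume e: "e \<in> lattice_steps"
      have "expectation (\<lambda>\<omega>. ?G \<omega> v * dev_mean r a (?G \<omega>) t (v + e)) \<le> (c * B)\<^sup>2 * green v t (v + e)"
        by (rule expectation_fluctuation_dev_mean_le[OF c])
      also have "\<dots> \<le> (c * B)\<^sup>2 * (2 * real CARD('d) * sqrt (real T))"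
        using Suc.prems T by (intro mult_left_mono green_neighbour_le e) auto
      finally show "expectation (\<lambda>\<omega>. ?G \<omega> v * dev_mean r a (?G \<omega>) t (v + e))
        \<le> (c * B)\<^sup>2 * (2 * real CARD('d) * sqrt (real T))" .
    next
      fix e :: "int ^ 'd"
      show "expectation (\<lambda>\<omega>. dev_var r a (?G \<omega>) t (v + e)) \<le> real t * ?K"
        using Suc.prems by (intro Suc.IH) simp
    qed simp
    also have "\<dots> = real (Suc t) * ?K"
      unfolding step_avg_const by (simp add: algebra_simps)
    finally show ?thesis .
  qed
qed simp

text \<open>The first term is the crossing weight in the constant potential \<open>c * m\<close>,
  the second the chance of not having passed by time \<open>t\<close>, and the last two the price of
  replacing the field by its mean. All of them are independent of \<open>n\<close> and
  \<open>z\<close>.\<close>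

lemma expectation_crossing_le:
  fixes r :: "real ^ 'd"
  assumes r: "norm r = 1" and R: "1 \<le> R" and c: "0 \<le> c"
    and g: "0 \<le> g" "1 + g\<^sup>2 * cosh g / (2 * real CARD('d)) \<le> exp (c * m)"
    and h: "0 < h" "2 * real CARD('d) \<le> h\<^sup>2 * real t" and \<epsilon>: "0 < \<epsilon>"
  shows "expectation (\<lambda>\<omega>. crossing 0 r (level r z) R (survival c \<omega>) n z)
    \<le> 1 / cosh (g * (R - 1)) + 2 * h * (R + 1) + \<epsilon> / 2
      + real t * ((c * B)\<^sup>2 * (1 + 4 * real CARD('d) * sqrt (real t))) / (2 * \<epsilon>)"
proof -
  let ?b = "level r z"
  let ?G = "fluctuation r ?b c"
  have t: "1 \<le> t"
  proof (rule ccontr)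
    assume "\<not> 1 \<le> t"
    then have "t = 0" by simp
    then show False using h by simp
  qed
  have det: "crossing 0 r ?b R (survival c \<omega>) n z
    \<le> (1 / cosh (g * (R - 1)) + 2 * h * (R + 1) + \<epsilon> / 2) + dev_var r (?b + R) (?G \<omega>) t z / (2 * \<epsilon>)"
    if \<omega>: "\<omega> \<in> space M" for \<omega>
  proof -
    have "crossing 0 r ?b R (survival c \<omega>) n z \<le> crossing 1 r ?b R (survival c \<omega>) t z"
      by (intro crossing_le_truncated survival_bounds c \<omega>)
    also have "\<dots> = exp (- 0) * crossing 1 r ?b R (\<lambda>v. exp (- (c * W v \<omega>))) t z"
      by (simp add: survival_def[abs_def])
    also have "\<dots> \<le> exp (- 0) * crossing 1 r ?b R (\<lambda>_. exp (- (c * m))) t z + \<epsilon> / 2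
        + dev_sq r (?b + R) (\<lambda>v. if ?b \<le> level r v then c * W v \<omega> - c * m else 0) t z (0 - 0) / (2 * \<epsilon>)"
      using c mean_bounds W_bounds[OF \<omega>] \<epsilon> by (intro crossing_compare) auto
    also have "\<dots> = crossing 1 r ?b R (\<lambda>_. exp (- (c * m))) t z + \<epsilon> / 2 + dev_var r (?b + R) (?G \<omega>) t z / (2 * \<epsilon>)"
      by (simp add: dev_sq_eq fluctuation_def[abs_def])
    also have "crossing 1 r ?b R (\<lambda>_. exp (- (c * m))) t z
      \<le> cosh (g * max 0 (level r z - ?b - 1)) / cosh (g * (R - 1)) + staying r (?b + R) t z"
      using c mean_bounds by (intro crossing_constant_le r g R) simp
    also have "cosh (g * max 0 (level r z - ?b - 1)) = 1" by simp
    also have "staying r (?b + R) t z \<le> 2 * h * (R + 1)"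
      using R h by (intro staying_le r) auto
    finally show ?thesis by simp
  qed
  have iv: "integrable M (\<lambda>\<omega>. dev_var r (?b + R) (?G \<omega>) t z)"
    by (rule local_rv_integrable[OF local_rv_dev_var[OF c]])
  have "expectation (\<lambda>\<omega>. crossing 0 r ?b R (survival c \<omega>) n z)
    \<le> expectation (\<lambda>\<omega>. (1 / cosh (g * (R - 1)) + 2 * h * (R + 1) + \<epsilon> / 2) + dev_var r (?b + R) (?G \<omega>) t z / (2 * \<epsilon>))"
    by (rule integral_mono[OF local_rv_integrable[OF local_rv_crossing[OF c]] _ det]) (use iv in auto)
  also have "\<dots> = (1 / cosh (g * (R - 1)) + 2 * h * (R + 1) + \<epsilon> / 2)
      + expectation (\<lambda>\<omega>. dev_var r (?b + R) (?G \<omega>) t z) / (2 * \<epsilon>)"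
    using iv by (simp add: prob_space)
  also have "\<dots> \<le> (1 / cosh (g * (R - 1)) + 2 * h * (R + 1) + \<epsilon> / 2)
      + real t * ((c * B)\<^sup>2 * (1 + 4 * real CARD('d) * sqrt (real t))) / (2 * \<epsilon>)"
    using \<epsilon> by (intro add_left_mono divide_right_mono expectation_dev_var_le c t order_refl) auto
  finally show ?thesis .
qed

end

subsection \<open>The field of holding laws\<close>

text \<open>Here \<open>x\<close> is the square root of the effective potential strength. Diffusive
  scaling takes width \<open>K / x\<close>, decay rate \<open>g * x\<close>, time about
  \<open>A / x\<^sup>2\<close> and \<open>\<epsilon> = E / 2\<close>. With
  \<open>E = exp (- (b * K))\<close> the target in the limit, three error terms cost at most
  \<open>E / 4\<close> each and the fluctuation term vanishes with \<open>x\<close>.\<close>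

lemma crossing_parameters:
  fixes d m B b :: real
  assumes d: "0 < d" and m: "0 < m" and b: "0 < b" "b\<^sup>2 < 2 * d * m"
  shows "\<forall>\<^sub>F x in at_right 0. \<exists>R g h \<epsilon>. \<exists>t :: nat. 1 \<le> R \<and> 0 \<le> g \<and> 1 + g\<^sup>2 * cosh g / (2 * d) \<le> exp (x\<^sup>2 * m)
    \<and> 0 < h \<and> 2 * d \<le> h\<^sup>2 * real t \<and> 0 < \<epsilon>
    \<and> 1 / cosh (g * (R - 1)) + 2 * h * (R + 1) + \<epsilon> / 2 + real t * ((x\<^sup>2 * B)\<^sup>2 * (1 + 4 * d * sqrt (real t))) / (2 * \<epsilon>)
      \<le> exp (- (b * x * (R + 1)))"
proof -
  have "b < sqrt (2 * d * m)"
    using b by (simp add: real_less_rsqrt)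
  then obtain g where g: "b < g" "g < sqrt (2 * d * m)"
    using dense by blast
  have g2: "g\<^sup>2 < 2 * d * m"
    using g b d m by (metis less_trans real_sqrt_less_iff real_sqrt_unique less_imp_le)
  \<comment> \<open>Since \<open>g > b\<close>, a large \<open>K\<close> absorbs the factor 2 in
    \<open>1 / cosh y \<le> 2 * exp (- y)\<close>.\<close>
  obtain K where K: "1 \<le> K" "2 * exp (- (g - b) * K) < 1 / 4"
  proof -
    have "((\<lambda>K. 2 * exp (- ((g - b) * K))) \<longlongrightarrow> 2 * 0) at_top"
      using g by (intro tendsto_intros exp_at_bot[THEN filterlim_compose] filterlim_uminus_at_bot_at_top[THEN filterlim_compose]
          filterlim_tendsto_pos_mult_at_top[OF tendsto_const] filterlim_ident) auto
    then have "\<forall>\<^sub>F K in at_top. 2 * exp (- ((g - b) * K)) < 1 / 4"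
      by (intro order_tendstoD(2)) auto
    then have "\<forall>\<^sub>F K in at_top. 1 \<le> K \<and> 2 * exp (- ((g - b) * K)) < 1 / 4"
      using eventually_ge_at_top by (rule eventually_conj[rotated])
    then show thesis
      using that by (auto simp: eventually_at_top_linorder minus_mult_left)
  qed
  define E where "E = exp (- (b * K))"
  \<comment> \<open>This makes \<open>2 * s * K = E / 4\<close>, the share of the paths that fail to
    pass; then \<open>A\<close> is the smallest constant for which
    \<open>t \<ge> A / x\<^sup>2\<close> gives
    \<open>2 * d \<le> (s * x)\<^sup>2 * t\<close>.\<close>
  define s where "s = E / (8 * K)"
  define A where "A = 2 * d / s\<^sup>2"
  have E: "0 < E" by (simp add: E_def)
  have s: "0 < s" using E K by (simp add: s_def)
  have A: "0 < A" using d s by (simp add: A_def)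
  \<comment> \<open>The fluctuation term for \<open>t\<close> at most
    \<open>(A + 1) / x\<^sup>2\<close>: the product of \<open>x ^ 4\<close> and \<open>t\<close> to
    the power 3/2 is of order \<open>x\<close>.\<close>
  define q where "q x = (A + 1) * B\<^sup>2 * (x\<^sup>2 + 4 * d * sqrt (A + 1) * x) / E" for x
  define f where "f x = 1 / cosh (g * K - g * x) + 2 * s * (K + x) + E / 4 + q x - exp (- (b * (K + x)))" for x
  have "(f \<longlongrightarrow> 1 / cosh (g * K - g * 0) + 2 * s * (K + 0) + E / 4
      + (A + 1) * B\<^sup>2 * (0\<^sup>2 + 4 * d * sqrt (A + 1) * 0) / E - exp (- (b * (K + 0)))) (at_right 0)"
    unfolding f_def q_def using E by (intro tendsto_intros) auto
  moreover have "1 / cosh (g * K - g * 0) + 2 * s * (K + 0) + E / 4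
      + (A + 1) * B\<^sup>2 * (0\<^sup>2 + 4 * d * sqrt (A + 1) * 0) / E - exp (- (b * (K + 0))) < 0"
  proof -
    have "1 / cosh (g * K) \<le> 2 * exp (- (g * K))"
    proof -
      have "exp (g * K) / 2 \<le> cosh (g * K)" by (simp add: cosh_def)
      then have "1 / cosh (g * K) \<le> 1 / (exp (g * K) / 2)" by (intro divide_left_mono) auto
      then show ?thesis by (simp add: exp_minus field_simps)
    qed
    also have "\<dots> = 2 * exp (- (g - b) * K) * E"
      by (simp add: E_def algebra_simps flip: exp_add)
    also have "\<dots> < 1 / 4 * E"
      using K(2) E by (intro mult_strict_right_mono) auto
    finally have c: "1 / cosh (g * K) < 1 / 4 * E" .
    have sK: "2 * s * K = 1 / 4 * E"
      using K by (simp add: s_def)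
    have "1 / cosh (g * K - g * 0) + 2 * s * (K + 0) + E / 4
      + (A + 1) * B\<^sup>2 * (0\<^sup>2 + 4 * d * sqrt (A + 1) * 0) / E - exp (- (b * (K + 0)))
      = 1 / cosh (g * K) + 2 * s * K + E / 4 - E"
      by (simp add: E_def)
    then show ?thesis using c sK E by linarith
  qed
  ultimately have ev1: "\<forall>\<^sub>F x in at_right 0. f x < 0"
    by (rule order_tendstoD(2))
  have "((\<lambda>x. g\<^sup>2 * cosh (g * x) / (2 * d)) \<longlongrightarrow> g\<^sup>2 * cosh (g * 0) / (2 * d)) (at_right 0)"
    using d by (intro tendsto_intros) auto
  moreover have "g\<^sup>2 * cosh (g * 0) / (2 * d) < m"
    using g2 d by (simp add: field_simps)
  ultimately have ev2: "\<forall>\<^sub>F x in at_right 0. g\<^sup>2 * cosh (g * x) / (2 * d) < m"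
    by (rule order_tendstoD(2))
  have ev3: "\<forall>\<^sub>F x in at_right (0::real). 0 < x \<and> x < 1"
    by (simp add: eventually_at_right_field) (rule exI[of _ 1], auto)
  show ?thesis
    using ev1 ev2 ev3
  proof eventually_elim
    case (elim x)
    then have x: "0 < x" "x < 1" by auto
    define t where "t = nat \<lceil>A / x\<^sup>2\<rceil>"
    have t1: "A / x\<^sup>2 \<le> real t" unfolding t_def by linarith
    have t2: "real t \<le> (A + 1) / x\<^sup>2"
    proof -
      have "0 \<le> A / x\<^sup>2" using A by simp
      then have "real t \<le> A / x\<^sup>2 + 1" unfolding t_def by linarith
      moreover have "1 \<le> 1 / x\<^sup>2" using x by (simp add: power_le_one)
      ultimately show ?thesis by (simp add: add_divide_distrib)
    qed
    have st: "sqrt (real t) \<le> sqrt (A + 1) / x"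
    proof -
      have "sqrt (real t) \<le> sqrt ((A + 1) / x\<^sup>2)" using t2 by simp
      then show ?thesis using x by (simp add: real_sqrt_divide)
    qed
    have last: "real t * ((x\<^sup>2 * B)\<^sup>2 * (1 + 4 * d * sqrt (real t))) / (2 * (E / 2)) \<le> q x"
    proof -
      have "real t * ((x\<^sup>2 * B)\<^sup>2 * (1 + 4 * d * sqrt (real t)))
        \<le> ((A + 1) / x\<^sup>2) * ((x\<^sup>2 * B)\<^sup>2 * (1 + 4 * d * (sqrt (A + 1) / x)))"
        using t2 st d A x by (intro mult_mono add_left_mono mult_left_mono) auto
      also have "\<dots> = (A + 1) * B\<^sup>2 * (x\<^sup>2 + 4 * d * sqrt (A + 1) * x)"
        using x by (simp add: field_simps power2_eq_square)
      finally show ?thesis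
        unfolding q_def using E by (simp add: divide_right_mono)
    qed
    have eqs: "g * x * (K / x - 1) = g * K - g * x" "2 * (s * x) * (K / x + 1) = 2 * s * (K + x)"
      "b * x * (K / x + 1) = b * (K + x)"
      using x by (simp_all add: field_simps)
    have e4: "E / 2 / 2 = E / 4" by simp
    have "f x < 0" using elim by blast
    then have main: "1 / cosh (g * x * (K / x - 1)) + 2 * (s * x) * (K / x + 1) + (E / 2) / 2
        + real t * ((x\<^sup>2 * B)\<^sup>2 * (1 + 4 * d * sqrt (real t))) / (2 * (E / 2)) \<le> exp (- (b * x * (K / x + 1)))"
      using last unfolding f_def eqs e4 by linarith
    have "1 \<le> K / x" using x K by (simp add: field_simps)
    moreover have "0 \<le> g * x" using g b x by simp
    moreover have "1 + (g * x)\<^sup>2 * cosh (g * x) / (2 * d) \<le> exp (x\<^sup>2 * m)"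
    proof -
      have "(g * x)\<^sup>2 * cosh (g * x) / (2 * d) = x\<^sup>2 * (g\<^sup>2 * cosh (g * x) / (2 * d))"
        by (simp add: power_mult_distrib)
      also have "\<dots> \<le> x\<^sup>2 * m" using elim by (intro mult_left_mono) auto
      finally show ?thesis using exp_ge_add_one_self[of "x\<^sup>2 * m"] by linarith
    qed
    moreover have "0 < s * x" using s x by simp
    moreover have "2 * d \<le> (s * x)\<^sup>2 * real t"
    proof -
      have "2 * d = (s * x)\<^sup>2 * (A / x\<^sup>2)"
        using s x by (simp add: A_def field_simps)
      also have "\<dots> \<le> (s * x)\<^sup>2 * real t" using t1 by (intro mult_left_mono) auto
      finally show ?thesis .
    qed
    moreover have "0 < E / 2" using E by simp
    ultimately show ?case using main by blast
  qed
qed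

lemma mean_holding_time_measurable:
  assumes "sets \<nu> = sets holding_laws"
  shows "mean_holding_time \<in> borel_measurable \<nu>"
  unfolding measurable_cong_sets[OF assms refl] holding_laws_def prob_algebra_def mean_holding_time_def[abs_def]
  by (rule measurable_restrict_space1, rule nn_integral_measurable_subprob_algebra, rule measurable_restrict_space1) simp

text \<open>The argument \<open>dim\<close> fixes the index type of the lattice, which does not
  occur in the type of \<open>\<nu>\<close>.\<close>

locale holding_field =
  fixes \<nu> :: "real measure measure" and dim :: "'d::finite itself"
  assumes \<nu>: "prob_space \<nu>" and sets_\<nu>: "sets \<nu> = sets holding_laws"
    and finite_mean: "(\<integral>\<^sup>+s. mean_holding_time s \<partial>\<nu>) < \<infinity>"
begin

abbreviation field_law :: "(int ^ 'd \<Rightarrow> real measure) measure" where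
  "field_law \<equiv> iid_law \<nu>"

definition total_mean :: real where
  "total_mean = enn2real (\<integral>\<^sup>+s. mean_holding_time s \<partial>\<nu>)"

definition trunc_mean :: "real \<Rightarrow> real measure \<Rightarrow> real" where
  "trunc_mean k s = (\<integral>t. min t k \<partial>s)"

lemma space_\<nu>: "space \<nu> = space holding_laws"
  using sets_eq_imp_space_eq[OF sets_\<nu>] .

lemma field_holding_env: "\<sigma> \<in> space field_law \<Longrightarrow> holding_env \<sigma>"
  by (simp add: holding_env_def iid_law_def space_PiM space_\<nu>)

sublocale \<nu>: prob_space \<nu> by (rule \<nu>)

sublocale F: product_prob_space "\<lambda>_. \<nu>" "UNIV :: (int ^ 'd) set"
  by (intro product_prob_spaceI) (rule \<nu>)

sublocale P: prob_space field_law
  unfolding iid_law_def by (rule prob_space_PiM) (rule \<nu>)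

lemma measurable_coordinate: "(\<lambda>\<sigma>. \<sigma> z) \<in> measurable field_law \<nu>"
  unfolding iid_law_def by (rule measurable_component_singleton) simp

lemma distr_coordinate: "distr field_law \<nu> (\<lambda>\<sigma>. \<sigma> z) = \<nu>"
  unfolding iid_law_def by (rule F.PiM_component) simp

lemma measurable_nn_integral_\<nu>:
  assumes "f \<in> borel_measurable borel"
  shows "(\<lambda>s. \<integral>\<^sup>+t. f t \<partial>s) \<in> borel_measurable \<nu>"
  unfolding measurable_cong_sets[OF sets_\<nu> refl] holding_laws_def prob_algebra_def
  by (intro measurable_restrict_space1 nn_integral_measurable_subprob_algebra assms)

lemma measurable_integral_\<nu>:
  fixes f :: "real \<Rightarrow> real"
  assumes "f \<in> borel_measurable borel"
  shows "(\<lambda>s. \<integral>t. f t \<partial>s) \<in> borel_measurable \<nu>"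
  unfolding measurable_cong_sets[OF sets_\<nu> refl] holding_laws_def prob_algebra_def
  by (intro measurable_restrict_space1 integral_measurable_subprob_algebra assms)

lemma indep_coordinates: "P.indep_vars (\<lambda>_. \<nu>) (\<lambda>z \<sigma>. \<sigma> z) UNIV"
proof (subst P.indep_vars_iff_distr_eq_PiM)
  have "(\<lambda>\<sigma>. \<lambda>z\<in>UNIV. \<sigma> z) = (\<lambda>\<sigma> :: int ^ 'd \<Rightarrow> real measure. \<sigma>)"
    by (rule ext) (simp add: restrict_def)
  then show "distr field_law (PiM UNIV (\<lambda>_. \<nu>)) (\<lambda>\<sigma>. \<lambda>z\<in>UNIV. \<sigma> z) = PiM UNIV (\<lambda>z. distr field_law \<nu> (\<lambda>\<sigma>. \<sigma> z))"
    by (simp add: distr_coordinate) (simp add: iid_law_def distr_id)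
qed (simp_all add: measurable_coordinate)

lemma trunc_mean:
  assumes s: "s \<in> space holding_laws" and k: "0 \<le> k"
  shows "integrable s (\<lambda>t. min t k)" "0 \<le> trunc_mean k s" "trunc_mean k s \<le> k"
    "(\<integral>\<^sup>+t. ennreal (min t k) \<partial>s) = ennreal (trunc_mean k s)"
proof -
  interpret prob_space s by (rule holding_lawsD(1)[OF s])
  have m: "(\<lambda>t. min t k) \<in> borel_measurable s"
    by (rule holding_laws_measurable_borel[OF s]) simp
  have b: "0 \<le> min t k \<and> min t k \<le> k" if "t \<in> space s" for t
    using that k holding_lawsD(3)[OF s] by auto
  show i: "integrable s (\<lambda>t. min t k)"
    by (rule integrable_const_bound[where B=k]) (use b m in \<open>auto intro!: AE_I2\<close>)
  show "0 \<le> trunc_mean k s"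
    unfolding trunc_mean_def using b by (intro Bochner_Integration.integral_nonneg) auto
  have "trunc_mean k s \<le> (\<integral>t. k \<partial>s)"
    unfolding trunc_mean_def using b by (intro integral_mono[OF i]) auto
  then show "trunc_mean k s \<le> k" by (simp add: prob_space)
  show "(\<integral>\<^sup>+t. ennreal (min t k) \<partial>s) = ennreal (trunc_mean k s)"
    unfolding trunc_mean_def using b by (intro nn_integral_eq_integral[OF i] AE_I2) auto
qed

text \<open>Capping the holding time at \<open>k\<close> keeps \<open>u = \<theta> * min t k\<close>
  below \<open>\<delta>\<close>. There
  \<open>exp (- u) \<le> 1 - u + u * u \<le> 1 - (1 - \<delta>) * u\<close> is linear and can be
  integrated; the factor \<open>1 - \<delta>\<close> is the only loss besides the
  truncation.\<close>

lemma holding_laplace_le_trunc: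
  assumes s: "s \<in> space holding_laws" and k: "0 \<le> k" and \<theta>: "0 \<le> \<theta>" "\<theta> * k \<le> \<delta>"
  shows "holding_laplace \<theta> s \<le> exp (- ((1 - \<delta>) * \<theta> * trunc_mean k s))"
proof -
  interpret prob_space s by (rule holding_lawsD(1)[OF s])
  have "exp (- \<theta> * t) \<le> 1 - (1 - \<delta>) * \<theta> * min t k" if t: "t \<in> space s" for t
  proof -
    let ?u = "\<theta> * min t k"
    have t0: "0 < t" using t holding_lawsD(3)[OF s] by simp
    have u: "0 \<le> ?u" using t0 k \<theta> by simp
    have "?u \<le> \<theta> * k" using \<theta> by (intro mult_left_mono) auto
    then have ud: "?u \<le> \<delta>" using \<theta> by linarith
    have "exp (- \<theta> * t) \<le> exp (- ?u)" using \<theta> by (simp add: mult_left_mono)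
    also have "\<dots> = 1 / exp ?u" by (simp add: exp_minus field_simps)
    also have "\<dots> \<le> 1 / (1 + ?u)"
      using u exp_ge_add_one_self[of ?u] by (intro divide_left_mono) auto
    also have "\<dots> \<le> 1 - ?u + ?u * ?u"
    proof -
      have "1 \<le> (1 - w + w * w) * (1 + w)" if "0 \<le> w" for w :: real
      proof -
        have "(1 - w + w * w) * (1 + w) = 1 + w * w * w" by (simp add: algebra_simps)
        then show ?thesis using that by simp
      qed
      from this[OF u] show ?thesis using u by (simp add: pos_divide_le_eq)
    qed
    also have "\<dots> \<le> 1 - ?u + \<delta> * ?u"
      using u ud by (intro add_left_mono mult_right_mono) auto
    finally show ?thesis by (simp add: algebra_simps)
  qed
  then have "holding_laplace \<theta> s \<le> (\<integral>t. 1 - (1 - \<delta>) * \<theta> * min t k \<partial>s)"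
    unfolding holding_laplace_def
    by (intro integral_mono holding_laplace(2)[OF s \<theta>(1)] Bochner_Integration.integrable_diff) (use trunc_mean(1)[OF s k] in auto)
  also have "\<dots> = 1 - (1 - \<delta>) * \<theta> * trunc_mean k s"
    using trunc_mean(1)[OF s k] by (simp add: trunc_mean_def prob_space)
  also have "\<dots> \<le> exp (- ((1 - \<delta>) * \<theta> * trunc_mean k s))"
    using exp_ge_add_one_self[of "- ((1 - \<delta>) * \<theta> * trunc_mean k s)"] by simp
  finally show ?thesis .
qed

lemma trunc_mean_measurable: "trunc_mean k \<in> borel_measurable \<nu>"
  unfolding trunc_mean_def[abs_def] by (rule measurable_integral_\<nu>) simp

lemma iid_trunc:
  assumes k: "0 \<le> k"
  shows "iid_field field_law (\<lambda>z \<sigma>. trunc_mean k (\<sigma> z)) k (\<integral>s. trunc_mean k s \<partial>\<nu>)"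
proof
  show "P.indep_vars (\<lambda>_. borel) (\<lambda>z \<sigma>. trunc_mean k (\<sigma> z)) UNIV"
    by (rule P.indep_vars_compose2[OF indep_coordinates trunc_mean_measurable])
  show "0 \<le> trunc_mean k (\<sigma> v) \<and> trunc_mean k (\<sigma> v) \<le> k" if "\<sigma> \<in> space field_law" for \<sigma> v
    using trunc_mean[OF holding_envD[OF field_holding_env[OF that]] k] by simp
  show "P.expectation (\<lambda>\<sigma>. trunc_mean k (\<sigma> v)) = (\<integral>s. trunc_mean k s \<partial>\<nu>)" for v
    using integral_distr[OF measurable_coordinate trunc_mean_measurable, of v k] by (simp add: distr_coordinate)
qed

lemma trunc_mean_tendsto: "(\<lambda>k. \<integral>s. trunc_mean (real k) s \<partial>\<nu>) \<longlonglongrightarrow> total_mean"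
proof -
  have inner: "(\<lambda>k. \<integral>\<^sup>+t. ennreal (min t (real k)) \<partial>s) \<longlonglongrightarrow> mean_holding_time s" if "s \<in> space holding_laws" for s
    unfolding mean_holding_time_def
  proof (rule nn_integral_LIMSEQ)
    show "incseq (\<lambda>k t. ennreal (min t (real k)))"
      by (auto simp: incseq_def le_fun_def intro!: ennreal_leI)
    show "(\<lambda>t. ennreal (min t (real k))) \<in> borel_measurable s" for k
      by (rule holding_laws_measurable_borel[OF that]) simp
    show "(\<lambda>k. ennreal (min t (real k))) \<longlonglongrightarrow> ennreal t" for t
    proof (rule tendsto_eventually)
      obtain n where "t \<le> real n" using real_arch_simple by blast
      then show "\<forall>\<^sub>F k in sequentially. ennreal (min t (real k)) = ennreal t"
        by (intro eventually_sequentiallyI[of n]) (auto simp: min_def)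
    qed
  qed
  \<comment> \<open>The limit is written as a supremum because monotone convergence asks for it at
    every \<open>s\<close>, while \<open>inner\<close> identifies it only for holding laws.\<close>
  have "(\<lambda>k. \<integral>\<^sup>+s. (\<integral>\<^sup>+t. ennreal (min t (real k)) \<partial>s) \<partial>\<nu>) \<longlonglongrightarrow> (\<integral>\<^sup>+s. (SUP k. \<integral>\<^sup>+t. ennreal (min t (real k)) \<partial>s) \<partial>\<nu>)"
  proof (rule nn_integral_LIMSEQ)
    show inc: "incseq (\<lambda>k s. \<integral>\<^sup>+t. ennreal (min t (real k)) \<partial>s)"
      by (auto simp: incseq_def le_fun_def intro!: nn_integral_mono ennreal_leI)
    show "(\<lambda>s. \<integral>\<^sup>+t. ennreal (min t (real k)) \<partial>s) \<in> borel_measurable \<nu>" for k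
      by (rule measurable_nn_integral_\<nu>) simp
    show "(\<lambda>k. \<integral>\<^sup>+t. ennreal (min t (real k)) \<partial>s) \<longlonglongrightarrow> (SUP k. \<integral>\<^sup>+t. ennreal (min t (real k)) \<partial>s)" for s
      using inc by (intro LIMSEQ_SUP) (auto simp: incseq_def le_fun_def)
  qed
  also have "(\<integral>\<^sup>+s. (SUP k. \<integral>\<^sup>+t. ennreal (min t (real k)) \<partial>s) \<partial>\<nu>) = (\<integral>\<^sup>+s. mean_holding_time s \<partial>\<nu>)"
  proof (rule nn_integral_cong)
    fix s assume "s \<in> space \<nu>"
    then have s: "s \<in> space holding_laws" by (simp add: space_\<nu>)
    have "(\<lambda>k. \<integral>\<^sup>+t. ennreal (min t (real k)) \<partial>s) \<longlonglongrightarrow> (SUP k. \<integral>\<^sup>+t. ennreal (min t (real k)) \<partial>s)"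
      by (intro LIMSEQ_SUP) (auto simp: incseq_def intro!: nn_integral_mono ennreal_leI)
    then show "(SUP k. \<integral>\<^sup>+t. ennreal (min t (real k)) \<partial>s) = mean_holding_time s"
      using inner[OF s] by (rule LIMSEQ_unique)
  qed
  finally have "(\<lambda>k. \<integral>\<^sup>+s. (\<integral>\<^sup>+t. ennreal (min t (real k)) \<partial>s) \<partial>\<nu>) \<longlonglongrightarrow> ennreal total_mean"
    unfolding total_mean_def using finite_mean by (subst ennreal_enn2real) simp_all
  moreover have "(\<integral>\<^sup>+s. (\<integral>\<^sup>+t. ennreal (min t (real k)) \<partial>s) \<partial>\<nu>) = ennreal (\<integral>s. trunc_mean (real k) s \<partial>\<nu>)" for k
  proof -
    have "(\<integral>\<^sup>+s. (\<integral>\<^sup>+t. ennreal (min t (real k)) \<partial>s) \<partial>\<nu>) = (\<integral>\<^sup>+s. ennreal (trunc_mean (real k) s) \<partial>\<nu>)"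
      by (rule nn_integral_cong) (simp add: trunc_mean(4) space_\<nu>)
    also have "\<dots> = ennreal (\<integral>s. trunc_mean (real k) s \<partial>\<nu>)"
    proof (rule nn_integral_eq_integral)
      show "integrable \<nu> (trunc_mean (real k))"
        by (rule \<nu>.integrable_const_bound[where B = "real k"])
          (use trunc_mean(2,3) trunc_mean_measurable in \<open>auto intro!: AE_I2 simp: space_\<nu>\<close>)
      show "AE s in \<nu>. 0 \<le> trunc_mean (real k) s"
        by (rule AE_I2) (simp add: trunc_mean(2) space_\<nu>)
    qed
    finally show ?thesis .
  qed
  moreover have "0 \<le> (\<integral>s. trunc_mean (real k) s \<partial>\<nu>)" for k
    by (rule Bochner_Integration.integral_nonneg) (simp add: trunc_mean(2) space_\<nu>)
  ultimately show ?thesis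
    by (simp add: total_mean_def tendsto_ennreal_iff)
qed

text \<open>Holding laws live on the open half-line, so no mean holding time vanishes. Positivity is
  needed to divide by the mean when the duration of the bridge is chosen.\<close>

lemma total_mean_pos: "0 < total_mean"
proof -
  have m: "mean_holding_time \<in> borel_measurable \<nu>"
    by (rule mean_holding_time_measurable[OF sets_\<nu>])
  have pos: "mean_holding_time s \<noteq> 0" if s: "s \<in> space holding_laws" for s
  proof
    interpret s: prob_space s by (rule holding_lawsD(1)[OF s])
    assume "mean_holding_time s = 0"
    then have "AE t in s. ennreal t = 0"
      unfolding mean_holding_time_def
      by (subst (asm) nn_integral_0_iff_AE) (auto intro: holding_laws_measurable_borel[OF s])
    moreover have "AE t in s. 0 < t"
      using holding_lawsD(3)[OF s] by (intro AE_I2) auto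
    ultimately have "AE t in s. False"
      by eventually_elim (simp add: ennreal_eq_0_iff)
    then show False by simp
  qed
  have "(\<integral>\<^sup>+s. mean_holding_time s \<partial>\<nu>) \<noteq> 0"
  proof
    assume "(\<integral>\<^sup>+s. mean_holding_time s \<partial>\<nu>) = 0"
    then have "AE s in \<nu>. mean_holding_time s = 0"
      by (simp add: nn_integral_0_iff_AE[OF m])
    moreover have "AE s in \<nu>. s \<in> space holding_laws"
      using AE_space[of \<nu>] by (simp add: space_\<nu>)
    ultimately have "AE s in \<nu>. False"
      by eventually_elim (use pos in blast)
    then show False by simp
  qed
  then show ?thesis
    using finite_mean by (simp add: total_mean_def enn2real_positive_iff less_top[symmetric] zero_less_iff_neq_zero)
qed

end

subsection \<open>Quenched lower bound\<close>

context holding_field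
begin

text \<open>The Lyapunov limit with the step environment frozen, almost sure in the holding laws
  only.\<close>

definition cost_limit :: "real \<Rightarrow> (int ^ 'd \<Rightarrow> (int ^ 'd) measure) \<Rightarrow> int ^ 'd \<Rightarrow> real \<Rightarrow> bool" where
  "cost_limit \<theta> \<omega> v a \<longleftrightarrow>
     (AE \<sigma> in field_law. (\<lambda>n. hitting_cost \<theta> 0 (int n *s v) \<omega> \<sigma> / ereal (real n)) \<longlonglongrightarrow> ereal a)"

lemma holding_laplace_measurable: "(\<lambda>\<sigma>. holding_laplace \<theta> (\<sigma> z)) \<in> borel_measurable field_law"
proof -
  have "holding_laplace \<theta> \<in> borel_measurable \<nu>"
    unfolding holding_laplace_def[abs_def] by (rule measurable_integral_\<nu>) simp
  with measurable_coordinate show ?thesis by (rule measurable_compose)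
qed

lemma hit_weight_measurable:
  "(\<lambda>\<sigma>. hit_weight n (\<lambda>z. holding_laplace \<theta> (\<sigma> z)) y v) \<in> borel_measurable field_law"
proof (induction n arbitrary: v)
  case (Suc n)
  have "(\<lambda>\<sigma>. holding_laplace \<theta> (\<sigma> v) * step_avg (hit_weight n (\<lambda>z. holding_laplace \<theta> (\<sigma> z)) y) v) \<in> borel_measurable field_law"
    unfolding step_avg_def
    by (intro borel_measurable_times holding_laplace_measurable borel_measurable_divide borel_measurable_sum Suc.IH borel_measurable_const)
  then show ?case by (cases "v = y") simp_all
qed simp

lemma holding_laplace_bounds:
  assumes "\<sigma> \<in> space field_law" "0 \<le> \<theta>"
  shows "0 \<le> holding_laplace \<theta> (\<sigma> z)" "holding_laplace \<theta> (\<sigma> z) \<le> 1"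
  using holding_laplace(3,4)[OF holding_envD[OF field_holding_env[OF assms(1)]] assms(2), of z] by simp_all

lemma hitting_laplace_field:
  assumes "uniform_env \<omega>" "0 \<le> \<theta>"
  shows "(\<lambda>\<sigma>. hitting_laplace \<theta> x y \<omega> \<sigma>) \<in> borel_measurable field_law"
    and "\<sigma> \<in> space field_law \<Longrightarrow> hit_weight n (\<lambda>z. holding_laplace \<theta> (\<sigma> z)) y x \<le> hitting_laplace \<theta> x y \<omega> \<sigma>"
    and "\<sigma> \<in> space field_law \<Longrightarrow> 0 \<le> hitting_laplace \<theta> x y \<omega> \<sigma>"
    and "\<sigma> \<in> space field_law \<Longrightarrow> hitting_laplace \<theta> x y \<omega> \<sigma> \<le> 1"
proof -
  have lim: "(\<lambda>n. hit_weight n (\<lambda>z. holding_laplace \<theta> (\<sigma> z)) y x) \<longlonglongrightarrow> hitting_laplace \<theta> x y \<omega> \<sigma>"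
    if "\<sigma> \<in> space field_law" for \<sigma>
    by (rule hitting_laplace_LIMSEQ[OF assms(1) field_holding_env[OF that] assms(2)])
  show "(\<lambda>\<sigma>. hitting_laplace \<theta> x y \<omega> \<sigma>) \<in> borel_measurable field_law"
    by (rule borel_measurable_LIMSEQ_real[OF lim hit_weight_measurable])
  assume \<sigma>: "\<sigma> \<in> space field_law"
  note b = holding_laplace_bounds[OF \<sigma> assms(2)]
  have inc: "incseq (\<lambda>n. hit_weight n (\<lambda>z. holding_laplace \<theta> (\<sigma> z)) y x)"
    by (intro incseq_SucI hit_weight_Suc_ge b)
  show le: "hit_weight n (\<lambda>z. holding_laplace \<theta> (\<sigma> z)) y x \<le> hitting_laplace \<theta> x y \<omega> \<sigma>" for n
    by (rule incseq_le[OF inc lim[OF \<sigma>]])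
  have "0 \<le> hit_weight 0 (\<lambda>z. holding_laplace \<theta> (\<sigma> z)) y x" by simp
  then show "0 \<le> hitting_laplace \<theta> x y \<omega> \<sigma>" using le[of 0] by linarith
  show "hitting_laplace \<theta> x y \<omega> \<sigma> \<le> 1"
    by (rule LIMSEQ_le_const2[OF lim[OF \<sigma>]]) (use hit_weight_bounds[where \<phi> = "\<lambda>z. holding_laplace \<theta> (\<sigma> z)", OF b] in blast)
qed

lemma hitting_laplace_integrable:
  assumes "uniform_env \<omega>" "0 \<le> \<theta>"
  shows "integrable field_law (\<lambda>\<sigma>. hitting_laplace \<theta> x y \<omega> \<sigma>)"
  using hitting_laplace_field[OF assms]
  by (intro P.integrable_const_bound[where B = 1] AE_I2) auto

text \<open>Truncation dominates the one-site transforms by \<open>survival\<close>, so the renewal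
  bound applies at each horizon \<open>n\<close>. It is uniform in \<open>n\<close> and survives the
  limit to the full hitting transform.\<close>

lemma expectation_hitting_laplace_le:
  fixes r :: "real ^ 'd"
  assumes \<omega>: "uniform_env \<omega>" and \<theta>: "0 \<le> \<theta>" "\<theta> * k \<le> \<delta>" "\<delta> \<le> 1" and k: "0 \<le> k"
    and r: "norm r = 1" and R: "1 \<le> R" and g: "0 \<le> g" "1 + g\<^sup>2 * cosh g / (2 * real CARD('d)) \<le> exp ((1 - \<delta>) * \<theta> * (\<integral>s. trunc_mean k s \<partial>\<nu>))"
    and h: "0 < h" "2 * real CARD('d) \<le> h\<^sup>2 * real t" and \<epsilon>: "0 < \<epsilon>"
    and \<rho>: "1 / cosh (g * (R - 1)) + 2 * h * (R + 1) + \<epsilon> / 2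
      + real t * (((1 - \<delta>) * \<theta> * k)\<^sup>2 * (1 + 4 * real CARD('d) * sqrt (real t))) / (2 * \<epsilon>) \<le> \<rho>"
    and y: "real i * (R + 1) \<le> level r y"
  shows "P.expectation (\<lambda>\<sigma>. hitting_laplace \<theta> 0 y \<omega> \<sigma>) \<le> \<rho> ^ i"
proof -
  interpret iid_field field_law "\<lambda>z \<sigma>. trunc_mean k (\<sigma> z)" k "\<integral>s. trunc_mean k s \<partial>\<nu>"
    by (rule iid_trunc[OF k])
  let ?c = "(1 - \<delta>) * \<theta>"
  have c: "0 \<le> ?c" using \<theta> by simp
  have cr: "P.expectation (\<lambda>\<sigma>. crossing 0 r (level r z) R (survival ?c \<sigma>) n z) \<le> \<rho>" for n z
    using expectation_crossing_le[OF r R c g h \<epsilon>] \<rho> by (rule order_trans)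
  have "0 \<le> P.expectation (\<lambda>\<sigma>. crossing 0 r (level r 0) R (survival ?c \<sigma>) 0 0)"
    by (rule Bochner_Integration.integral_nonneg) simp
  then have \<rho>0: "0 \<le> \<rho>" using cr[of 0 0] by linarith
  have bound: "P.expectation (\<lambda>\<sigma>. hit_weight n (\<lambda>z. holding_laplace \<theta> (\<sigma> z)) y 0) \<le> \<rho> ^ i" for n
  proof -
    have b: "0 \<le> hit_weight n (\<lambda>z. holding_laplace \<theta> (\<sigma> z)) y 0 \<and> hit_weight n (\<lambda>z. holding_laplace \<theta> (\<sigma> z)) y 0 \<le> 1"
      if "\<sigma> \<in> space field_law" for \<sigma>
      by (intro hit_weight_bounds holding_laplace_bounds that \<theta>)
    have "P.expectation (\<lambda>\<sigma>. hit_weight n (\<lambda>z. holding_laplace \<theta> (\<sigma> z)) y 0)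
      \<le> P.expectation (\<lambda>\<sigma>. hit_weight n (survival ?c \<sigma>) y 0)"
    proof (rule integral_mono)
      show "integrable field_law (\<lambda>\<sigma>. hit_weight n (\<lambda>z. holding_laplace \<theta> (\<sigma> z)) y 0)"
        using b by (intro P.integrable_const_bound[where B = 1] AE_I2 hit_weight_measurable) auto
      show "integrable field_law (\<lambda>\<sigma>. hit_weight n (survival ?c \<sigma>) y 0)"
        by (rule local_rv_integrable[OF local_rv_hit_weight_survival[OF c]])
    next
      fix \<sigma> :: "int ^ 'd \<Rightarrow> real measure" assume \<sigma>: "\<sigma> \<in> space field_law"
      show "hit_weight n (\<lambda>z. holding_laplace \<theta> (\<sigma> z)) y 0 \<le> hit_weight n (survival ?c \<sigma>) y 0"
      proof (intro hit_weight_mono holding_laplace_bounds \<sigma> \<theta> survival_bounds c)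
        show "holding_laplace \<theta> (\<sigma> v) \<le> survival ?c \<sigma> v" for v
          unfolding survival_def
          by (rule holding_laplace_le_trunc[OF holding_envD[OF field_holding_env[OF \<sigma>]] k \<theta>(1,2)])
      qed
    qed
    also have "\<dots> \<le> \<rho> ^ i"
      using R y by (intro expectation_hit_weight_le[OF r _ c \<rho>0 cr]) (simp_all add: level_def lattice_to_real_def zero_vec_def[symmetric] vec_eq_iff inner_vec_def)
    finally show ?thesis .
  qed
  have "(\<lambda>n. P.expectation (\<lambda>\<sigma>. hit_weight n (\<lambda>z. holding_laplace \<theta> (\<sigma> z)) y 0)) \<longlonglongrightarrow> P.expectation (\<lambda>\<sigma>. hitting_laplace \<theta> 0 y \<omega> \<sigma>)"
  proof (rule integral_dominated_convergence[where w = "\<lambda>_. 1"])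
    show "AE \<sigma> in field_law. (\<lambda>n. hit_weight n (\<lambda>z. holding_laplace \<theta> (\<sigma> z)) y 0) \<longlonglongrightarrow> hitting_laplace \<theta> 0 y \<omega> \<sigma>"
      by (intro AE_I2 hitting_laplace_LIMSEQ \<omega> \<theta> field_holding_env)
    show "AE \<sigma> in field_law. norm (hit_weight n (\<lambda>z. holding_laplace \<theta> (\<sigma> z)) y 0) \<le> 1" for n
    proof (rule AE_I2)
      fix \<sigma> :: "int ^ 'd \<Rightarrow> real measure" assume \<sigma>: "\<sigma> \<in> space field_law"
      show "norm (hit_weight n (\<lambda>z. holding_laplace \<theta> (\<sigma> z)) y 0) \<le> 1"
        using hit_weight_bounds[where \<phi> = "\<lambda>z. holding_laplace \<theta> (\<sigma> z)", OF holding_laplace_bounds[OF \<sigma> \<theta>(1)], of n y 0] by simp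
    qed
  qed (simp_all add: hit_weight_measurable hitting_laplace_field[OF \<omega> \<theta>(1)])
  then show ?thesis
    by (rule LIMSEQ_le_const2) (use bound in blast)
qed

text \<open>If \<open>a < \<gamma> < \<kappa>\<close>, then \<open>exp (\<gamma> * n)\<close> times
  the transform is almost surely at least 1 for large \<open>n\<close>, whereas its mean tends to 0,
  contradicting Fatou's lemma.\<close>

lemma cost_lower_bound:
  assumes \<omega>: "uniform_env \<omega>" and \<theta>: "0 \<le> \<theta>" and lim: "cost_limit \<theta> \<omega> v a"
    and bound: "\<And>n. P.expectation (\<lambda>\<sigma>. hitting_laplace \<theta> 0 (int n *s v) \<omega> \<sigma>) \<le> D * exp (- (\<kappa> * real n))"
  shows "\<kappa> \<le> a"
proof (rule ccontr)
  assume "\<not> \<kappa> \<le> a"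
  then obtain \<gamma> where \<gamma>: "a < \<gamma>" "\<gamma> < \<kappa>" using dense[of a \<kappa>] by auto
  let ?L = "\<lambda>n \<sigma>. hitting_laplace \<theta> 0 (int n *s v) \<omega> \<sigma>"
  let ?u = "\<lambda>n \<sigma>. ennreal (exp (\<gamma> * real n) * ?L n \<sigma>)"
  have um: "?u n \<in> borel_measurable field_law" for n
    using hitting_laplace_field(1)[OF \<omega> \<theta>] by measurable
  have "AE \<sigma> in field_law. 1 \<le> liminf (\<lambda>n. ?u n \<sigma>)"
    using lim[unfolded cost_limit_def] AE_space
  proof eventually_elim
    case (elim \<sigma>)
    have "\<forall>\<^sub>F n in sequentially. hitting_cost \<theta> 0 (int n *s v) \<omega> \<sigma> / ereal (real n) < ereal \<gamma>"
      by (rule order_tendstoD(2)[OF elim(1)]) (use \<gamma> in simp)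
    then have "\<forall>\<^sub>F n in sequentially. 1 \<le> ?u n \<sigma>"
      using eventually_gt_at_top[of 0]
    proof eventually_elim
      case (elim n)
      have ne: "?L n \<sigma> \<noteq> 0"
      proof
        assume "?L n \<sigma> = 0"
        then show False using elim by (simp add: hitting_cost_def)
      qed
      then have L0: "0 < ?L n \<sigma>"
        using hitting_laplace_field(3)[OF \<omega> \<theta> \<open>\<sigma> \<in> space field_law\<close>, of 0 "int n *s v"] by linarith
      have "- ln (?L n \<sigma>) / real n < \<gamma>"
        using elim ne by (simp add: hitting_cost_def)
      moreover have "0 < real n" using elim by simp
      ultimately have "- ln (?L n \<sigma>) < \<gamma> * real n"
        by (simp only: pos_divide_less_eq)
      then have "exp (- (\<gamma> * real n)) \<le> ?L n \<sigma>"
        using L0 by (simp add: ln_ge_iff[symmetric])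
      then have "exp (\<gamma> * real n) * exp (- (\<gamma> * real n)) \<le> exp (\<gamma> * real n) * ?L n \<sigma>"
        by (intro mult_left_mono) auto
      then have "1 \<le> exp (\<gamma> * real n) * ?L n \<sigma>" by (simp flip: exp_add)
      then show ?case by (metis ennreal_1 ennreal_leI)
    qed
    then show ?case by (rule Liminf_bounded)
  qed
  then have "(\<integral>\<^sup>+\<sigma>. 1 \<partial>field_law) \<le> (\<integral>\<^sup>+\<sigma>. liminf (\<lambda>n. ?u n \<sigma>) \<partial>field_law)"
    by (rule nn_integral_mono_AE)
  also have "\<dots> \<le> liminf (\<lambda>n. \<integral>\<^sup>+\<sigma>. ?u n \<sigma> \<partial>field_law)"
    by (rule nn_integral_liminf[OF um])
  also have "\<dots> \<le> liminf (\<lambda>n. ennreal (D * exp ((\<gamma> - \<kappa>) * real n)))"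
  proof (intro Liminf_mono always_eventually allI)
    fix n
    have "(\<integral>\<^sup>+\<sigma>. ?u n \<sigma> \<partial>field_law) = ennreal (\<integral>\<sigma>. exp (\<gamma> * real n) * ?L n \<sigma> \<partial>field_law)"
      using hitting_laplace_integrable[OF \<omega> \<theta>] hitting_laplace_field(3)[OF \<omega> \<theta>]
      by (intro nn_integral_eq_integral AE_I2) auto
    also have "(\<integral>\<sigma>. exp (\<gamma> * real n) * ?L n \<sigma> \<partial>field_law) = exp (\<gamma> * real n) * P.expectation (?L n)"
      by simp
    also have "\<dots> \<le> exp (\<gamma> * real n) * (D * exp (- (\<kappa> * real n)))"
      by (intro mult_left_mono bound) auto
    also have "\<dots> = D * exp ((\<gamma> - \<kappa>) * real n)"
      by (simp add: left_diff_distrib exp_diff exp_minus field_simps)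
    finally show "(\<integral>\<^sup>+\<sigma>. ?u n \<sigma> \<partial>field_law) \<le> ennreal (D * exp ((\<gamma> - \<kappa>) * real n))"
      by (simp add: ennreal_leI)
  qed
  also have "\<dots> = 0"
  proof -
    have "filterlim (\<lambda>n. (\<gamma> - \<kappa>) * real n) at_bot sequentially"
      using \<gamma> by (intro filterlim_tendsto_neg_mult_at_bot[OF tendsto_const] filterlim_real_sequentially) auto
    then have "(\<lambda>n. D * exp ((\<gamma> - \<kappa>) * real n)) \<longlonglongrightarrow> D * 0"
      by (intro tendsto_mult tendsto_const filterlim_compose[OF exp_at_bot])
    then have "(\<lambda>n. ennreal (D * exp ((\<gamma> - \<kappa>) * real n))) \<longlonglongrightarrow> ennreal 0"
      by (intro tendsto_ennrealI) simp
    then show ?thesis by (auto dest: lim_imp_Liminf[rotated])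
  qed
  finally show False by (simp add: P.emeasure_space_1)
qed

text \<open>The strict inequality on \<open>\<beta>\<close> leaves room to fix first
  \<open>\<delta>\<close>, then the truncation level \<open>k\<close>. The range of
  \<open>\<theta>\<close> is chosen before \<open>\<omega>\<close>, \<open>v\<close> and
  \<open>a\<close>, because the rate function is later evaluated at a \<open>\<theta>\<close> that
  depends on the speed.\<close>

lemma quenched_lower:
  assumes \<beta>: "0 < \<beta>" "\<beta>\<^sup>2 < 2 * real CARD('d) * total_mean"
  shows "\<forall>\<^sub>F \<theta> in at_right 0. \<forall>\<omega> v a. uniform_env \<omega> \<longrightarrow> cost_limit \<theta> \<omega> v a \<longrightarrow> 0 \<le> a
    \<longrightarrow> \<beta> * sqrt \<theta> * norm (lattice_to_real v) \<le> a"
proof -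
  let ?d = "real CARD('d)"
  have "((\<lambda>\<delta>. (1 - \<delta>) * (2 * ?d * total_mean)) \<longlongrightarrow> (1 - 0) * (2 * ?d * total_mean)) (at_right 0)"
    by (intro tendsto_intros)
  then have "\<forall>\<^sub>F \<delta> in at_right 0. \<beta>\<^sup>2 < (1 - \<delta>) * (2 * ?d * total_mean)"
    using \<beta> by (intro order_tendstoD(1)) auto
  moreover have "\<forall>\<^sub>F \<delta> in at_right (0::real). 0 < \<delta> \<and> \<delta> < 1"
    by (simp add: eventually_at_right_field) (rule exI[of _ 1], auto)
  ultimately have "\<forall>\<^sub>F \<delta> in at_right 0. \<beta>\<^sup>2 < (1 - \<delta>) * (2 * ?d * total_mean) \<and> 0 < \<delta> \<and> \<delta> < 1"
    by (rule eventually_conj)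
  then obtain \<delta> where \<delta>: "\<beta>\<^sup>2 < (1 - \<delta>) * (2 * ?d * total_mean)" "0 < \<delta>" "\<delta> < 1"
    using eventually_happens'[OF trivial_limit_at_right_real] by blast
  have "(\<lambda>k. (1 - \<delta>) * (2 * ?d * (\<integral>s. trunc_mean (real k) s \<partial>\<nu>))) \<longlonglongrightarrow> (1 - \<delta>) * (2 * ?d * total_mean)"
    by (intro tendsto_intros trunc_mean_tendsto)
  then have "\<forall>\<^sub>F k in sequentially. \<beta>\<^sup>2 < (1 - \<delta>) * (2 * ?d * (\<integral>s. trunc_mean (real k) s \<partial>\<nu>))"
    using \<delta>(1) by (rule order_tendstoD(1))
  then obtain k :: nat where k: "\<beta>\<^sup>2 < (1 - \<delta>) * (2 * ?d * (\<integral>s. trunc_mean (real k) s \<partial>\<nu>))"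
    using eventually_happens' by (auto simp: eventually_sequentially)
  define w where "w = (\<integral>s. trunc_mean (real k) s \<partial>\<nu>)"
  \<comment> \<open>With \<open>x = sqrt ((1 - \<delta>) * \<theta>)\<close> this gives
    \<open>b * x = \<beta> * sqrt \<theta>\<close>.\<close>
  define b where "b = \<beta> / sqrt (1 - \<delta>)"
  have b: "0 < b" "b\<^sup>2 < 2 * ?d * w"
    using \<beta> \<delta> k by (simp_all add: b_def w_def power_divide field_simps)
  have w: "0 < w"
  proof -
    have "0 < 2 * ?d * w" using b(2) zero_le_power2[of b] by linarith
    then show ?thesis by (simp add: zero_less_mult_iff)
  qed
  have "filterlim (\<lambda>\<theta>. sqrt ((1 - \<delta>) * \<theta>)) (at_right 0) (at_right 0)"
  proof (rule tendsto_imp_filterlim_at_right)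
    have "((\<lambda>\<theta>. sqrt ((1 - \<delta>) * \<theta>)) \<longlongrightarrow> sqrt ((1 - \<delta>) * 0)) (at_right 0)"
      by (intro tendsto_intros)
    then show "((\<lambda>\<theta>. sqrt ((1 - \<delta>) * \<theta>)) \<longlongrightarrow> 0) (at_right 0)" by simp
    show "\<forall>\<^sub>F \<theta> in at_right 0. 0 < sqrt ((1 - \<delta>) * \<theta>)"
      using \<delta> by (simp add: eventually_at_right_field) (rule exI[of _ 1], auto)
  qed
  note ev1 = eventually_compose_filterlim[OF crossing_parameters[of ?d w b "real k", OF _ w b] this]
  have ev2: "\<forall>\<^sub>F \<theta> in at_right 0. \<theta> * real k < \<delta>"
  proof -
    have "((\<lambda>\<theta>. \<theta> * real k) \<longlongrightarrow> 0 * real k) (at_right 0)" by (intro tendsto_intros)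
    then show ?thesis using \<delta> by (intro order_tendstoD(2)) auto
  qed
  have ev3: "\<forall>\<^sub>F \<theta> in at_right (0::real). 0 < \<theta>"
    by (simp add: eventually_at_right_less)
  show ?thesis
    using ev1[OF of_nat_0_less_iff[THEN iffD2, OF zero_less_card_finite]] ev2 ev3
  proof eventually_elim
    case (elim \<theta>)
    let ?x = "sqrt ((1 - \<delta>) * \<theta>)"
    have x2: "?x\<^sup>2 = (1 - \<delta>) * \<theta>" using elim \<delta> by simp
    from elim(1) obtain R g h \<epsilon> and t :: nat where R: "1 \<le> R" and g: "0 \<le> g" "1 + g\<^sup>2 * cosh g / (2 * ?d) \<le> exp (?x\<^sup>2 * w)"
      and h: "0 < h" "2 * ?d \<le> h\<^sup>2 * real t" and \<epsilon>: "0 < \<epsilon>"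
      and \<rho>: "1 / cosh (g * (R - 1)) + 2 * h * (R + 1) + \<epsilon> / 2 + real t * ((?x\<^sup>2 * real k)\<^sup>2 * (1 + 4 * ?d * sqrt (real t))) / (2 * \<epsilon>)
        \<le> exp (- (b * ?x * (R + 1)))"
      by blast
    have bx: "b * ?x = \<beta> * sqrt \<theta>"
      using \<delta> by (simp add: b_def real_sqrt_mult)
    show ?case
    proof (intro allI impI)
      fix \<omega> and v :: "int ^ 'd" and a
      assume \<omega>: "uniform_env \<omega>" and lim: "cost_limit \<theta> \<omega> v a" and a: "0 \<le> a"
      let ?n = "norm (lattice_to_real v)"
      show "\<beta> * sqrt \<theta> * ?n \<le> a"
      proof (cases "lattice_to_real v = 0")
        case True
        then show ?thesis using a by simp
      next
        case False
        define r where "r = (1 / ?n) *\<^sub>R lattice_to_real v"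
        have n: "0 < ?n" using False by simp
        have r: "norm r = 1" using n by (simp add: r_def)
        have lv: "level r v = ?n"
          using n by (simp add: level_def r_def dot_square_norm power2_eq_square)
        have bx0: "0 \<le> b * ?x" using b elim \<delta> by simp
        have bound: "P.expectation (\<lambda>\<sigma>. hitting_laplace \<theta> 0 (int n *s v) \<omega> \<sigma>)
          \<le> exp (b * ?x * (R + 1)) * exp (- (b * ?x * ?n * real n))" for n
        proof -
          \<comment> \<open>The number of complete slabs before the target. Rounding costs the
            constant factor \<open>exp (b * ?x * (R + 1))\<close>, which does not affect the
            exponential rate in \<open>n\<close>.\<close>
          define i where "i = nat \<lfloor>real n * ?n / (R + 1)\<rfloor>"
          have q0: "0 \<le> real n * ?n / (R + 1)" using R by simp
          have i1: "real i \<le> real n * ?n / (R + 1)" using q0 unfolding i_def by linarith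
          have i2: "real n * ?n / (R + 1) - 1 \<le> real i" unfolding i_def by linarith
          have "real i * (R + 1) \<le> level r (int n *s v)"
            using i1 R by (simp add: level_scale lv pos_le_divide_eq)
          then have "P.expectation (\<lambda>\<sigma>. hitting_laplace \<theta> 0 (int n *s v) \<omega> \<sigma>) \<le> exp (- (b * ?x * (R + 1))) ^ i"
            using elim \<delta> g h \<epsilon> \<rho> R unfolding x2 w_def
            by (intro expectation_hitting_laplace_le[OF \<omega> _ _ _ _ r]) auto
          also have "\<dots> = exp (- (b * ?x * ((R + 1) * real i)))"
            by (simp add: exp_of_nat_mult[symmetric] mult_ac)
          also have "\<dots> \<le> exp (- (b * ?x * (real n * ?n - (R + 1))))"
          proof -
            have "(R + 1) * (real n * ?n / (R + 1) - 1) \<le> (R + 1) * real i"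
              using i2 R by (intro mult_left_mono) auto
            then have "real n * ?n - (R + 1) \<le> (R + 1) * real i"
              using R by (simp add: right_diff_distrib)
            then show ?thesis
              using bx0 by (simp add: mult_left_mono)
          qed
          also have "\<dots> = exp (b * ?x * (R + 1)) * exp (- (b * ?x * ?n * real n))"
            by (simp add: algebra_simps flip: exp_add)
          finally show ?thesis .
        qed
        have "b * ?x * ?n \<le> a"
          by (rule cost_lower_bound[OF \<omega> _ lim bound]) (use elim in simp)
        then show ?thesis unfolding bx .
      qed
    qed
  qed
qed

end

subsection \<open>Quenched upper bound\<close>

lemma end_accum_nonneg:
  assumes "\<And>v. 0 \<le> V v"
  shows "0 \<le> end_accum n V y z"
  by (induction n arbitrary: z) (auto intro!: add_nonneg_nonneg mult_nonneg_nonneg step_avg_nonneg assms end_weight_nonneg)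

text \<open>Linearity alone: each of the \<open>n\<close> steps contributes the mean
  \<open>c\<close> whatever site it visits, so revisits and correlations are irrelevant.\<close>

lemma (in prob_space) expectation_end_accum:
  fixes V :: "'a \<Rightarrow> int ^ 'd \<Rightarrow> real"
  assumes V: "\<And>v. integrable M (\<lambda>\<omega>. V \<omega> v)" "\<And>v. expectation (\<lambda>\<omega>. V \<omega> v) = c"
  shows "integrable M (\<lambda>\<omega>. end_accum n (V \<omega>) y z) \<and>
    expectation (\<lambda>\<omega>. end_accum n (V \<omega>) y z) = real n * c * end_weight n (\<lambda>_. 1) y z"
proof (induction n arbitrary: z)
  case (Suc n)
  have i: "integrable M (\<lambda>\<omega>. end_accum n (V \<omega>) y u)" and e: "expectation (\<lambda>\<omega>. end_accum n (V \<omega>) y u) = real n * c * end_weight n (\<lambda>_. 1) y u" for u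
    using Suc.IH by auto
  let ?p = "step_avg (end_weight n (\<lambda>_. 1) y) z"
  have i2: "integrable M (\<lambda>\<omega>. step_avg (end_accum n (V \<omega>) y) z)"
    unfolding step_avg_def by (intro Bochner_Integration.integrable_divide Bochner_Integration.integrable_sum i)
  have "expectation (\<lambda>\<omega>. step_avg (end_accum n (V \<omega>) y) z) = step_avg (\<lambda>u. real n * c * end_weight n (\<lambda>_. 1) y u) z"
    unfolding step_avg_def using i by (simp add: Bochner_Integration.integral_sum e)
  also have "\<dots> = real n * c * ?p" by (rule step_avg_cmult)
  finally have e2: "expectation (\<lambda>\<omega>. step_avg (end_accum n (V \<omega>) y) z) = real n * c * ?p" .
  have "expectation (\<lambda>\<omega>. end_accum (Suc n) (V \<omega>) y z)
      = expectation (\<lambda>\<omega>. V \<omega> z * ?p) + expectation (\<lambda>\<omega>. step_avg (end_accum n (V \<omega>) y) z)"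
    unfolding end_accum.simps using V(1) i2 by (intro Bochner_Integration.integral_add) auto
  also have "\<dots> = real (Suc n) * c * end_weight (Suc n) (\<lambda>_. 1) y z"
    using V by (simp add: e2 algebra_simps)
  finally show ?case using V(1) i2 by simp
qed simp

context holding_field
begin

text \<open>The costs are dominated by random variables \<open>u n\<close> that need not converge.
  As the limit \<open>a\<close> is not random, Fatou's lemma, for which \<open>u n\<close> must be
  nonnegative, bounds it by the limit of bounds on their normalised means.\<close>

lemma cost_upper_bound:
  assumes lim: "cost_limit \<theta> \<omega> v a"
    and u: "\<And>n. 0 < n \<Longrightarrow> AE \<sigma> in field_law. hitting_cost \<theta> 0 (int n *s v) \<omega> \<sigma> \<le> ereal (u n \<sigma>)"
    and um: "\<And>n. integrable field_law (u n)" "\<And>n \<sigma>. 0 \<le> u n \<sigma>"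
    and s: "\<And>n. 0 < n \<Longrightarrow> P.expectation (u n) / real n \<le> s n" and l: "s \<longlonglongrightarrow> l"
  shows "a \<le> l"
proof (rule ccontr)
  assume "\<not> a \<le> l"
  then obtain \<gamma> where \<gamma>: "l < \<gamma>" "\<gamma> < a" using dense[of l a] by auto
  have l0: "0 \<le> l"
  proof (rule LIMSEQ_le_const[OF l])
    show "\<exists>N. \<forall>n\<ge>N. 0 \<le> s n"
    proof (intro exI[of _ 1] allI impI)
      fix n :: nat assume "1 \<le> n"
      have "0 \<le> P.expectation (u n) / real n"
        using um(2) by (intro divide_nonneg_nonneg Bochner_Integration.integral_nonneg) auto
      then show "0 \<le> s n" using s[of n] \<open>1 \<le> n\<close> by simp
    qed
  qed
  let ?u = "\<lambda>n \<sigma>. ennreal (u n \<sigma> / real n)"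
  have "AE \<sigma> in field_law. \<forall>n. 0 < n \<longrightarrow> hitting_cost \<theta> 0 (int n *s v) \<omega> \<sigma> \<le> ereal (u n \<sigma>)"
    unfolding AE_all_countable
  proof (intro allI)
    fix n :: nat
    show "AE \<sigma> in field_law. 0 < n \<longrightarrow> hitting_cost \<theta> 0 (int n *s v) \<omega> \<sigma> \<le> ereal (u n \<sigma>)"
      using u[of n] by (cases "0 < n") auto
  qed
  with lim[unfolded cost_limit_def]
  have "AE \<sigma> in field_law. ennreal \<gamma> \<le> liminf (\<lambda>n. ?u n \<sigma>)"
  proof eventually_elim
    case (elim \<sigma>)
    have "\<forall>\<^sub>F n in sequentially. ereal \<gamma> < hitting_cost \<theta> 0 (int n *s v) \<omega> \<sigma> / ereal (real n)"
      by (rule order_tendstoD(1)[OF elim(1)]) (use \<gamma> in simp)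
    then have "\<forall>\<^sub>F n in sequentially. ennreal \<gamma> \<le> ?u n \<sigma>"
      using eventually_gt_at_top[of 0]
    proof eventually_elim
      case (elim n)
      have n: "0 < real n" using elim by simp
      have le: "hitting_cost \<theta> 0 (int n *s v) \<omega> \<sigma> / ereal (real n) \<le> ereal (u n \<sigma>) / ereal (real n)"
        using n elim(2) \<open>\<forall>n>0. hitting_cost \<theta> 0 (int n *s v) \<omega> \<sigma> \<le> ereal (u n \<sigma>)\<close>
        by (intro ereal_divide_right_mono) auto
      from less_le_trans[OF elim(1) le] have "ereal \<gamma> < ereal (u n \<sigma> / real n)"
        using n by simp
      then show ?case by (intro ennreal_leI) simp
    qed
    then show ?case by (rule Liminf_bounded)
  qed
  then have "(\<integral>\<^sup>+\<sigma>. ennreal \<gamma> \<partial>field_law) \<le> (\<integral>\<^sup>+\<sigma>. liminf (\<lambda>n. ?u n \<sigma>) \<partial>field_law)"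
    by (rule nn_integral_mono_AE)
  also have "\<dots> \<le> liminf (\<lambda>n. \<integral>\<^sup>+\<sigma>. ?u n \<sigma> \<partial>field_law)"
  proof (rule nn_integral_liminf)
    show "?u n \<in> borel_measurable field_law" for n
      using borel_measurable_integrable[OF um(1)[of n]] by measurable
  qed
  also have "\<dots> \<le> liminf (\<lambda>n. ennreal (s n))"
  proof (rule Liminf_mono)
    show "\<forall>\<^sub>F n in sequentially. (\<integral>\<^sup>+\<sigma>. ?u n \<sigma> \<partial>field_law) \<le> ennreal (s n)"
      using eventually_gt_at_top[of 0]
    proof eventually_elim
      case (elim n)
      have "(\<integral>\<^sup>+\<sigma>. ?u n \<sigma> \<partial>field_law) = ennreal (\<integral>\<sigma>. u n \<sigma> / real n \<partial>field_law)"
        using um by (intro nn_integral_eq_integral AE_I2) auto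
      then show ?case using s[OF elim] by (simp add: ennreal_leI)
    qed
  qed
  also have "\<dots> = ennreal l"
    using tendsto_ennrealI[OF l] by (auto dest: lim_imp_Liminf[rotated])
  finally have "ennreal \<gamma> \<le> ennreal l" by (simp add: P.emeasure_space_1)
  then show False using \<gamma> l0 by (simp add: ennreal_le_iff)
qed

definition real_mean :: "real measure \<Rightarrow> real" where
  "real_mean s = enn2real (mean_holding_time s)"

lemma AE_mean_finite: "AE s in \<nu>. mean_holding_time s < \<infinity>"
  using nn_integral_noteq_infinite[OF mean_holding_time_measurable[OF sets_\<nu>]] finite_mean by (auto simp: less_top)

lemma real_mean: "integrable \<nu> real_mean" "(\<integral>s. real_mean s \<partial>\<nu>) = total_mean"
proof -
  have m: "real_mean \<in> borel_measurable \<nu>"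
    unfolding real_mean_def[abs_def] using mean_holding_time_measurable[OF sets_\<nu>] by measurable
  have e: "(\<integral>\<^sup>+s. ennreal (real_mean s) \<partial>\<nu>) = (\<integral>\<^sup>+s. mean_holding_time s \<partial>\<nu>)"
    by (rule nn_integral_cong_AE) (use AE_mean_finite in \<open>eventually_elim, simp add: real_mean_def\<close>)
  show "integrable \<nu> real_mean"
    using m e finite_mean by (intro integrableI_nonneg) (auto simp: real_mean_def)
  show "(\<integral>s. real_mean s \<partial>\<nu>) = total_mean"
    using m e by (subst integral_eq_nn_integral) (auto simp: real_mean_def total_mean_def)
qed

text \<open>Jensen's inequality, from the tangent of the exponential at the mean.\<close>

lemma holding_laplace_ge:
  assumes s: "s \<in> space holding_laws" and fin: "mean_holding_time s < \<infinity>" and \<theta>: "0 \<le> \<theta>"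
  shows "exp (- (\<theta> * real_mean s)) \<le> holding_laplace \<theta> s"
proof -
  interpret prob_space s by (rule holding_lawsD(1)[OF s])
  have m: "(\<lambda>t. t) \<in> borel_measurable s"
    by (rule holding_laws_measurable_borel[OF s]) simp
  have nn: "AE t in s. 0 \<le> t"
    using holding_lawsD(3)[OF s] by (intro AE_I2) auto
  have i: "integrable s (\<lambda>t. t)"
    using m nn fin unfolding mean_holding_time_def by (intro integrableI_nonneg)
  have mu: "(\<integral>t. t \<partial>s) = real_mean s"
    unfolding real_mean_def mean_holding_time_def by (rule integral_eq_nn_integral[OF m nn])
  let ?\<mu> = "real_mean s"
  have "(\<integral>t. exp (- (\<theta> * ?\<mu>)) * (1 - \<theta> * (t - ?\<mu>)) \<partial>s) \<le> holding_laplace \<theta> s"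
    unfolding holding_laplace_def
  proof (rule integral_mono)
    show "integrable s (\<lambda>t. exp (- (\<theta> * ?\<mu>)) * (1 - \<theta> * (t - ?\<mu>)))" using i by simp
    show "integrable s (\<lambda>t. exp (- \<theta> * t))" by (rule holding_laplace(2)[OF s \<theta>])
    fix t
    have "exp (- (\<theta> * ?\<mu>)) * (1 - \<theta> * (t - ?\<mu>)) \<le> exp (- (\<theta> * ?\<mu>)) * exp (- (\<theta> * (t - ?\<mu>)))"
      using exp_ge_add_one_self[of "- (\<theta> * (t - ?\<mu>))"] by (intro mult_left_mono) auto
    also have "\<dots> = exp (- \<theta> * t)" by (simp add: algebra_simps flip: exp_add)
    finally show "exp (- (\<theta> * ?\<mu>)) * (1 - \<theta> * (t - ?\<mu>)) \<le> exp (- \<theta> * t)" .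
  qed
  moreover have "(\<integral>t. exp (- (\<theta> * ?\<mu>)) * (1 - \<theta> * (t - ?\<mu>)) \<partial>s) = exp (- (\<theta> * ?\<mu>))"
    using i by (simp add: mu prob_space)
  ultimately show ?thesis by simp
qed

lemma quenched_upper:
  fixes z :: "int ^ 'd"
  assumes \<omega>: "uniform_env \<omega>" and \<theta>: "0 \<le> \<theta>" and lim: "cost_limit \<theta> \<omega> (\<chi> i. 2 * z $ i) a"
    and N: "\<And>i. \<bar>z $ i\<bar> < int N"
  shows "a \<le> real N * (\<Sum>i\<in>UNIV. (real_of_int (z $ i) / real N)\<^sup>2 + (real_of_int (z $ i) / real N) ^ 4)
    + 2 * real CARD('d) * real N * \<theta> * total_mean"
proof -
  let ?v = "\<chi> i. 2 * z $ i" and ?d = "real CARD('d)"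
  define K where "K n = 2 * CARD('d) * N * n" for n
  define p where "p n = end_weight (K n) (\<lambda>_. 1) (int n *s ?v) 0" for n
  define V where "V \<sigma> v = \<theta> * real_mean (\<sigma> v)" for \<sigma> :: "int ^ 'd \<Rightarrow> real measure" and v :: "int ^ 'd"
  \<comment> \<open>The entropy bound \<open>p\<close> needs \<open>n > 0\<close>, while
    integrability and nonnegativity of \<open>u n\<close> are asked for every \<open>n\<close>;
    hence the value 0 at \<open>n = 0\<close>.\<close>
  define u where "u n \<sigma> = (if n = 0 then 0 else - ln (p n) + end_accum (K n) (V \<sigma>) (int n *s ?v) 0 / p n)" for n \<sigma>
  define H where "H = (\<Sum>i\<in>UNIV. (real_of_int (z $ i) / real N)\<^sup>2 + (real_of_int (z $ i) / real N) ^ 4)"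
  have p: "0 < p n" "- ln (p n) \<le> real n * real N * H + 2 * ?d * (ln (2 * real N * real n) + 1)" if "0 < n" for n
    using end_weight_entropy_bound[OF N that] unfolding p_def K_def H_def by blast+
  have p1: "p n \<le> 1" for n
    unfolding p_def using end_weight_le_hit_weight[of "\<lambda>_. 1" "K n" "int n *s ?v" 0]
      hit_weight_bounds[of "\<lambda>_. 1" "K n" "int n *s ?v" 0] by simp
  have V0: "0 \<le> V \<sigma> v" for \<sigma> v using \<theta> by (simp add: V_def real_mean_def)
  have rm: "real_mean \<in> borel_measurable \<nu>" using real_mean(1) by (rule borel_measurable_integrable)
  have Vi: "integrable field_law (\<lambda>\<sigma>. V \<sigma> v)" and Ve: "P.expectation (\<lambda>\<sigma>. V \<sigma> v) = \<theta> * total_mean" for v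
  proof -
    have "integrable field_law (\<lambda>\<sigma>. real_mean (\<sigma> v))"
      using integrable_distr[OF measurable_coordinate[of v], of real_mean] real_mean(1) by (simp add: distr_coordinate)
    then show "integrable field_law (\<lambda>\<sigma>. V \<sigma> v)" by (simp add: V_def)
    have "P.expectation (\<lambda>\<sigma>. real_mean (\<sigma> v)) = total_mean"
      using integral_distr[OF measurable_coordinate rm, of v] real_mean(2) by (simp add: distr_coordinate)
    then show "P.expectation (\<lambda>\<sigma>. V \<sigma> v) = \<theta> * total_mean" by (simp add: V_def)
  qed
  have acc_int: "integrable field_law (\<lambda>\<sigma>. end_accum k (V \<sigma>) y 0)"
    and acc_exp: "P.expectation (\<lambda>\<sigma>. end_accum k (V \<sigma>) y 0) = real k * (\<theta> * total_mean) * end_weight k (\<lambda>_. 1) y 0" for k y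
    using P.expectation_end_accum[of V, OF Vi Ve] by blast+
  have fin: "AE \<sigma> in field_law. \<forall>v. mean_holding_time (\<sigma> v) < \<infinity>"
    unfolding AE_all_countable
  proof
    fix v :: "int ^ 'd"
    have "AE s in distr field_law \<nu> (\<lambda>\<sigma>. \<sigma> v). mean_holding_time s < \<infinity>"
      unfolding distr_coordinate by (rule AE_mean_finite)
    then show "AE \<sigma> in field_law. mean_holding_time (\<sigma> v) < \<infinity>"
      by (rule AE_distrD[OF measurable_coordinate])
  qed
  show ?thesis
    unfolding H_def[symmetric]
  proof (rule cost_upper_bound[OF lim])
    show "AE \<sigma> in field_law. hitting_cost \<theta> 0 (int n *s ?v) \<omega> \<sigma> \<le> ereal (u n \<sigma>)" if n: "0 < n" for n
      using fin AE_space
    proof eventually_elim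
      case (elim \<sigma>)
      let ?\<phi> = "\<lambda>v. holding_laplace \<theta> (\<sigma> v)" and ?y = "int n *s ?v"
      let ?q = "p n * exp (- (end_accum (K n) (V \<sigma>) ?y 0 / p n))"
      have "?q \<le> end_weight (K n) (\<lambda>v. exp (- V \<sigma> v)) ?y 0"
        using end_weight_exp_ge_Jensen[of "K n" ?y 0 "V \<sigma>"] p(1)[OF n] unfolding p_def by blast
      also have "\<dots> \<le> end_weight (K n) ?\<phi> ?y 0"
      proof (rule end_weight_mono)
        show "exp (- V \<sigma> v) \<le> ?\<phi> v" for v
          unfolding V_def using elim by (intro holding_laplace_ge holding_envD[OF field_holding_env] \<theta>) auto
      qed simp
      also have "\<dots> \<le> hit_weight (K n) ?\<phi> ?y 0"
        by (intro end_weight_le_hit_weight holding_laplace_bounds elim \<theta>)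
      also have "\<dots> \<le> hitting_laplace \<theta> 0 ?y \<omega> \<sigma>"
        by (rule hitting_laplace_field(2)[OF \<omega> \<theta> elim(2)])
      finally have L: "?q \<le> hitting_laplace \<theta> 0 ?y \<omega> \<sigma>" .
      have q0: "0 < ?q" using p(1)[OF n] by simp
      have "ln ?q = - u n \<sigma>"
        using p(1)[OF n] n by (simp add: u_def ln_mult)
      moreover have "ln ?q \<le> ln (hitting_laplace \<theta> 0 ?y \<omega> \<sigma>)"
        using L q0 by (subst ln_le_cancel_iff) auto
      ultimately have "- ln (hitting_laplace \<theta> 0 ?y \<omega> \<sigma>) \<le> u n \<sigma>" by linarith
      moreover have "hitting_laplace \<theta> 0 ?y \<omega> \<sigma> \<noteq> 0" using L q0 by linarith
      ultimately show ?case by (simp add: hitting_cost_def)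
    qed
    show "integrable field_law (u n)" for n
      unfolding u_def[abs_def] using acc_int by (cases "n = 0") auto
    show "0 \<le> u n \<sigma>" for n \<sigma>
    proof (cases "n = 0")
      case False
      then have "ln (p n) \<le> 0" using p(1)[of n] p1[of n] by simp
      moreover have "0 \<le> end_accum (K n) (V \<sigma>) (int n *s ?v) 0 / p n"
        using p(1)[of n] False by (intro divide_nonneg_nonneg end_accum_nonneg V0) auto
      ultimately show ?thesis by (simp add: u_def)
    qed (simp add: u_def)
    show "P.expectation (u n) / real n \<le> real N * H + 2 * ?d * real N * \<theta> * total_mean
        + 2 * ?d * (ln (2 * real N * real n) + 1) / real n" if n: "0 < n" for n
    proof -
      have "P.expectation (u n) = - ln (p n) + P.expectation (\<lambda>\<sigma>. end_accum (K n) (V \<sigma>) (int n *s ?v) 0) / p n"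
        unfolding u_def[abs_def] using acc_int n by (simp add: P.prob_space)
      also have "\<dots> = - ln (p n) + real (K n) * (\<theta> * total_mean)"
        unfolding acc_exp p_def[symmetric] using p(1)[OF n] by simp
      also have "\<dots> \<le> real n * real N * H + 2 * ?d * (ln (2 * real N * real n) + 1) + real (K n) * (\<theta> * total_mean)"
        using p(2)[OF n] by simp
      also have "\<dots> = real n * (real N * H + 2 * ?d * real N * \<theta> * total_mean) + 2 * ?d * (ln (2 * real N * real n) + 1)"
        unfolding K_def by (simp add: algebra_simps)
      finally have le: "P.expectation (u n) \<le> real n * (real N * H + 2 * ?d * real N * \<theta> * total_mean) + 2 * ?d * (ln (2 * real N * real n) + 1)" .
      have "P.expectation (u n) / real n \<le> (real n * (real N * H + 2 * ?d * real N * \<theta> * total_mean) + 2 * ?d * (ln (2 * real N * real n) + 1)) / real n"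
        using le by (rule divide_right_mono) simp
      also have "\<dots> = real N * H + 2 * ?d * real N * \<theta> * total_mean + 2 * ?d * (ln (2 * real N * real n) + 1) / real n"
        using n by (simp add: add_divide_distrib)
      finally show ?thesis .
    qed
    have N0: "0 < N" using N[of undefined] by linarith
    have "(\<lambda>n. 2 * ?d * (ln (2 * real N * real n) + 1) / real n) \<longlonglongrightarrow> 0"
    proof -
      have "(\<lambda>n. 2 * ?d * (ln (2 * real N) * (1 / real n) + ln (real n) / real n + 1 / real n)) \<longlonglongrightarrow> 2 * ?d * (ln (2 * real N) * 0 + 0 + 0)"
        by (intro tendsto_intros lim_ln_over_n lim_1_over_n)
      then have l: "(\<lambda>n. 2 * ?d * (ln (2 * real N) * (1 / real n) + ln (real n) / real n + 1 / real n)) \<longlonglongrightarrow> 0"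
        by simp
      show ?thesis
      proof (rule Lim_transform_eventually[OF l])
        show "\<forall>\<^sub>F n in sequentially. 2 * ?d * (ln (2 * real N) * (1 / real n) + ln (real n) / real n + 1 / real n)
            = 2 * ?d * (ln (2 * real N * real n) + 1) / real n"
          using eventually_gt_at_top[of 0]
        proof eventually_elim
          case (elim n)
          then have "ln (2 * real N * real n) = ln (2 * real N) + ln (real n)"
            using N0 by (simp add: ln_mult)
          then show ?case by (simp add: add_divide_distrib distrib_left)
        qed
      qed
    qed
    from tendsto_add[OF tendsto_const[of "real N * H + 2 * ?d * real N * \<theta> * total_mean"] this]
    show "(\<lambda>n. real N * H + 2 * ?d * real N * \<theta> * total_mean + 2 * ?d * (ln (2 * real N * real n) + 1) / real n)
      \<longlonglongrightarrow> real N * H + 2 * ?d * real N * \<theta> * total_mean"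
      by (simp only: add_0_right)
  qed
qed

end

subsection \<open>Homogeneous extension and the rate function\<close>

lemma floor_scaled_tendsto: "(\<lambda>n. real_of_int \<lfloor>real (Suc n) * c\<rfloor> / real (Suc n)) \<longlonglongrightarrow> c"
proof (rule tendsto_sandwich)
  show "\<forall>\<^sub>F n in sequentially. c - 1 / real (Suc n) \<le> real_of_int \<lfloor>real (Suc n) * c\<rfloor> / real (Suc n)"
  proof (intro always_eventually allI)
    fix n
    have "(real (Suc n) * c - 1) / real (Suc n) \<le> real_of_int \<lfloor>real (Suc n) * c\<rfloor> / real (Suc n)"
      by (intro divide_right_mono) linarith+
    then show "c - 1 / real (Suc n) \<le> real_of_int \<lfloor>real (Suc n) * c\<rfloor> / real (Suc n)"
      by (simp add: diff_divide_distrib del: of_nat_Suc)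
  qed
  show "\<forall>\<^sub>F n in sequentially. real_of_int \<lfloor>real (Suc n) * c\<rfloor> / real (Suc n) \<le> c"
  proof (intro always_eventually allI)
    fix n
    have "real_of_int \<lfloor>real (Suc n) * c\<rfloor> / real (Suc n) \<le> (real (Suc n) * c) / real (Suc n)"
      by (intro divide_right_mono) linarith+
    then show "real_of_int \<lfloor>real (Suc n) * c\<rfloor> / real (Suc n) \<le> c" by (simp del: of_nat_Suc)
  qed
  show "(\<lambda>n. c - 1 / real (Suc n)) \<longlonglongrightarrow> c"
    using tendsto_diff[OF tendsto_const lim_inverse_n'[THEN LIMSEQ_Suc]] by simp
qed simp

definition lattice_approx :: "real ^ 'd \<Rightarrow> nat \<Rightarrow> int ^ 'd" where
  "lattice_approx x n = (\<chi> i. \<lfloor>real (Suc n) * x $ i\<rfloor>)"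

lemma lattice_approx_component: "(\<lambda>n. real_of_int (lattice_approx x n $ i) / real (Suc n)) \<longlonglongrightarrow> x $ i"
  unfolding lattice_approx_def vec_lambda_beta by (rule floor_scaled_tendsto)

lemma lattice_approx_tendsto: "(\<lambda>n. (1 / real (Suc n)) *\<^sub>R lattice_to_real (lattice_approx x n)) \<longlonglongrightarrow> x"
  by (rule vec_tendstoI) (use lattice_approx_component in \<open>simp add: lattice_to_real_def\<close>)

lemma homogeneous_lower_bound:
  fixes f :: "real ^ 'd \<Rightarrow> real"
  assumes cont: "continuous_on UNIV f"
    and hom: "\<And>z q. 0 < q \<Longrightarrow> f ((1 / real q) *\<^sub>R lattice_to_real z) = f (lattice_to_real z) / real q"
    and low: "\<And>z. \<kappa> * norm (lattice_to_real z) \<le> f (lattice_to_real z)"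
  shows "\<kappa> * norm x \<le> f x"
proof -
  let ?r = "\<lambda>n. (1 / real (Suc n)) *\<^sub>R lattice_to_real (lattice_approx x n)"
  have "\<kappa> * norm (?r n) \<le> f (?r n)" for n
  proof -
    have "\<kappa> * norm (lattice_to_real (lattice_approx x n)) / real (Suc n) \<le> f (lattice_to_real (lattice_approx x n)) / real (Suc n)"
      by (intro divide_right_mono low) simp
    then show ?thesis
      using hom[of "Suc n" "lattice_approx x n"] by (simp del: of_nat_Suc)
  qed
  moreover have "(\<lambda>n. f (?r n)) \<longlonglongrightarrow> f x"
  proof (rule isCont_tendsto_compose[OF _ lattice_approx_tendsto])
    show "isCont f x" using cont by (simp add: continuous_on_eq_continuous_at)
  qed
  moreover have "(\<lambda>n. \<kappa> * norm (?r n)) \<longlonglongrightarrow> \<kappa> * norm x"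
    by (intro tendsto_intros lattice_approx_tendsto)
  ultimately show ?thesis
    by (intro LIMSEQ_le[where X = "\<lambda>n. \<kappa> * norm (?r n)" and Y = "\<lambda>n. f (?r n)"]) auto
qed

lemma sum_squares_eq_norm: "(\<Sum>i\<in>UNIV. (x $ i)\<^sup>2) = (norm x)\<^sup>2" for x :: "real ^ 'd"
  by (simp add: norm_vec_def L2_set_def sum_nonneg)

lemma sum_fourth_le:
  fixes x :: "real ^ 'd"
  shows "(\<Sum>i\<in>UNIV. (x $ i) ^ 4) \<le> norm x ^ 4"
proof -
  have "(x $ i) ^ 4 \<le> (norm x)\<^sup>2 * (x $ i)\<^sup>2" for i
  proof -
    have "\<bar>x $ i\<bar>\<^sup>2 \<le> (norm x)\<^sup>2" by (intro power_mono component_le_norm_cart) simp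
    then have "(x $ i)\<^sup>2 * (x $ i)\<^sup>2 \<le> (norm x)\<^sup>2 * (x $ i)\<^sup>2" by (intro mult_right_mono) auto
    then show ?thesis by (simp flip: power_add)
  qed
  then have "(\<Sum>i\<in>UNIV. (x $ i) ^ 4) \<le> (\<Sum>i\<in>UNIV. (norm x)\<^sup>2 * (x $ i)\<^sup>2)" by (rule sum_mono)
  also have "\<dots> = (norm x)\<^sup>2 * (norm x)\<^sup>2" by (simp add: sum_distrib_left[symmetric] sum_squares_eq_norm)
  finally show ?thesis by (simp flip: power_add)
qed

text \<open>After scaling, \<open>z\<close> tends to \<open>x / 2\<close>, since the lattice target
  is twice \<open>z\<close>, and \<open>N\<close> tends to \<open>s\<close>, a free parameter that
  sets the number of steps per unit of time. The condition \<open>norm x < 2 * s\<close> makes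
  \<open>\<bar>z $ i\<bar> < N\<close> hold eventually.\<close>

lemma homogeneous_upper_bound:
  fixes f :: "real ^ 'd \<Rightarrow> real"
  assumes cont: "continuous_on UNIV f"
    and hom: "\<And>z q. 0 < q \<Longrightarrow> f ((1 / real q) *\<^sub>R lattice_to_real z) = f (lattice_to_real z) / real q"
    and up: "\<And>z N. (\<And>i. \<bar>z $ i\<bar> < int N) \<Longrightarrow> f (lattice_to_real (\<chi> i. 2 * z $ i))
      \<le> real N * (\<Sum>i\<in>UNIV. (real_of_int (z $ i) / real N)\<^sup>2 + (real_of_int (z $ i) / real N) ^ 4) + c * real N"
    and s: "0 < s" "norm x < 2 * s"
  shows "f x \<le> (norm x)\<^sup>2 / (4 * s) + norm x ^ 4 / (16 * s ^ 3) + c * s"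
proof -
  define z where "z n = lattice_approx ((1 / 2) *\<^sub>R x) n" for n
  define N where "N n = nat \<lceil>real (Suc n) * s\<rceil>" for n
  let ?r = "\<lambda>n. (1 / real (Suc n)) *\<^sub>R lattice_to_real (\<chi> i. 2 * z n $ i)"
  have zl: "(\<lambda>n. real_of_int (z n $ i) / real (Suc n)) \<longlonglongrightarrow> x $ i / 2" for i
    using lattice_approx_component[of "(1 / 2) *\<^sub>R x" i] by (simp add: z_def)
  have Nl: "(\<lambda>n. real (N n) / real (Suc n)) \<longlonglongrightarrow> s"
  proof -
    have "real (N n) = - real_of_int \<lfloor>real (Suc n) * (- s)\<rfloor>" for n
    proof -
      have "0 \<le> real (Suc n) * s" using s by simp
      then have "real (N n) = real_of_int \<lceil>real (Suc n) * s\<rceil>"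
        unfolding N_def by (intro of_nat_nat) linarith
      then show ?thesis by (simp add: ceiling_def)
    qed
    then show ?thesis using tendsto_minus[OF floor_scaled_tendsto[of "- s"]] by simp
  qed
  have rl: "?r \<longlonglongrightarrow> x"
  proof (rule vec_tendstoI)
    fix i
    have "(\<lambda>n. 2 * (real_of_int (z n $ i) / real (Suc n))) \<longlonglongrightarrow> 2 * (x $ i / 2)"
      by (intro tendsto_intros zl)
    then show "(\<lambda>n. ?r n $ i) \<longlonglongrightarrow> x $ i" by (simp add: lattice_to_real_def)
  qed
  have fl: "(\<lambda>n. f (?r n)) \<longlonglongrightarrow> f x"
  proof (rule isCont_tendsto_compose[OF _ rl])
    show "isCont f x" using cont by (simp add: continuous_on_eq_continuous_at)
  qed
  let ?p = "\<lambda>n i. (real_of_int (z n $ i) / real (Suc n)) / (real (N n) / real (Suc n))"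
  let ?b = "\<lambda>n. real (N n) / real (Suc n) * (\<Sum>i\<in>UNIV. (?p n i)\<^sup>2 + (?p n i) ^ 4) + c * (real (N n) / real (Suc n))"
  have bl: "?b \<longlonglongrightarrow> s * (\<Sum>i\<in>UNIV. (x $ i / 2 / s)\<^sup>2 + (x $ i / 2 / s) ^ 4) + c * s"
    using s by (intro tendsto_intros zl Nl) auto
  have "\<forall>\<^sub>F n in sequentially. \<forall>i. \<bar>z n $ i\<bar> < int (N n)"
  proof (rule eventually_all_finite)
    fix i
    have "\<bar>x $ i / 2\<bar> < s" using component_le_norm_cart[of x i] s by simp
    moreover have "(\<lambda>n. real (N n) / real (Suc n) - \<bar>real_of_int (z n $ i) / real (Suc n)\<bar>) \<longlonglongrightarrow> s - \<bar>x $ i / 2\<bar>"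
      by (intro tendsto_intros zl Nl)
    ultimately have "\<forall>\<^sub>F n in sequentially. 0 < real (N n) / real (Suc n) - \<bar>real_of_int (z n $ i) / real (Suc n)\<bar>"
      by (intro order_tendstoD(1)) auto
    then show "\<forall>\<^sub>F n in sequentially. \<bar>z n $ i\<bar> < int (N n)"
    proof eventually_elim
      case (elim n)
      then have "\<bar>real_of_int (z n $ i)\<bar> / real (Suc n) < real (N n) / real (Suc n)" by (simp del: of_nat_Suc)
      then have "\<bar>real_of_int (z n $ i)\<bar> < real (N n)"
        by (simp add: divide_less_cancel del: of_nat_Suc)
      then show ?case by linarith
    qed
  qed
  then have "\<forall>\<^sub>F n in sequentially. f (?r n) \<le> ?b n"
  proof eventually_elim
    case (elim n)
    have pe: "?p n i = real_of_int (z n $ i) / real (N n)" for i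
      by (simp del: of_nat_Suc)
    have "f (?r n) = f (lattice_to_real (\<chi> i. 2 * z n $ i)) / real (Suc n)"
      by (rule hom) simp
    also have "\<dots> \<le> (real (N n) * (\<Sum>i\<in>UNIV. (?p n i)\<^sup>2 + (?p n i) ^ 4) + c * real (N n)) / real (Suc n)"
      unfolding pe using elim by (intro divide_right_mono up) auto
    also have "\<dots> = ?b n" by (simp add: add_divide_distrib del: of_nat_Suc)
    finally show ?case .
  qed
  then have "f x \<le> s * (\<Sum>i\<in>UNIV. (x $ i / 2 / s)\<^sup>2 + (x $ i / 2 / s) ^ 4) + c * s"
    by (rule tendsto_le[OF sequentially_bot bl fl])
  also have "(\<Sum>i\<in>UNIV. (x $ i / 2 / s)\<^sup>2 + (x $ i / 2 / s) ^ 4)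
    = (norm x)\<^sup>2 / (4 * s\<^sup>2) + (\<Sum>i\<in>UNIV. (x $ i) ^ 4) / (16 * s ^ 4)"
    by (simp add: sum.distrib power_divide power_mult_distrib sum_divide_distrib[symmetric] sum_squares_eq_norm)
  also have "s * ((norm x)\<^sup>2 / (4 * s\<^sup>2) + (\<Sum>i\<in>UNIV. (x $ i) ^ 4) / (16 * s ^ 4)) + c * s
    = (norm x)\<^sup>2 / (4 * s) + (\<Sum>i\<in>UNIV. (x $ i) ^ 4) / (16 * s ^ 3) + c * s"
    using s by (simp add: field_simps power2_eq_square power3_eq_cube power4_eq_xxxx)
  also have "\<dots> \<le> (norm x)\<^sup>2 / (4 * s) + norm x ^ 4 / (16 * s ^ 3) + c * s"
    using s sum_fourth_le[of x] by (intro add_mono divide_right_mono) auto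
  finally show ?thesis .
qed

text \<open>The upper bound comes with an explicit quartic error, the lower one only with every
  constant below \<open>C\<close> on its own neighbourhood of 0. The correction
  \<open>\<epsilon>\<close> is defined by division, so \<open>x = 0\<close> is treated
  apart.\<close>

lemma quadratic_rate_asymptotics:
  fixes I :: "real ^ 'd \<Rightarrow> ereal" and x :: "real ^ 'd"
  assumes C: "0 < C" and nn: "\<And>v. 0 \<le> I v"
    and up: "\<And>v. norm v < \<delta> \<Longrightarrow> I v \<le> ereal (C * (norm v)\<^sup>2 + D * norm v ^ 4)" and \<delta>: "0 < \<delta>"
    and low: "\<And>c. c < C \<Longrightarrow> \<exists>\<eta>>0. \<forall>v. v \<noteq> 0 \<longrightarrow> norm v < \<eta> \<longrightarrow> ereal (c * (norm v)\<^sup>2) \<le> I v"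
  shows "\<exists>\<epsilon> :: real \<Rightarrow> real. (\<epsilon> \<longlongrightarrow> 0) (at 0) \<and>
    (\<forall>\<^sub>F l in at 0. I (l *\<^sub>R x) = ereal (C * l\<^sup>2 * (norm x)\<^sup>2 * (1 + \<epsilon> l)))"
proof (cases "x = 0")
  case True
  have "I 0 \<le> 0" using up[of 0] \<delta> by (simp add: zero_ereal_def)
  then have "I 0 = 0" using nn[of 0] by (rule antisym)
  then show ?thesis using True by (intro exI[of _ "\<lambda>_. 0"]) (simp add: zero_ereal_def)
next
  case False
  define \<epsilon> where "\<epsilon> l = real_of_ereal (I (l *\<^sub>R x)) / (C * l\<^sup>2 * (norm x)\<^sup>2) - 1" for l
  have small: "\<forall>\<^sub>F l in at 0. l \<noteq> 0 \<and> norm (l *\<^sub>R x) < e" if "0 < e" for e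
  proof -
    have "((\<lambda>l. norm (l *\<^sub>R x)) \<longlongrightarrow> norm (0 *\<^sub>R x)) (at 0)" by (intro tendsto_intros)
    then have "\<forall>\<^sub>F l in at 0. norm (l *\<^sub>R x) < e"
      using that by (intro order_tendstoD(2)) auto
    then show ?thesis
      using eventually_at_ball'[of 1 0 UNIV] by (intro eventually_conj) (auto elim: eventually_mono)
  qed
  have eq: "\<forall>\<^sub>F l in at 0. I (l *\<^sub>R x) = ereal (C * l\<^sup>2 * (norm x)\<^sup>2 * (1 + \<epsilon> l))"
    using small[OF \<delta>]
  proof eventually_elim
    case (elim l)
    have "\<bar>I (l *\<^sub>R x)\<bar> \<noteq> \<infinity>" using nn[of "l *\<^sub>R x"] up[of "l *\<^sub>R x"] elim by auto
    then have "I (l *\<^sub>R x) = ereal (real_of_ereal (I (l *\<^sub>R x)))" by (simp add: ereal_real)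
    also have "real_of_ereal (I (l *\<^sub>R x)) = C * l\<^sup>2 * (norm x)\<^sup>2 * (1 + \<epsilon> l)"
      using elim False C by (simp add: \<epsilon>_def)
    finally show ?case .
  qed
  have "(\<epsilon> \<longlongrightarrow> 0) (at 0)"
  proof (rule order_tendstoI)
    fix a :: real assume a: "a < 0"
    \<comment> \<open>A lower constant strictly below \<open>C\<close> is required; this one gives
      \<open>\<epsilon> l \<ge> a / 2\<close>, which exceeds \<open>a\<close> because
      \<open>a\<close> is negative.\<close>
    obtain \<eta> where \<eta>: "0 < \<eta>" "\<And>v. v \<noteq> 0 \<Longrightarrow> norm v < \<eta> \<Longrightarrow> ereal ((1 + a / 2) * C * (norm v)\<^sup>2) \<le> I v"
      using low[of "(1 + a / 2) * C"] a C by (auto simp: mult_less_cancel_right)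
    show "\<forall>\<^sub>F l in at 0. a < \<epsilon> l"
      using small[OF \<eta>(1)] eq
    proof eventually_elim
      case (elim l)
      let ?q = "C * l\<^sup>2 * (norm x)\<^sup>2"
      have q: "0 < ?q" using elim False C by simp
      have "ereal ((1 + a / 2) * C * (norm (l *\<^sub>R x))\<^sup>2) \<le> I (l *\<^sub>R x)"
        using elim False by (intro \<eta>(2)) auto
      then have "(1 + a / 2) * ?q \<le> (1 + \<epsilon> l) * ?q"
        unfolding elim(2) by (simp add: power_mult_distrib mult_ac)
      then have "1 + a / 2 \<le> 1 + \<epsilon> l" using q by (rule mult_right_le_imp_le)
      then show ?case using a by linarith
    qed
  next
    fix a :: real assume a: "0 < a"
    have "((\<lambda>l. D * (norm (l *\<^sub>R x))\<^sup>2 / C) \<longlongrightarrow> D * (norm (0 *\<^sub>R x))\<^sup>2 / C) (at 0)"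
      using C by (intro tendsto_intros) auto
    then have "\<forall>\<^sub>F l in at 0. D * (norm (l *\<^sub>R x))\<^sup>2 / C < a"
      using a by (intro order_tendstoD(2)) auto
    then show "\<forall>\<^sub>F l in at 0. \<epsilon> l < a"
      using small[OF \<delta>] eq
    proof eventually_elim
      case (elim l)
      let ?q = "C * l\<^sup>2 * (norm x)\<^sup>2"
      have q: "0 < ?q" using elim False C by simp
      have "I (l *\<^sub>R x) \<le> ereal (C * (norm (l *\<^sub>R x))\<^sup>2 + D * norm (l *\<^sub>R x) ^ 4)"
        using elim by (intro up) auto
      then have "?q * (1 + \<epsilon> l) \<le> C * (norm (l *\<^sub>R x))\<^sup>2 + D * norm (l *\<^sub>R x) ^ 4"
        unfolding elim(3) by simp
      also have "C * (norm (l *\<^sub>R x))\<^sup>2 = ?q" by (simp add: power_mult_distrib)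
      also have "D * norm (l *\<^sub>R x) ^ 4 = ?q * (D * (norm (l *\<^sub>R x))\<^sup>2 / C)"
        using C by (simp add: power_mult_distrib power4_eq_xxxx power2_eq_square)
      finally have "?q * \<epsilon> l \<le> ?q * (D * (norm (l *\<^sub>R x))\<^sup>2 / C)" by (simp add: distrib_left)
      then have "\<epsilon> l \<le> D * (norm (l *\<^sub>R x))\<^sup>2 / C" using q by (rule mult_left_le_imp_le)
      then show ?case using elim(1) by linarith
    qed
  qed
  with eq show ?thesis by blast
qed

text \<open>The environment obtained may depend on \<open>\<theta>\<close> and \<open>v\<close>;
  this is harmless because the quenched bounds hold for every uniform environment.\<close>

lemma lyapunov_exponent_quenched:
  fixes \<mu> :: "(int ^ 'd) measure measure" and f :: "real ^ 'd \<Rightarrow> real" and v :: "int ^ 'd"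
  assumes \<mu>: "prob_space \<mu>" "sets \<mu> = sets step_laws"
    and \<nu>: "holding_field \<nu>" and f: "lyapunov_exponent \<mu> \<nu> \<theta> f"
    and unif: "AE \<omega> in iid_law \<mu>. \<forall>(y :: int ^ 'd) (e :: int ^ 'd).
           lattice_l1 e = 1 \<longrightarrow> measure (\<omega> y) {e} = 1 / (2 * real CARD('d))"
  obtains \<omega> where "uniform_env \<omega>" "holding_field.cost_limit \<nu> \<theta> \<omega> v (f (lattice_to_real v))"
proof -
  interpret holding_field \<nu> "TYPE('d)" by (rule \<nu>)
  interpret A: prob_space "iid_law \<mu> :: (int ^ 'd \<Rightarrow> (int ^ 'd) measure) measure"
    unfolding iid_law_def by (rule prob_space_PiM) (rule \<mu>)
  interpret AB: pair_prob_space "iid_law \<mu> :: (int ^ 'd \<Rightarrow> (int ^ 'd) measure) measure" field_law ..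
  have "AE p in iid_law \<mu> \<Otimes>\<^sub>M field_law. (\<lambda>n. hitting_cost \<theta> 0 (int n *s v) (fst p) (snd p) / ereal (real n)) \<longlonglongrightarrow> ereal (f (lattice_to_real v))"
    using f unfolding lyapunov_exponent_def case_prod_beta by blast
  then have "AE \<omega> in iid_law \<mu>. AE \<sigma> in field_law. (\<lambda>n. hitting_cost \<theta> 0 (int n *s v) (fst (\<omega>, \<sigma>)) (snd (\<omega>, \<sigma>)) / ereal (real n)) \<longlonglongrightarrow> ereal (f (lattice_to_real v))"
    by (rule AB.AE_pair)
  then have "AE \<omega> in iid_law \<mu>. cost_limit \<theta> \<omega> v (f (lattice_to_real v))"
    by (simp add: cost_limit_def)
  moreover have "AE \<omega> in iid_law \<mu>. uniform_env (\<omega> :: int ^ 'd \<Rightarrow> (int ^ 'd) measure)"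
    using unif AE_space
  proof eventually_elim
    case (elim \<omega>)
    have "\<omega> \<in> space (\<Pi>\<^sub>M x\<in>UNIV. step_laws)"
      using elim(2) sets_eq_imp_space_eq[OF \<mu>(2)] by (simp add: iid_law_def space_PiM)
    then show ?case using elim(1) by (simp add: uniform_env_def)
  qed
  ultimately have "AE \<omega> in iid_law \<mu>. uniform_env \<omega> \<and> cost_limit \<theta> \<omega> v (f (lattice_to_real v))"
    by eventually_elim blast
  then obtain \<omega> where "uniform_env \<omega> \<and> cost_limit \<theta> \<omega> v (f (lattice_to_real v))"
    using eventually_happens'[OF A.ae_filter_bot] by blast
  then show thesis using that by blast
qed

text \<open>Used to pass from a finite moment of order \<open>d \<ge> 1\<close> to a finite
  mean.\<close>

lemma ennreal_le_one_plus_power: "(m :: ennreal) \<le> 1 + m ^ Suc k"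
proof (cases "m \<le> 1")
  case True
  then show ?thesis by (meson add_increasing2 zero_le order_trans)
next
  case False
  then have 1: "1 \<le> m" by simp
  have "1 \<le> m ^ k"
  proof (induction k)
    case (Suc k)
    have "1 * 1 \<le> m * m ^ k" using 1 Suc by (intro mult_mono) auto
    then show ?case by simp
  qed simp
  then have "m * 1 \<le> m * m ^ k" by (intro mult_left_mono) auto
  then show ?thesis by (simp add: add_increasing)
qed

lemma nn_integral_iid_coordinate:
  assumes "prob_space \<nu>" "g \<in> borel_measurable \<nu>"
  shows "(\<integral>\<^sup>+\<sigma>. g (\<sigma> (z :: int ^ 'd)) \<partial>iid_law \<nu>) = (\<integral>\<^sup>+s. g s \<partial>\<nu>)"
proof -
  interpret product_prob_space "\<lambda>_. \<nu>" "UNIV :: (int ^ 'd) set"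
    by (intro product_prob_spaceI) (rule assms(1))
  have "(\<integral>\<^sup>+s. g s \<partial>distr (iid_law \<nu>) \<nu> (\<lambda>\<sigma>. \<sigma> z)) = (\<integral>\<^sup>+\<sigma>. g (\<sigma> z) \<partial>iid_law \<nu>)"
    unfolding iid_law_def using assms(2) by (intro nn_integral_distr measurable_component_singleton) auto
  moreover have "distr (iid_law \<nu>) \<nu> (\<lambda>\<sigma>. \<sigma> z) = \<nu>"
    unfolding iid_law_def by (rule PiM_component) simp
  ultimately show ?thesis by simp
qed

theorem mainTheorem5:
  fixes \<mu> :: "(int ^ 'd) measure measure" and \<nu> :: "real measure measure"
    and \<alpha> :: "real \<Rightarrow> real ^ 'd \<Rightarrow> real" and x :: "real ^ 'd"
  assumes "prob_space \<mu>" and "sets \<mu> = sets step_laws"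
    and "prob_space \<nu>" and "sets \<nu> = sets holding_laws"
    and "\<And>\<theta>. 0 \<le> \<theta> \<Longrightarrow> lyapunov_exponent \<mu> \<nu> \<theta> (\<alpha> \<theta>)"
    and "AE \<omega> in iid_law \<mu>. \<forall>(y :: int ^ 'd) (e :: int ^ 'd).
           lattice_l1 e = 1 \<longrightarrow> measure (\<omega> y) {e} = 1 / (2 * real CARD('d))"
    and "(\<integral>\<^sup>+ \<sigma>. mean_holding_time (\<sigma> (0 :: int ^ 'd)) ^ CARD('d) \<partial>iid_law \<nu>) < \<infinity>"
  shows "\<exists>\<epsilon> :: real \<Rightarrow> real. (\<epsilon> \<longlongrightarrow> 0) (at 0) \<and>
    (\<forall>\<^sub>F l in at 0. rate_function \<alpha> (l *\<^sub>R x) =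
       ereal (real CARD('d) / 2
         * enn2real (\<integral>\<^sup>+ \<sigma>. mean_holding_time (\<sigma> (0 :: int ^ 'd)) \<partial>iid_law \<nu>)
         * l\<^sup>2 * (norm x)\<^sup>2 * (1 + \<epsilon> l)))"
proof -
  let ?d = "real CARD('d)"
  note mm = mean_holding_time_measurable[OF assms(4)]
  have fin: "(\<integral>\<^sup>+s. mean_holding_time s \<partial>\<nu>) < \<infinity>"
  proof -
    interpret prob_space \<nu> by (rule assms(3))
    obtain k where k: "CARD('d) = Suc k"
      using zero_less_card_finite[where 'a = 'd] by (cases "CARD('d)") auto
    have "(\<integral>\<^sup>+s. mean_holding_time s \<partial>\<nu>) \<le> (\<integral>\<^sup>+s. 1 + mean_holding_time s ^ CARD('d) \<partial>\<nu>)"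
      unfolding k by (intro nn_integral_mono ennreal_le_one_plus_power)
    also have "\<dots> = 1 + (\<integral>\<^sup>+s. mean_holding_time s ^ CARD('d) \<partial>\<nu>)"
      using mm by (subst nn_integral_add) (simp_all add: emeasure_space_1)
    also have "\<dots> < \<infinity>"
      using assms(7) nn_integral_iid_coordinate[OF assms(3), of "\<lambda>s. mean_holding_time s ^ CARD('d)" "0 :: int ^ 'd"] mm
      by (simp add: ennreal_add_less_top)
    finally show ?thesis .
  qed
  interpret holding_field \<nu> "TYPE('d)"
    by (rule holding_field.intro[OF assms(3,4) fin])
  let ?m = total_mean
  have m: "0 < ?m" by (rule total_mean_pos)
  have meq: "enn2real (\<integral>\<^sup>+ \<sigma>. mean_holding_time (\<sigma> (0 :: int ^ 'd)) \<partial>iid_law \<nu>) = ?m"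
    unfolding total_mean_def nn_integral_iid_coordinate[OF assms(3) mm] ..
  have ly: "0 \<le> \<alpha> \<theta> v" "continuous_on UNIV (\<alpha> \<theta>)"
    "\<And>z q. 0 < q \<Longrightarrow> \<alpha> \<theta> ((1 / real q) *\<^sub>R lattice_to_real z) = \<alpha> \<theta> (lattice_to_real z) / real q" if "0 \<le> \<theta>" for \<theta> v
    using assms(5)[OF that] unfolding lyapunov_exponent_def by blast+
  note quenched = lyapunov_exponent_quenched[OF assms(1,2) holding_field_axioms assms(5) assms(6)]
  have up: "rate_function \<alpha> v \<le> ereal (?d * ?m / 2 * (norm v)\<^sup>2 + (?d * ?m) ^ 3 / 2 * norm v ^ 4)"
    if v: "norm v < 1 / (?d * ?m)" for v
    unfolding rate_function_def
  proof (rule SUP_least)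
    fix \<theta> :: real assume "\<theta> \<in> {0..}"
    then have \<theta>: "0 \<le> \<theta>" by simp
    \<comment> \<open>The bridge then makes \<open>2 * ?d * ?s = 1 / ?m\<close> steps per unit of
      time, of mean total duration 1, so its potential costs exactly \<open>\<theta>\<close> and
      cancels in the rate function. The radius assumed for \<open>v\<close> is
      \<open>2 * ?s\<close>.\<close>
    let ?s = "1 / (2 * ?d * ?m)"
    have "\<alpha> \<theta> v \<le> (norm v)\<^sup>2 / (4 * ?s) + norm v ^ 4 / (16 * ?s ^ 3) + (2 * ?d * \<theta> * ?m) * ?s"
    proof (rule homogeneous_upper_bound[OF ly(2,3)[OF \<theta>]])
      fix z :: "int ^ 'd" and N assume N: "\<And>i. \<bar>z $ i\<bar> < int N"
      obtain \<omega> where \<omega>: "uniform_env \<omega>" "cost_limit \<theta> \<omega> (\<chi> i. 2 * z $ i) (\<alpha> \<theta> (lattice_to_real (\<chi> i. 2 * z $ i)))"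
        by (rule quenched[OF \<theta>])
      have "2 * ?d * real N * \<theta> * ?m = (2 * ?d * \<theta> * ?m) * real N" by simp
      with quenched_upper[OF \<omega>(1) \<theta> \<omega>(2) N]
      show "\<alpha> \<theta> (lattice_to_real (\<chi> i. 2 * z $ i))
        \<le> real N * (\<Sum>i\<in>UNIV. (real_of_int (z $ i) / real N)\<^sup>2 + (real_of_int (z $ i) / real N) ^ 4)
          + (2 * ?d * \<theta> * ?m) * real N"
        by (simp only:)
    qed (use m v in simp_all)
    also have "\<dots> = ?d * ?m / 2 * (norm v)\<^sup>2 + (?d * ?m) ^ 3 / 2 * norm v ^ 4 + \<theta>"
    proof -
      have "(norm v)\<^sup>2 / (4 * ?s) = ?d * ?m / 2 * (norm v)\<^sup>2"
        "norm v ^ 4 / (16 * ?s ^ 3) = (?d * ?m) ^ 3 / 2 * norm v ^ 4"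
        "(2 * ?d * \<theta> * ?m) * ?s = \<theta>"
        using m by (simp_all add: power_divide power_mult_distrib)
      then show ?thesis by (simp only:)
    qed
    finally show "ereal (\<alpha> \<theta> v - \<theta>) \<le> ereal (?d * ?m / 2 * (norm v)\<^sup>2 + (?d * ?m) ^ 3 / 2 * norm v ^ 4)"
      by simp
  qed
  have low: "\<exists>\<eta>>0. \<forall>v. v \<noteq> 0 \<longrightarrow> norm v < \<eta> \<longrightarrow> ereal (c * (norm v)\<^sup>2) \<le> rate_function \<alpha> v"
    if c: "c < ?d * ?m / 2" for c
  proof -
    have "0 < ?d * ?m / 2" using m by simp
    then have "max c 0 < ?d * ?m / 2" using c by (simp only: max_less_iff_conj simp_thms)
    then obtain c' where c': "max c 0 < c'" "c' < ?d * ?m / 2"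
      using dense by blast
    \<comment> \<open>Maximising \<open>\<beta> * sqrt \<theta> * norm v - \<theta>\<close> over
      \<open>\<theta>\<close> gives \<open>\<beta>\<^sup>2 / 4\<close> times the squared norm, which
      is to have the constant \<open>c'\<close>. Taking \<open>c'\<close> positive keeps
      \<open>\<beta>\<close> positive even for negative \<open>c\<close>.\<close>
    define \<beta> where "\<beta> = 2 * sqrt c'"
    have \<beta>: "0 < \<beta>" "\<beta>\<^sup>2 = 4 * c'" using c' by (simp_all add: \<beta>_def power_mult_distrib)
    have "\<beta>\<^sup>2 < 2 * ?d * ?m" using c'(2) unfolding \<beta>(2) by (simp add: field_simps)
    from quenched_lower[OF \<beta>(1) this] obtain \<theta>0 where \<theta>0: "0 < \<theta>0"
      "\<And>\<theta> \<omega> v a. 0 < \<theta> \<Longrightarrow> \<theta> < \<theta>0 \<Longrightarrow> uniform_env \<omega> \<Longrightarrow> cost_limit \<theta> \<omega> v a \<Longrightarrow> 0 \<le> a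
        \<Longrightarrow> \<beta> * sqrt \<theta> * norm (lattice_to_real v) \<le> a"
      unfolding eventually_at_right_field by blast
    have "ereal (c * (norm v)\<^sup>2) \<le> rate_function \<alpha> v" if v: "v \<noteq> 0" "norm v < 2 * sqrt \<theta>0 / \<beta>" for v
    proof -
      \<comment> \<open>The maximiser; it tends to 0 with \<open>v\<close>, and the bound on
        \<open>norm v\<close> puts it into the range where \<open>quenched_lower\<close>
        applies.\<close>
      define \<theta> where "\<theta> = (\<beta> * norm v / 2)\<^sup>2"
      have b0: "0 < \<beta> * norm v / 2" using \<beta> v by simp
      have \<theta>: "0 < \<theta>" unfolding \<theta>_def by (rule zero_less_power[OF b0])
      have sq: "sqrt \<theta> = \<beta> * norm v / 2" unfolding \<theta>_def using b0 by simp
      have "\<beta> * norm v / 2 < sqrt \<theta>0" using v(2) \<beta> by (simp add: field_simps)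
      then have \<theta>lt: "\<theta> < \<theta>0" unfolding sq[symmetric] by simp
      have "\<beta> * sqrt \<theta> * norm v \<le> \<alpha> \<theta> v"
      proof (rule homogeneous_lower_bound[OF ly(2,3)])
        fix z :: "int ^ 'd"
        obtain \<omega> where "uniform_env \<omega>" "cost_limit \<theta> \<omega> z (\<alpha> \<theta> (lattice_to_real z))"
          by (rule quenched[OF less_imp_le[OF \<theta>]])
        then show "\<beta> * sqrt \<theta> * norm (lattice_to_real z) \<le> \<alpha> \<theta> (lattice_to_real z)"
          by (rule \<theta>0(2)[OF \<theta> \<theta>lt]) (rule ly(1)[OF less_imp_le[OF \<theta>]])
      qed (use \<theta> in simp_all)
      moreover have "\<beta> * sqrt \<theta> * norm v - \<theta> = c' * (norm v)\<^sup>2"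
      proof -
        have "\<beta> * sqrt \<theta> * norm v - \<theta> = \<beta>\<^sup>2 * (norm v)\<^sup>2 / 4"
          unfolding sq unfolding \<theta>_def by (simp add: power2_eq_square field_simps)
        then show ?thesis by (simp add: \<beta>(2))
      qed
      moreover have "c * (norm v)\<^sup>2 \<le> c' * (norm v)\<^sup>2" using c' by (intro mult_right_mono) auto
      ultimately have "ereal (c * (norm v)\<^sup>2) \<le> ereal (\<alpha> \<theta> v - \<theta>)" by simp
      also have "\<dots> \<le> rate_function \<alpha> v"
        unfolding rate_function_def by (rule SUP_upper) (use \<theta> in simp)
      finally show ?thesis .
    qed
    moreover have "0 < 2 * sqrt \<theta>0 / \<beta>" using \<theta>0(1) \<beta>(1) by simp
    ultimately show ?thesis by blast
  qed
  have nn: "0 \<le> rate_function \<alpha> v" for v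
  proof -
    have "0 \<le> ereal (\<alpha> 0 v - 0)" using ly(1)[of 0 v] by simp
    also have "\<dots> \<le> rate_function \<alpha> v"
      unfolding rate_function_def by (rule SUP_upper) simp
    finally show ?thesis .
  qed
  have "0 < ?d * ?m / 2" "0 < 1 / (?d * ?m)" using m by simp_all
  from quadratic_rate_asymptotics[OF this(1) nn up this(2) low, of x]
  have main: "\<exists>\<epsilon> :: real \<Rightarrow> real. (\<epsilon> \<longlongrightarrow> 0) (at 0) \<and>
    (\<forall>\<^sub>F l in at 0. rate_function \<alpha> (l *\<^sub>R x) = ereal (?d * ?m / 2 * l\<^sup>2 * (norm x)\<^sup>2 * (1 + \<epsilon> l)))" .
  have "?d / 2 * ?m = ?d * ?m / 2" by simp
  then show ?thesis
    unfolding meq using main by (simp only:)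
qed

end
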